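(* For each $q\in\{1,3\}$, computing $\mathrm{TV}_{4,q}(\mathfrak{T})$ on an $n$-tetrahedron triangulation $\mathfrak{T}$ of a closed $3$-manifold reduces to $\mathrm{poly}(n)$ calls to the following two counting problems, both of which belong to the class $\#\mathrm{P}$: Counting even octagons colourings: given a triangulation $\mathfrak{T}$ of a closed $3$-manifold and an integer $m$, output $b_m^+$, the number of $\hat\theta\in\mathrm{Adm}(\mathfrak{T},4)$ with an even number of octagons and $\chi(S_\theta)=m$, where $\theta$ is the reduction of $\hat\theta$. Counting odd octagons colourings: given a triangulation $\mathfrak{T}$ of a closed $3$-manifold and an integer $m$, output $b_m^-$, the number of $\hat\theta\in\mathrm{Adm}(\mathfrak{T},4)$ with an odd number of octagons and $\chi(S_\theta)=m$, where $\theta$ is the reduction of $\hat\theta$.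
   Context: Triangulations. A (generalised) triangulation $\mathfrak{T}$ of a closed $3$-manifold $M$ is a collection of $n$ abstract tetrahedra together with $2n$ gluing maps identifying their $4n$ triangular faces in pairs such that the underlying topological space is homeomorphic to $M$. Vertices, edges and triangles of $\mathfrak{T}$ are the equivalence classes of vertices, edges and triangles of the tetrahedra under the gluings; $V,E,F,T$ denote the sets of vertices, edges, triangles and tetrahedra of $\mathfrak{T}$. Admissible colourings. For an integer $r\ge 3$, $\mathrm{Adm}(\mathfrak{T},r)$ is the set of maps $\theta: E\to\{0,\tfrac12,1,\dots,\tfrac{r-2}{2}\}$ such that for every triangle of $\mathfrak{T}$ with edges $e_1,e_2,e_3$: $\theta(e_1)+\theta(e_2)+\theta(e_3)\in\mathbb{Z}$; $\theta(e_i)\le\theta(e_j)+\theta(e_k)$ for $\{i,j,k\}=\{1,2,3\}$; and $\theta(e_1)+\theta(e_2)+\theta(e_3)\le r-2$. Reduction, octagons and surfaces. The reduction $\theta$ of $\hat\theta\in\mathrm{Adm}(\mathfrak{T},4)$ is defined by $\theta(e)=\hat\theta(e)-\lfloor\hat\theta(e)\rfloor$ for every $e\in E$; it lies in $\mathrm{Adm}(\mathfrak{T},3)$. The number of octagons of $\hat\theta$ is the number of tetrahedra in which $\hat\theta$ colours one pair of opposite edges by $1$ and the other four edges by $\tfrac12$. For $\theta\in\mathrm{Adm}(\mathfrak{T},3)$, $S_\theta$ is the surface embedded in $\mathfrak{T}$, transverse to its faces, which meets each edge $e$ in exactly $2\theta(e)\in\{0,1\}$ points, meets each triangle coloured $(0,\tfrac12,\tfrac12)$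 (up to permutation) in one straight segment joining its two $\tfrac12$-coloured edges, and meets each tetrahedron in the empty set, one triangular disk (if exactly the three edges at one vertex of the tetrahedron are coloured $\tfrac12$), or one quadrilateral disk (if exactly the four edges other than a pair of opposite edges are coloured $\tfrac12$). $\chi$ denotes the Euler characteristic. Weights ($r=4$, $0<q<8$, $\gcd(4,q)=1$). Let $\zeta=e^{i\pi q/4}$, $[k]=(\zeta^k-\zeta^{-k})/(\zeta-\zeta^{-1})$ for $k\ge1$, $[0]=1$, and $[k]!=[k][k-1]\cdots[0]$. For $\theta\in\mathrm{Adm}(\mathfrak{T},4)$: an edge $e$ of colour $i$ has weight $|e|_\theta=(-1)^{2i}[2i+1]$; a triangle $f$ with edge colours $i,j,k$ has weight $$|f|_\theta=(-1)^{i+j+k}\frac{[i+j-k]!\,[i+k-j]!\,[j+k-i]!}{[i+j+k+1]!}.$$ For a tetrahedron $t$ with edge colours $i_0,\dots,i_5$, labelled so that its triangles have colours $(i_0,i_1,i_3),(i_0,i_2,i_4),(i_1,i_2,i_5),(i_3,i_4,i_5)$ and its opposite edge pairs have colours $(i_0,i_5),(i_1,i_4),(i_2,i_3)$, $$|t|_\theta=\sum_{s}\frac{(-1)^s[s+1]!}{\tau(s)\,\kappa(s)},$$ where $\tau(s)=[s-i_0-i_1-i_3]!\,[s-i_0-i_2-i_4]!\,[s-i_1-i_2-i_5]!\,[s-i_3-i_4-i_5]!$, $\kappa(s)=[i_0+i_1+i_4+i_5-s]!\,[i_0+i_2+i_3+i_5-s]!\,[i_1+i_2+i_3+i_4-s]!$,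 and $s$ ranges over all integers for which all bracket-factorial arguments in $\tau(s),\kappa(s)$ are non-negative. By convention the constant vertex weight $\tfrac14$ per vertex is omitted: the weight of $\theta$ is $|\mathfrak{T}|_\theta=\prod_{e\in E}|e|_\theta\prod_{f\in F}|f|_\theta\prod_{t\in T}|t|_\theta$, and $\mathrm{TV}_{4,q}(\mathfrak{T})=\sum_{\theta\in\mathrm{Adm}(\mathfrak{T},4)}|\mathfrak{T}|_\theta$. Values of $\mathrm{TV}_{4,q}$ are represented symbolically as elements of $\mathbb{Z}[\sqrt2]$ (or its localisation at $2$). *)

theory Defs
  imports
    "HOL-Analysis.Analysis"
    "HOL-Homology.Simplices"
    "HOL-Computational_Algebra.Polynomial"
    "HOL-Library.Log_Nat"
begin

section \<open>Triangulations of closed 3-manifolds\<close>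

text \<open>
  \<open>T ! t ! f = (u, [p0, p1, p2, p3])\<close>: the face of tetrahedron \<open>t\<close> opposite to its vertex
  \<open>f\<close> is glued to a face of tetrahedron \<open>u\<close>, each vertex \<open>v \<noteq> f\<close> of \<open>t\<close> going to the vertex
  \<open>p\<^sub>v\<close> of \<open>u\<close>; the remaining entry \<open>p\<^sub>f\<close> is then the vertex of \<open>u\<close> opposite to the target face.
\<close>

type_synonym triangulation = "(nat \<times> nat list) list list"

abbreviation num_tets :: "triangulation \<Rightarrow> nat" where
  "num_tets T \<equiv> length T"

definition adj :: "triangulation \<Rightarrow> nat \<Rightarrow> nat \<Rightarrow> nat" where
  "adj T t f = fst (T ! t ! f)"

definition perm :: "triangulation \<Rightarrow> nat \<Rightarrow> nat \<Rightarrow> nat \<Rightarrow> nat" where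
  "perm T t f v = snd (T ! t ! f) ! v"

definition face_pairing :: "triangulation \<Rightarrow> bool" where
  "face_pairing T \<longleftrightarrow>
     (\<forall>t < num_tets T. length (T ! t) = 4 \<and>
       (\<forall>f < 4. length (snd (T ! t ! f)) = 4 \<and>
          adj T t f < num_tets T \<and>
          bij_betw (perm T t f) {..<4} {..<4} \<and>
          (adj T t f, perm T t f f) \<noteq> (t, f) \<and>
          adj T (adj T t f) (perm T t f f) = t \<and>
          (\<forall>v < 4. perm T (adj T t f) (perm T t f f) (perm T t f v) = v)))"

text \<open>
  The underlying space: points of tetrahedron \<open>t\<close> are pairs \<open>(t, x)\<close> with barycentric
  coordinates \<open>x\<close>; the gluing maps are affine.
\<close>

definition glue_points ::
    "triangulation \<Rightarrow> ((nat \<times> (nat \<Rightarrow> real)) \<times> (nat \<times> (nat \<Rightarrow> real))) set" where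
  "glue_points T = {((t, x), (u, y)). t < num_tets T \<and>
     x \<in> standard_simplex 3 \<and> y \<in> standard_simplex 3 \<and>
     (\<exists>f < 4. x f = 0 \<and> u = adj T t f \<and> (\<forall>v < 4. y (perm T t f v) = x v))}"

definition disjoint_tets :: "triangulation \<Rightarrow> (nat \<times> (nat \<Rightarrow> real)) topology" where
  "disjoint_tets T = prod_topology (discrete_topology {..<num_tets T})
     (subtopology (powertop_real UNIV) (standard_simplex 3))"

definition closed_3_manifold :: "'a topology \<Rightarrow> bool" where
  "closed_3_manifold X \<longleftrightarrow>
     compact_space X \<and> Hausdorff_space X \<and> second_countable X \<and>
     (\<forall>x \<in> topspace X. \<exists>U V. openin X U \<and> x \<in> U \<and> openin (Euclidean_space 3) V \<and>
        subtopology X U homeomorphic_space subtopology (Euclidean_space 3) V)"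

definition closed_3_manifold_triangulation :: "triangulation \<Rightarrow> bool" where
  "closed_3_manifold_triangulation T \<longleftrightarrow> face_pairing T \<and>
     (\<exists>X. quotient_map (disjoint_tets T) X (\<lambda>p. (glue_points T)\<^sup>* `` {p}) \<and> closed_3_manifold X)"

text \<open>
  A face of a tetrahedron is a pair \<open>(t, A)\<close> of a tetrahedron and the set of its vertices;
  edges and triangles of the triangulation are classes of these.
\<close>

definition glue_faces :: "triangulation \<Rightarrow> ((nat \<times> nat set) \<times> (nat \<times> nat set)) set" where
  "glue_faces T = {((t, A), (u, B)). t < num_tets T \<and>
     (\<exists>f < 4. A \<subseteq> {..<4} - {f} \<and> u = adj T t f \<and> B = perm T t f ` A)}"

definition face_class :: "triangulation \<Rightarrow> nat \<Rightarrow> nat set \<Rightarrow> (nat \<times> nat set) set" where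
  "face_class T t A = (glue_faces T)\<^sup>* `` {(t, A)}"

definition edges :: "triangulation \<Rightarrow> (nat \<times> nat set) set set" where
  "edges T = {face_class T t A | t A. t < num_tets T \<and> A \<subseteq> {..<4} \<and> card A = 2}"

definition triangles :: "triangulation \<Rightarrow> (nat \<times> nat set) set set" where
  "triangles T = {face_class T t A | t A. t < num_tets T \<and> A \<subseteq> {..<4} \<and> card A = 3}"


section \<open>Admissible colourings, octagons, surfaces\<close>

type_synonym colouring = "(nat \<times> nat set) set \<Rightarrow> real"

abbreviation colour :: "triangulation \<Rightarrow> colouring \<Rightarrow> nat \<Rightarrow> nat set \<Rightarrow> real" where
  "colour T \<theta> t A \<equiv> \<theta> (face_class T t A)"

text \<open>\<open>i, j, k\<close> are the colours of the edges of the triangle \<open>F\<close>, in some order.\<close>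

definition triangle_coloured ::
    "triangulation \<Rightarrow> colouring \<Rightarrow> (nat \<times> nat set) set \<Rightarrow> real \<Rightarrow> real \<Rightarrow> real \<Rightarrow> bool" where
  "triangle_coloured T \<theta> F i j k \<longleftrightarrow>
     (\<exists>t a b c. (t, {a, b, c}) \<in> F \<and> a \<noteq> b \<and> a \<noteq> c \<and> b \<noteq> c \<and>
        i = colour T \<theta> t {a, b} \<and> j = colour T \<theta> t {a, c} \<and> k = colour T \<theta> t {b, c})"

definition Adm :: "triangulation \<Rightarrow> nat \<Rightarrow> colouring set" where
  "Adm T r = {\<theta> \<in> edges T \<rightarrow>\<^sub>E {real c / 2 | c. c \<le> r - 2}.
     \<forall>F \<in> triangles T. \<forall>i j k. triangle_coloured T \<theta> F i j k \<longrightarrow>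
       i + j + k \<in> \<int> \<and> i \<le> j + k \<and> j \<le> i + k \<and> k \<le> i + j \<and> i + j + k \<le> real r - 2}"

definition reduction :: "triangulation \<Rightarrow> colouring \<Rightarrow> colouring" where
  "reduction T \<theta> = (\<lambda>e \<in> edges T. \<theta> e - \<lfloor>\<theta> e\<rfloor>)"

definition octagons :: "triangulation \<Rightarrow> colouring \<Rightarrow> nat set" where
  "octagons T \<theta> = {t. t < num_tets T \<and>
     (\<exists>A \<subseteq> {..<4}. card A = 2 \<and>
        (\<forall>B \<subseteq> {..<4}. card B = 2 \<longrightarrow>
           colour T \<theta> t B = (if B = A \<or> B = {..<4} - A then 1 else 1/2)))}"

text \<open>
  The surface \<open>S\<^sub>\<theta>\<close> of \<open>\<theta> \<in> Adm T 3\<close>, given by the cells in which it meets the edges, triangles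
  and tetrahedra of \<open>T\<close>. Each edge, triangle and tetrahedron contains at most one cell, so the
  cells are indexed by the faces containing them.
\<close>

definition surface_points :: "triangulation \<Rightarrow> colouring \<Rightarrow> (nat \<times> nat set) set set" where
  "surface_points T \<theta> = {e \<in> edges T. 2 * \<theta> e = 1}"

definition surface_segments :: "triangulation \<Rightarrow> colouring \<Rightarrow> (nat \<times> nat set) set set" where
  "surface_segments T \<theta> = {F \<in> triangles T. triangle_coloured T \<theta> F 0 (1/2) (1/2)}"

definition triangular_discs :: "triangulation \<Rightarrow> colouring \<Rightarrow> nat set" where
  "triangular_discs T \<theta> = {t. t < num_tets T \<and>
     (\<exists>v < 4. \<forall>B \<subseteq> {..<4}. card B = 2 \<longrightarrow> (colour T \<theta> t B = 1/2 \<longleftrightarrow> v \<in> B))}"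

definition quadrilateral_discs :: "triangulation \<Rightarrow> colouring \<Rightarrow> nat set" where
  "quadrilateral_discs T \<theta> = {t. t < num_tets T \<and>
     (\<exists>A \<subseteq> {..<4}. card A = 2 \<and>
        (\<forall>B \<subseteq> {..<4}. card B = 2 \<longrightarrow>
           (colour T \<theta> t B = 1/2 \<longleftrightarrow> B \<noteq> A \<and> B \<noteq> {..<4} - A)))}"

definition euler_char_surface :: "triangulation \<Rightarrow> colouring \<Rightarrow> int" where
  "euler_char_surface T \<theta> =
     int (card (surface_points T \<theta>)) - int (card (surface_segments T \<theta>))
     + int (card (triangular_discs T \<theta> \<union> quadrilateral_discs T \<theta>))"

definition b_even :: "triangulation \<Rightarrow> int \<Rightarrow> nat" where
  "b_even T m = card {\<theta> \<in> Adm T 4. even (card (octagons T \<theta>)) \<and>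
     euler_char_surface T (reduction T \<theta>) = m}"

definition b_odd :: "triangulation \<Rightarrow> int \<Rightarrow> nat" where
  "b_odd T m = card {\<theta> \<in> Adm T 4. odd (card (octagons T \<theta>)) \<and>
     euler_char_surface T (reduction T \<theta>) = m}"


section \<open>The Turaev-Viro invariant for r = 4\<close>

definition zeta :: "nat \<Rightarrow> complex" where
  "zeta q = exp (\<i> * of_real pi * of_nat q / 4)"

definition qint :: "nat \<Rightarrow> nat \<Rightarrow> complex" where
  "qint q k = (if k = 0 then 1
     else (zeta q ^ k - inverse (zeta q) ^ k) / (zeta q - inverse (zeta q)))"

definition qfact :: "nat \<Rightarrow> nat \<Rightarrow> complex" where
  "qfact q k = (\<Prod>j\<le>k. qint q j)"

text \<open>
  Colours are half-integers; the arguments below are non-negative integers for admissible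
  colourings, and \<open>nat \<lfloor>_\<rfloor>\<close> only changes the type.
\<close>

definition edge_weight :: "nat \<Rightarrow> real \<Rightarrow> complex" where
  "edge_weight q i = (-1) ^ nat \<lfloor>2 * i\<rfloor> * qint q (nat \<lfloor>2 * i + 1\<rfloor>)"

definition triangle_weight :: "nat \<Rightarrow> real \<Rightarrow> real \<Rightarrow> real \<Rightarrow> complex" where
  "triangle_weight q i j k = (-1) ^ nat \<lfloor>i + j + k\<rfloor> *
     (qfact q (nat \<lfloor>i + j - k\<rfloor>) * qfact q (nat \<lfloor>i + k - j\<rfloor>) * qfact q (nat \<lfloor>j + k - i\<rfloor>)
      / qfact q (nat \<lfloor>i + j + k + 1\<rfloor>))"

definition tet_weight ::
    "nat \<Rightarrow> real \<Rightarrow> real \<Rightarrow> real \<Rightarrow> real \<Rightarrow> real \<Rightarrow> real \<Rightarrow> complex" where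
  "tet_weight q i0 i1 i2 i3 i4 i5 =
     (let lower = [i0 + i1 + i3, i0 + i2 + i4, i1 + i2 + i5, i3 + i4 + i5];
          upper = [i0 + i1 + i4 + i5, i0 + i2 + i3 + i5, i1 + i2 + i3 + i4];
          \<tau> = (\<lambda>s::int. \<Prod>x\<leftarrow>lower. qfact q (nat \<lfloor>of_int s - x\<rfloor>));
          \<kappa> = (\<lambda>s::int. \<Prod>x\<leftarrow>upper. qfact q (nat \<lfloor>x - of_int s\<rfloor>))
      in \<Sum>s \<in> {s. (\<forall>x \<in> set lower. 0 \<le> of_int s - x) \<and> (\<forall>x \<in> set upper. 0 \<le> x - of_int s)}.
           (-1) ^ nat s * qfact q (nat (s + 1)) / (\<tau> s * \<kappa> s))"

definition weight :: "triangulation \<Rightarrow> nat \<Rightarrow> colouring \<Rightarrow> complex" where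
  "weight T q \<theta> =
     (\<Prod>e \<in> edges T. edge_weight q (\<theta> e)) *
     (\<Prod>F \<in> triangles T.
        THE w. \<exists>i j k. triangle_coloured T \<theta> F i j k \<and> w = triangle_weight q i j k) *
     (\<Prod>t < num_tets T.
        tet_weight q (colour T \<theta> t {0,1}) (colour T \<theta> t {0,2}) (colour T \<theta> t {0,3})
                     (colour T \<theta> t {1,2}) (colour T \<theta> t {1,3}) (colour T \<theta> t {2,3}))"

definition TV4 :: "nat \<Rightarrow> triangulation \<Rightarrow> complex" where
  "TV4 q T = (\<Sum>\<theta> \<in> Adm T 4. weight T q \<theta>)"


section \<open>Oracle random access machines with logarithmic cost\<close>

text \<open>
  The usual integer RAM (addition, subtraction, multiplication, division, indirect addressing)
  under the logarithmic cost criterion, which is polynomially equivalent to multitape Turing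
  machines, written with structured control flow and a memory of numbered arrays.
\<close>

type_synonym memory = "nat \<Rightarrow> int \<Rightarrow> int"

datatype expr =
    Const int
  | Get nat expr
  | Add expr expr
  | Sub expr expr
  | Mul expr expr
  | Div expr expr

datatype prog =
    Skip
  | Store nat expr expr
  | Seq prog prog
  | If_Pos expr prog prog
  | While_Pos expr prog
  | Query nat nat nat

fun ev :: "memory \<Rightarrow> expr \<Rightarrow> int" where
  "ev s (Const c) = c"
| "ev s (Get a e) = s a (ev s e)"
| "ev s (Add e1 e2) = ev s e1 + ev s e2"
| "ev s (Sub e1 e2) = ev s e1 - ev s e2"
| "ev s (Mul e1 e2) = ev s e1 * ev s e2"
| "ev s (Div e1 e2) = ev s e1 div ev s e2"

text \<open>Number of binary digits, plus one for the sign.\<close>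

definition int_size :: "int \<Rightarrow> nat" where
  "int_size x = floorlog 2 (nat \<bar>x\<bar>) + 1"

definition list_size :: "int list \<Rightarrow> nat" where
  "list_size xs = (\<Sum>x\<leftarrow>xs. int_size x)"

fun ev_cost :: "memory \<Rightarrow> expr \<Rightarrow> nat" where
  "ev_cost s (Const c) = int_size c"
| "ev_cost s (Get a e) = ev_cost s e + int_size (s a (ev s e))"
| "ev_cost s (Add e1 e2) = ev_cost s e1 + ev_cost s e2 + int_size (ev s e1 + ev s e2)"
| "ev_cost s (Sub e1 e2) = ev_cost s e1 + ev_cost s e2 + int_size (ev s e1 - ev s e2)"
| "ev_cost s (Mul e1 e2) = ev_cost s e1 + ev_cost s e2 + int_size (ev s e1 * ev s e2)"
| "ev_cost s (Div e1 e2) = ev_cost s e1 + ev_cost s e2 + int_size (ev s e1 div ev s e2)"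

text \<open>A list is stored in an array with its length at index 0 and its entries from index 1 on.\<close>

definition read_list :: "memory \<Rightarrow> nat \<Rightarrow> int list" where
  "read_list s a = map (\<lambda>i. s a (int i + 1)) [0..<nat (s a 0)]"

definition load :: "int list list \<Rightarrow> memory" where
  "load xss = (\<lambda>a i.
     if a < length xss \<and> i = 0 then int (length (xss ! a))
     else if a < length xss \<and> 1 \<le> i \<and> i \<le> int (length (xss ! a)) then xss ! a ! nat (i - 1)
     else 0)"

definition store :: "memory \<Rightarrow> nat \<Rightarrow> int \<Rightarrow> int \<Rightarrow> memory" where
  "store s a i x = s(a := (s a)(i := x))"

text \<open>
  \<open>exec \<O> c s n k s'\<close>: program \<open>c\<close>, started in \<open>s\<close>, halts in \<open>s'\<close> after time \<open>n\<close> and \<open>k\<close> oracle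
  calls. \<open>Query j a b\<close> asks oracle \<open>j\<close> for the list in array \<open>a\<close> and puts the answer at index 0
  of array \<open>b\<close>; it is charged for the sizes of the query and of the answer.
\<close>

inductive exec ::
    "(nat \<Rightarrow> int list \<Rightarrow> int) \<Rightarrow> prog \<Rightarrow> memory \<Rightarrow> nat \<Rightarrow> nat \<Rightarrow> memory \<Rightarrow> bool"
  for \<O> :: "nat \<Rightarrow> int list \<Rightarrow> int" where
  exec_Skip: "exec \<O> Skip s 1 0 s"
| exec_Store: "exec \<O> (Store a e1 e2) s (1 + ev_cost s e1 + ev_cost s e2) 0
                 (store s a (ev s e1) (ev s e2))"
| exec_Seq: "exec \<O> c1 s n1 k1 s1 \<Longrightarrow> exec \<O> c2 s1 n2 k2 s2 \<Longrightarrow>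
    exec \<O> (Seq c1 c2) s (n1 + n2) (k1 + k2) s2"
| exec_If_True: "ev s e > 0 \<Longrightarrow> exec \<O> c1 s n k s1 \<Longrightarrow>
    exec \<O> (If_Pos e c1 c2) s (1 + ev_cost s e + n) k s1"
| exec_If_False: "\<not> ev s e > 0 \<Longrightarrow> exec \<O> c2 s n k s1 \<Longrightarrow>
    exec \<O> (If_Pos e c1 c2) s (1 + ev_cost s e + n) k s1"
| exec_While_True: "ev s e > 0 \<Longrightarrow> exec \<O> c s n1 k1 s1 \<Longrightarrow>
    exec \<O> (While_Pos e c) s1 n2 k2 s2 \<Longrightarrow>
    exec \<O> (While_Pos e c) s (1 + ev_cost s e + n1 + n2) (k1 + k2) s2"
| exec_While_False: "\<not> ev s e > 0 \<Longrightarrow> exec \<O> (While_Pos e c) s (1 + ev_cost s e) 0 s"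
| exec_Query: "x = read_list s a \<Longrightarrow>
    exec \<O> (Query j a b) s (1 + int_size (s a 0) + list_size x + int_size (\<O> j x)) 1
      (store s b 0 (\<O> j x))"


section \<open>The class #P and oracle reductions\<close>

text \<open>
  A counting problem is a set of pairs (instance, answer); its instances need not be all integer
  lists (a promise problem, here: the input encodes a triangulation of a closed 3-manifold).
\<close>

type_synonym counting_problem = "(int list \<times> nat) set"

definition bit_strings :: "nat \<Rightarrow> int list set" where
  "bit_strings l = {w. length w = l \<and> set w \<subseteq> {0, 1}}"

text \<open>
  Functions counting the accepted witnesses of polynomial length of a polynomial-time verifier.
  The verifier runs with the constant oracle 0, that is, without oracle; it accepts
  by leaving a positive number at index 0 of array 0.
\<close>

definition sharpP :: "(int list \<Rightarrow> nat) set" where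
  "sharpP = {g. \<exists>(c::prog) (l::nat poly) (p::nat poly). \<forall>x.
     (\<forall>w \<in> bit_strings (poly l (list_size x)).
        \<exists>n k s. exec (\<lambda>_ _. 0) c (load [x, w]) n k s \<and> n \<le> poly p (list_size x)) \<and>
     g x = card {w \<in> bit_strings (poly l (list_size x)).
        \<exists>n k s. exec (\<lambda>_ _. 0) c (load [x, w]) n k s \<and> s 0 0 > 0}}"

definition in_sharpP :: "counting_problem \<Rightarrow> bool" where
  "in_sharpP P \<longleftrightarrow> (\<exists>g \<in> sharpP. \<forall>(x, y) \<in> P. g x = y)"

definition solves :: "(int list \<Rightarrow> int) \<Rightarrow> counting_problem \<Rightarrow> bool" where
  "solves h P \<longleftrightarrow> (\<forall>(x, y) \<in> P. h x = int y)"

definition encode :: "triangulation \<Rightarrow> int list" where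
  "encode T = int (num_tets T) # concat (map (\<lambda>gs. concat (map (\<lambda>(u, ps). int u # map int ps) gs)) T)"

definition encode_with :: "triangulation \<Rightarrow> int \<Rightarrow> int list" where
  "encode_with T m = m # encode T"

definition counting_even_octagons :: counting_problem where
  "counting_even_octagons =
     {(encode_with T m, b_even T m) | T m. closed_3_manifold_triangulation T}"

definition counting_odd_octagons :: counting_problem where
  "counting_odd_octagons =
     {(encode_with T m, b_odd T m) | T m. closed_3_manifold_triangulation T}"

text \<open>Symbolic values in the localisation of \<open>\<int>[\<surd>2]\<close> at 2: \<open>[a, b, d]\<close> stands for
  \<open>(a + b \<surd>2) / d\<close> with \<open>d\<close> a power of 2.\<close>

definition represents :: "int list \<Rightarrow> complex \<Rightarrow> bool" where
  "represents xs z \<longleftrightarrow> (\<exists>a b h. xs = [a, b, 2 ^ h] \<and>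
     z = (of_int a + of_int b * of_real (sqrt 2)) / 2 ^ h)"

text \<open>
  A polynomial-time program computing \<open>F T\<close> from a triangulation \<open>T\<close> of a closed 3-manifold with
  \<open>n\<close> tetrahedra by poly(n) calls to arbitrary oracles for \<open>P\<close> and \<open>Q\<close>. The oracles are
  only constrained on the instances of \<open>P\<close> and \<open>Q\<close>.
\<close>

definition reduces_by_poly_calls ::
    "(triangulation \<Rightarrow> complex) \<Rightarrow> counting_problem \<Rightarrow> counting_problem \<Rightarrow> bool" where
  "reduces_by_poly_calls F P Q \<longleftrightarrow>
     (\<exists>(c::prog) (p::nat poly) (calls::nat poly).
        \<forall>T. closed_3_manifold_triangulation T \<longrightarrow>
          (\<forall>\<O>. solves (\<O> 0) P \<and> solves (\<O> 1) Q \<longrightarrow>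
             (\<exists>n k s. exec \<O> c (load [encode T]) n k s \<and>
                n \<le> poly p (list_size (encode T)) \<and>
                k \<le> poly calls (num_tets T) \<and>
                represents (read_list s 0) (F T))))"

end

theory Submission
  imports Defs
begin

text \<open>
  For \<open>r = 4\<close> and \<open>q \<in> {1, 3}\<close> the quantum integers are \<open>[1] = [3] = 1\<close> and \<open>[2] = x = \<plusminus>\<surd>2\<close>, and all
  nonzero weights are powers of \<open>x\<close> up to sign. Points, segments and discs of the surface of the
  reduced colouring contribute \<open>-x\<close>, \<open>-1 / x\<close> and \<open>-x\<close>, and the remaining signs cancel except for one
  per octagon, since every triangle has exactly two sides. Hence \<open>TV\<close> is the sum of
  \<open>(b\<^sub>m\<^sup>+ - b\<^sub>m\<^sup>-) (-x)\<^sup>m\<close> over the linearly many possible Euler characteristics \<open>m\<close>, which a Horner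
  scheme evaluates in \<open>\<int>[\<surd>2]\<close>. For membership in \<open>#P\<close> a colouring is guessed as two bits for each
  ordered pair of vertices of each tetrahedron; its admissibility is a local condition, and the only
  global quantity, the number of edge classes coloured 1/2, is found by a reachability computation.
\<close>

section \<open>Step counting and bit growth\<close>

text \<open>Both claims require explicit programs for a machine whose cost depends on the lengths of
  the numbers it handles. They are therefore written in a small language of bounded sums and loops,
  whose meaning (\<open>val\<close>, \<open>run\<close>) is an ordinary function, and compiled once
  and for all. The syntax yields a polynomial number of unit-cost steps, and
  \<open>exec_of_steps\<close> turns these into a polynomial cost. Three points shape the programs.
  Loop bounds must not change while loops run, so they are computed in a separate first phase. The
  verifier must stop in time on every list of integers, encoding or not, and every colouring must
  have exactly one accepted witness, so all bits that a colouring leaves free are pinned down.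
  Finally, the evaluation has to stay in the integers although Euler characteristics may be
  negative; since the square of \<open>x\<close> is 2, an even shift of all exponents costs only a
  power of 2 in the denominator.\<close>

lemma int_size_le_iff: "int_size x \<le> Suc b \<longleftrightarrow> \<bar>x\<bar> < 2 ^ b"
  unfolding int_size_def by (simp add: floorlog_le_iff nat_less_iff)

lemma int_size_pos: "1 \<le> int_size x"
  by (simp add: int_size_def)

lemma int_size_mono: "\<bar>x\<bar> \<le> \<bar>y\<bar> \<Longrightarrow> int_size x \<le> int_size y"
  unfolding int_size_def by (simp add: floorlog_mono nat_mono)

lemma int_size_uminus [simp]: "int_size (- x) = int_size x"
  by (simp add: int_size_def)

lemma int_size_add: "int_size (x + y) \<le> Suc (max (int_size x) (int_size y))"
proof -
  define b where "b = max (int_size x) (int_size y) - 1"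
  have b: "max (int_size x) (int_size y) = Suc b"
    using int_size_pos[of x] by (simp add: b_def)
  have "int_size x \<le> Suc b" "int_size y \<le> Suc b" using b by auto
  then have "\<bar>x\<bar> < 2 ^ b" "\<bar>y\<bar> < 2 ^ b" by (simp_all add: int_size_le_iff)
  then have "\<bar>x + y\<bar> < 2 ^ Suc b" by simp
  then show ?thesis unfolding b by (simp only: int_size_le_iff)
qed

lemma int_size_diff: "int_size (x - y) \<le> Suc (max (int_size x) (int_size y))"
  using int_size_add[of x "- y"] by simp

lemma int_size_mult: "int_size (x * y) \<le> int_size x + int_size y"
proof -
  obtain a b where a: "int_size x = Suc a" and b: "int_size y = Suc b"
    using int_size_pos by (metis Suc_le_D One_nat_def)
  have "\<bar>x\<bar> < 2 ^ a" "\<bar>y\<bar> < 2 ^ b"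
    using a b by (simp_all flip: int_size_le_iff)
  then have "\<bar>x * y\<bar> < 2 ^ (a + b)"
    by (simp add: abs_mult power_add mult_strict_mono')
  then have "int_size (x * y) \<le> Suc (a + b)" by (simp add: int_size_le_iff)
  then show ?thesis using a b by simp
qed

text \<open>\<open>div\<close> rounds down, so rounding can enlarge a negative quotient in absolute
  value; comparison with the divisor 1 shows that it still never passes the dividend. Negating both
  numbers reduces to a positive divisor, and division by 0 gives 0.\<close>

lemma int_size_div: "int_size (x div y) \<le> int_size x"
proof (rule int_size_mono)
  show "\<bar>x div y\<bar> \<le> \<bar>x\<bar>"
  proof (cases "x = 0 \<or> y = 0")
    case False
    have *: "\<bar>u div v\<bar> \<le> \<bar>u\<bar>" if "v > 0" "u \<noteq> 0" for u v :: int
    proof (cases "u > 0")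
      case True
      then show ?thesis using that pos_imp_zdiv_nonneg_iff[of v u] zdiv_mono2[of u 1 v] by auto
    next
      case False
      have "u div 1 \<le> u div v" using zdiv_mono2_neg[of u 1 v] that False by auto
      moreover have "u div v < 0" using that False by (simp add: neg_imp_zdiv_neg_iff pos_imp_zdiv_neg_iff)
      ultimately show ?thesis by simp
    qed
    show ?thesis
    proof (cases "y > 0")
      case True then show ?thesis using * False by auto
    next
      case f: False
      have "\<bar>(- x) div (- y)\<bar> \<le> \<bar>- x\<bar>" using * [of "- y" "- x"] f False by auto
      then show ?thesis by simp
    qed
  qed auto
qed

text \<open>Products are only allowed with a constant factor: then one expression adds only a constant
  number of bits to the numbers in memory, so that values stay short during polynomially many
  steps.\<close>

fun linear_expr :: "expr \<Rightarrow> bool" where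
  "linear_expr (Const c) = True"
| "linear_expr (Get a e) = linear_expr e"
| "linear_expr (Add e1 e2) = (linear_expr e1 \<and> linear_expr e2)"
| "linear_expr (Sub e1 e2) = (linear_expr e1 \<and> linear_expr e2)"
| "linear_expr (Mul e1 e2) = ((\<exists>c. e1 = Const c) \<and> linear_expr e2)"
| "linear_expr (Div e1 e2) = (linear_expr e1 \<and> linear_expr e2)"

fun linear_prog :: "prog \<Rightarrow> bool" where
  "linear_prog Skip = True"
| "linear_prog (Store a e1 e2) = (linear_expr e1 \<and> linear_expr e2)"
| "linear_prog (Seq c1 c2) = (linear_prog c1 \<and> linear_prog c2)"
| "linear_prog (If_Pos e c1 c2) = (linear_expr e \<and> linear_prog c1 \<and> linear_prog c2)"
| "linear_prog (While_Pos e c) = (linear_expr e \<and> linear_prog c)"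
| "linear_prog (Query j a b) = True"

text \<open>Counts the digits of constants besides the nodes, so that one number bounds both the
  bits that an evaluation can add and the number of charges it incurs.\<close>

fun expr_length :: "expr \<Rightarrow> nat" where
  "expr_length (Const c) = int_size c"
| "expr_length (Get a e) = 1 + expr_length e"
| "expr_length (Add e1 e2) = 1 + expr_length e1 + expr_length e2"
| "expr_length (Sub e1 e2) = 1 + expr_length e1 + expr_length e2"
| "expr_length (Mul e1 e2) = 1 + expr_length e1 + expr_length e2"
| "expr_length (Div e1 e2) = 1 + expr_length e1 + expr_length e2"

fun prog_length :: "prog \<Rightarrow> nat" where
  "prog_length Skip = 1"
| "prog_length (Store a e1 e2) = expr_length e1 + expr_length e2"
| "prog_length (Seq c1 c2) = prog_length c1 + prog_length c2"
| "prog_length (If_Pos e c1 c2) = expr_length e + prog_length c1 + prog_length c2"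
| "prog_length (While_Pos e c) = expr_length e + prog_length c"
| "prog_length (Query j a b) = 1"

lemma int_size_ev:
  assumes "linear_expr e" and "\<And>a i. int_size (s a i) \<le> B"
  shows "int_size (ev s e) \<le> B + expr_length e"
  using assms(1)
proof (induction e)
  case (Get a e)
  then show ?case using assms(2)[of a "ev s e"] by simp
next
  case (Add e1 e2)
  then show ?case using int_size_add[of "ev s e1" "ev s e2"] by simp
next
  case (Sub e1 e2)
  then show ?case using int_size_diff[of "ev s e1" "ev s e2"] by simp
next
  case (Mul e1 e2)
  then obtain c where "e1 = Const c" by auto
  then show ?case using Mul int_size_mult[of c "ev s e2"] by simp
next
  case (Div e1 e2)
  then show ?case using int_size_div[of "ev s e1" "ev s e2"] by simp
qed auto

text \<open>Each node is charged the size of a value that \<open>int_size_ev\<close> bounds, and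
  there are at most \<open>expr_length e\<close> nodes.\<close>

lemma ev_cost_le:
  assumes "linear_expr e" and "\<And>a i. int_size (s a i) \<le> B"
  shows "ev_cost s e \<le> expr_length e * (B + expr_length e)"
proof -
  have binary: "c + d + v \<le> (1 + k + l) * (B + (1 + k + l))"
    if "c \<le> k * (B + k)" "d \<le> l * (B + l)" "v \<le> B + (1 + k + l)" for c d v k l :: nat
  proof -
    define D where "D = B + (1 + k + l)"
    have "B + k \<le> D" "B + l \<le> D" by (simp_all add: D_def)
    then have "c \<le> k * D" "d \<le> l * D" using that(1,2) by (meson mult_le_mono2 order_trans)+
    then show ?thesis using that(3) unfolding D_def[symmetric] add_mult_distrib mult_1 by linarith
  qed
  have size: "int_size (ev s e) \<le> B + expr_length e" if "linear_expr e" for e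
    using int_size_ev[OF that assms(2)] .
  show ?thesis using assms(1)
  proof (induction e)
    case (Const c)
    then show ?case by (simp add: algebra_simps trans_le_add2)
  next
    case (Get a e)
    then show ?case using assms(2)[of a "ev s e"] by (simp add: algebra_simps)
  next
    case (Add e1 e2)
    then show ?case using binary[OF _ _ size[OF Add.prems, unfolded expr_length.simps]] by simp
  next
    case (Sub e1 e2)
    then show ?case using binary[OF _ _ size[OF Sub.prems, unfolded expr_length.simps]] by simp
  next
    case (Mul e1 e2)
    then have "linear_expr e1" by auto
    then show ?case using Mul binary[OF _ _ size[OF Mul.prems, unfolded expr_length.simps]] by simp
  next
    case (Div e1 e2)
    then show ?case using binary[OF _ _ size[OF Div.prems, unfolded expr_length.simps]] by simp
  qed
qed

text \<open>Unit-cost semantics. The parameters \<open>W\<close> and \<open>L\<close> bound the answers and the lengths of the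
  queries.\<close>

inductive steps ::
    "(nat \<Rightarrow> int list \<Rightarrow> int) \<Rightarrow> nat \<Rightarrow> nat \<Rightarrow> prog \<Rightarrow> memory \<Rightarrow> nat \<Rightarrow> memory \<Rightarrow> bool"
  for \<O> :: "nat \<Rightarrow> int list \<Rightarrow> int" and W L :: nat where
  steps_Skip: "steps \<O> W L Skip s 1 s"
| steps_Store: "s' = store s a (ev s e1) (ev s e2) \<Longrightarrow> steps \<O> W L (Store a e1 e2) s 1 s'"
| steps_Seq: "steps \<O> W L c1 s n1 s1 \<Longrightarrow> steps \<O> W L c2 s1 n2 s2 \<Longrightarrow>
    steps \<O> W L (Seq c1 c2) s (n1 + n2) s2"
| steps_If_True: "ev s e > 0 \<Longrightarrow> steps \<O> W L c1 s n s1 \<Longrightarrow>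
    steps \<O> W L (If_Pos e c1 c2) s (1 + n) s1"
| steps_If_False: "\<not> ev s e > 0 \<Longrightarrow> steps \<O> W L c2 s n s1 \<Longrightarrow>
    steps \<O> W L (If_Pos e c1 c2) s (1 + n) s1"
| steps_While_True: "ev s e > 0 \<Longrightarrow> steps \<O> W L c s n1 s1 \<Longrightarrow>
    steps \<O> W L (While_Pos e c) s1 n2 s2 \<Longrightarrow>
    steps \<O> W L (While_Pos e c) s (1 + n1 + n2) s2"
| steps_While_False: "\<not> ev s e > 0 \<Longrightarrow> steps \<O> W L (While_Pos e c) s 1 s"
| steps_Query: "int_size (\<O> j (read_list s a)) \<le> W \<Longrightarrow> s a 0 \<le> int L \<Longrightarrow>
    s' = store s b 0 (\<O> j (read_list s a)) \<Longrightarrow>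
    steps \<O> W L (Query j a b) s 1 s'"

text \<open>The price of the dearest single instruction: \<open>2 * K\<close> pays for a store,
  which evaluates two expressions, and \<open>L + 2\<close> for a query, which reads
  \<open>L\<close> cells, their number and the answer.\<close>

definition step_cost :: "nat \<Rightarrow> nat \<Rightarrow> nat \<Rightarrow> nat" where
  "step_cost K L B = 1 + (2 * K + L + 2) * (B + K)"

lemma step_cost_mono: "B \<le> B' \<Longrightarrow> step_cost K L B \<le> step_cost K L B'"
  unfolding step_cost_def by (intro add_left_mono mult_le_mono2 add_right_mono)

lemma test_cost:
  assumes "linear_expr e" "expr_length e \<le> K" "\<And>a i. int_size (s a i) \<le> B" "B \<le> B'"
  shows "1 + ev_cost s e \<le> step_cost K L B'"
proof -
  have "ev_cost s e \<le> K * (B + K)"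
    using ev_cost_le[OF assms(1,3)] assms(2) by (meson add_left_mono mult_le_mono order_trans)
  then have "1 + ev_cost s e \<le> step_cost K L B" by (simp add: step_cost_def algebra_simps)
  then show ?thesis using step_cost_mono[OF assms(4)] by (rule order_trans)
qed

lemma cost_add: "1 + e \<le> C' \<Longrightarrow> m \<le> n * C \<Longrightarrow> C \<le> C' \<Longrightarrow> 1 + e + m \<le> (1 + n) * C'"
  for e m n C C' :: nat
  using mult_le_mono2[of C C' n] unfolding add_mult_distrib by linarith

text \<open>Each step lengthens the numbers in memory by at most \<open>K\<close> bits, so
  throughout \<open>t\<close> steps they have at most \<open>B + K * t\<close> bits and no
  instruction costs more than \<open>step_cost\<close> at that size. Time and bit length are bounded
  in one induction because the price of a later instruction depends on the growth caused by earlier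
  ones. Answers of oracles are not computed by expressions; \<open>W \<le> B\<close> keeps them
  within the bound.\<close>

lemma exec_of_steps:
  assumes "steps \<O> W L c s t s'" and "linear_prog c" and "prog_length c \<le> K"
    and "\<And>a i. int_size (s a i) \<le> B" and "W \<le> B"
  shows "(\<exists>n k. exec \<O> c s n k s' \<and> k \<le> t \<and> n \<le> t * step_cost K L (B + K * t))
         \<and> (\<forall>a i. int_size (s' a i) \<le> B + K * t)"
  using assms
proof (induction arbitrary: B rule: steps.induct)
  case (steps_Skip s)
  then show ?case by (auto intro!: exI exec_Skip simp: step_cost_def intro: trans_le_add1)
next
  case (steps_Store s' s a e1 e2)
  have l: "linear_expr e1" "linear_expr e2" "expr_length e1 \<le> K" "expr_length e2 \<le> K"
    using steps_Store.prems(1,2) by auto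
  have "ev_cost s e1 \<le> K * (B + K)"
    using ev_cost_le[OF l(1) steps_Store.prems(3)] l(3)
    by (meson add_left_mono mult_le_mono order_trans)
  moreover have "ev_cost s e2 \<le> K * (B + K)"
    using ev_cost_le[OF l(2) steps_Store.prems(3)] l(4)
    by (meson add_left_mono mult_le_mono order_trans)
  ultimately have "1 + ev_cost s e1 + ev_cost s e2 \<le> step_cost K L B"
    by (simp add: step_cost_def algebra_simps)
  also have "\<dots> \<le> step_cost K L (B + K * 1)" by (rule step_cost_mono) simp
  finally have n: "1 + ev_cost s e1 + ev_cost s e2 \<le> 1 * step_cost K L (B + K * 1)" by simp
  have "int_size (ev s e2) \<le> B + K"
    using int_size_ev[OF l(2) steps_Store.prems(3)] l(4) by (meson add_left_mono order_trans)
  then have "int_size (s' x i) \<le> B + K * 1" for x i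
    using steps_Store.prems(3)[of x i] by (auto simp: steps_Store.hyps store_def)
  then show ?case
    using exec_Store[of \<O> a e1 e2 s] n steps_Store.hyps by (metis zero_le)
next
  case (steps_Seq c1 s n1 s1 c2 n2 s2)
  have l: "linear_prog c1" "linear_prog c2" "prog_length c1 \<le> K" "prog_length c2 \<le> K"
    using steps_Seq.prems(1,2) by auto
  obtain m1 k1 where 1: "exec \<O> c1 s m1 k1 s1" "k1 \<le> n1" "m1 \<le> n1 * step_cost K L (B + K * n1)"
    and b1: "\<And>a i. int_size (s1 a i) \<le> B + K * n1"
    using steps_Seq.IH(1)[OF l(1,3) steps_Seq.prems(3,4)] by blast
  obtain m2 k2 where 2: "exec \<O> c2 s1 m2 k2 s2" "k2 \<le> n2"
     "m2 \<le> n2 * step_cost K L (B + K * n1 + K * n2)"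
    and b2: "\<And>a i. int_size (s2 a i) \<le> B + K * n1 + K * n2"
    using steps_Seq.IH(2)[OF l(2,4) b1] steps_Seq.prems(4) by (meson trans_le_add1)
  have "m1 \<le> n1 * step_cost K L (B + K * (n1 + n2))"
    by (rule order_trans[OF 1(3) mult_le_mono2[OF step_cost_mono]]) simp
  then have "m1 + m2 \<le> (n1 + n2) * step_cost K L (B + K * (n1 + n2))"
    using 2(3) by (simp add: algebra_simps)
  then show ?case
    using exec_Seq[OF 1(1) 2(1)] 1(2) 2(2) b2 by (metis add_mono add.assoc distrib_left)
next
  case (steps_If_True s e c1 n s1 c2)
  have l: "linear_expr e" "linear_prog c1" "expr_length e \<le> K" "prog_length c1 \<le> K"
    using steps_If_True.prems(1,2) by auto
  obtain m k where 1: "exec \<O> c1 s m k s1" "k \<le> n" "m \<le> n * step_cost K L (B + K * n)"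
    and b1: "\<And>a i. int_size (s1 a i) \<le> B + K * n"
    using steps_If_True.IH[OF l(2,4) steps_If_True.prems(3,4)] by blast
  have "1 + ev_cost s e \<le> step_cost K L (B + K * (1 + n))"
    by (rule test_cost[OF l(1,3) steps_If_True.prems(3)]) simp
  then have "1 + ev_cost s e + m \<le> (1 + n) * step_cost K L (B + K * (1 + n))"
    using cost_add[OF _ 1(3) step_cost_mono] by simp
  moreover have "B + K * n \<le> B + K * (1 + n)" by simp
  ultimately show ?case
    using exec_If_True[OF steps_If_True.hyps(1) 1(1)] 1(2) b1
    by (meson le_trans trans_le_add2)
next
  case (steps_If_False s e c2 n s1 c1)
  have l: "linear_expr e" "linear_prog c2" "expr_length e \<le> K" "prog_length c2 \<le> K"
    using steps_If_False.prems(1,2) by auto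
  obtain m k where 1: "exec \<O> c2 s m k s1" "k \<le> n" "m \<le> n * step_cost K L (B + K * n)"
    and b1: "\<And>a i. int_size (s1 a i) \<le> B + K * n"
    using steps_If_False.IH[OF l(2,4) steps_If_False.prems(3,4)] by blast
  have "1 + ev_cost s e \<le> step_cost K L (B + K * (1 + n))"
    by (rule test_cost[OF l(1,3) steps_If_False.prems(3)]) simp
  then have "1 + ev_cost s e + m \<le> (1 + n) * step_cost K L (B + K * (1 + n))"
    using cost_add[OF _ 1(3) step_cost_mono] by simp
  moreover have "B + K * n \<le> B + K * (1 + n)" by simp
  ultimately show ?case
    using exec_If_False[OF steps_If_False.hyps(1) 1(1)] 1(2) b1
    by (meson le_trans trans_le_add2)
next
  case (steps_While_True s e c n1 s1 n2 s2)
  have l: "linear_expr e" "linear_prog c" "expr_length e \<le> K" "prog_length c \<le> K"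
    using steps_While_True.prems(1,2) by auto
  obtain m1 k1 where 1: "exec \<O> c s m1 k1 s1" "k1 \<le> n1" "m1 \<le> n1 * step_cost K L (B + K * n1)"
    and b1: "\<And>a i. int_size (s1 a i) \<le> B + K * n1"
    using steps_While_True.IH(1)[OF l(2,4) steps_While_True.prems(3,4)] by blast
  obtain m2 k2 where 2: "exec \<O> (While_Pos e c) s1 m2 k2 s2" "k2 \<le> n2"
     "m2 \<le> n2 * step_cost K L (B + K * n1 + K * n2)"
    and b2: "\<And>a i. int_size (s2 a i) \<le> B + K * n1 + K * n2"
    using steps_While_True.IH(2)[OF steps_While_True.prems(1,2) b1] steps_While_True.prems(4)
    by (meson trans_le_add1)
  define C where "C = step_cost K L (B + K * (1 + n1 + n2))"
  have "1 + ev_cost s e \<le> C"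
    unfolding C_def by (rule test_cost[OF l(1,3) steps_While_True.prems(3)]) simp
  moreover have "m1 \<le> n1 * C"
    unfolding C_def by (rule order_trans[OF 1(3) mult_le_mono2[OF step_cost_mono]]) (simp add: algebra_simps)
  moreover have "m2 \<le> n2 * C"
    unfolding C_def
    by (rule order_trans[OF 2(3) mult_le_mono2[OF step_cost_mono]]) (simp add: algebra_simps)
  ultimately have "1 + ev_cost s e + m1 + m2 \<le> (1 + n1 + n2) * C"
    by (simp add: algebra_simps)
  moreover have "B + K * n1 + K * n2 \<le> B + K * (1 + n1 + n2)" by (simp add: algebra_simps)
  moreover have "k1 + k2 \<le> 1 + n1 + n2" using 1(2) 2(2) by simp
  ultimately show ?case
    using exec_While_True[OF steps_While_True.hyps(1) 1(1) 2(1)] b2 unfolding C_def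
    by (meson le_trans)
next
  case (steps_While_False s e c)
  have l: "linear_expr e" "expr_length e \<le> K"
    using steps_While_False.prems(1,2) by auto
  have "1 + ev_cost s e \<le> 1 * step_cost K L (B + K * 1)"
    using test_cost[OF l steps_While_False.prems(3), of "B + K * 1"] by simp
  then show ?case
    using exec_While_False[OF steps_While_False.hyps] steps_While_False.prems(3)
    by (meson trans_le_add1 zero_le)
next
  case (steps_Query j s a s' b)
  have "list_size (read_list s a) \<le> (\<Sum>i\<leftarrow>[0..<nat (s a 0)]. B)"
    unfolding list_size_def read_list_def map_map
    by (rule sum_list_mono) (use steps_Query.prems(3) in auto)
  also have "\<dots> = nat (s a 0) * B" by (simp add: sum_list_triv)
  also have "\<dots> \<le> L * B" using steps_Query.hyps(2) by (intro mult_le_mono1) simp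
  finally have "1 + int_size (s a 0) + list_size (read_list s a) + int_size (\<O> j (read_list s a))
      \<le> 1 + B + L * B + B"
    using steps_Query.hyps(1) steps_Query.prems(3)[of a 0] steps_Query.prems(4) by linarith
  also have "\<dots> \<le> step_cost K L B" by (simp add: step_cost_def algebra_simps)
  also have "\<dots> \<le> step_cost K L (B + K * 1)" by (rule step_cost_mono) simp
  finally have n: "1 + int_size (s a 0) + list_size (read_list s a) + int_size (\<O> j (read_list s a))
      \<le> 1 * step_cost K L (B + K * 1)" by simp
  have "int_size (s' x i) \<le> B + K * 1" for x i
    using steps_Query.prems(3)[of x i] steps_Query.prems(4) steps_Query.hyps(1)
    by (auto simp: steps_Query.hyps(3) store_def trans_le_add1)
  then show ?case
    using exec_Query[of "read_list s a" s a \<O> j b] n steps_Query.hyps(3) by (metis order_refl)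
qed

section \<open>Determinism of execution\<close>

inductive_cases exec_SkipE: "exec \<O> Skip s n k s'"
inductive_cases exec_StoreE: "exec \<O> (Store a e1 e2) s n k s'"
inductive_cases exec_SeqE: "exec \<O> (Seq c1 c2) s n k s'"
inductive_cases exec_IfE: "exec \<O> (If_Pos e c1 c2) s n k s'"
inductive_cases exec_WhileE: "exec \<O> (While_Pos e c) s n k s'"
inductive_cases exec_QueryE: "exec \<O> (Query j a b) s n k s'"

text \<open>Acceptance in \<open>sharpP\<close> asks for some run that ends with a positive entry.
  By determinism the single run that is constructed also serves to refute acceptance.\<close>

lemma exec_deterministic:
  assumes "exec \<O> c s n k s'" and "exec \<O> c s n' k' s''"
  shows "s' = s''"
  using assms
proof (induction arbitrary: n' k' s'' rule: exec.induct)
  case (exec_Skip s)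
  from exec_Skip.prems show ?case by (rule exec_SkipE) simp
next
  case (exec_Store s a e1 e2)
  from exec_Store.prems show ?case by (rule exec_StoreE) simp
next
  case (exec_Seq c1 s n1 k1 s1 c2 n2 k2 s2)
  from exec_Seq.prems show ?case by (rule exec_SeqE) (use exec_Seq.IH in blast)
next
  case (exec_If_True s e c1 n k s1 c2)
  from exec_If_True.prems show ?case by (rule exec_IfE) (use exec_If_True in blast)+
next
  case (exec_If_False s e c2 n k s1 c1)
  from exec_If_False.prems show ?case by (rule exec_IfE) (use exec_If_False in blast)+
next
  case (exec_While_True s e c n1 k1 s1 n2 k2 s2)
  from exec_While_True.prems show ?case by (rule exec_WhileE) (use exec_While_True in blast)+
next
  case (exec_While_False s e c)
  from exec_While_False.prems show ?case by (rule exec_WhileE) (use exec_While_False in blast)+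
next
  case (exec_Query x s a j b)
  from exec_Query.prems show ?case by (rule exec_QueryE) (use exec_Query in simp)
qed

section \<open>A language of bounded sums\<close>

text \<open>Iteration counts are constant or linear in a stored number, so that the degree of the
  time polynomial is at most the nesting depth of loops and sums.\<close>

datatype bound = Fixed nat | Times nat nat

datatype binop = Plus_Op | Minus_Op | Quot_Op

text \<open>\<open>Scale\<close> is the only product, which makes all compiled programs linear. Sums
  are the only loops inside terms; counting and bounded quantifiers are later derived from
  \<open>Sum\<close> and \<open>Cond\<close>.\<close>

datatype tm =
    Num int
  | Var nat
  | Arr nat tm
  | Bin binop tm tm
  | Scale int tm
  | Cond tm tm tm
  | Sum nat bound tm

abbreviation "Plus \<equiv> Bin Plus_Op"
abbreviation "Minus \<equiv> Bin Minus_Op"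
abbreviation "Quot \<equiv> Bin Quot_Op"

datatype stm =
    Assign nat tm tm
  | Then stm stm
  | For nat bound stm
  | Ask nat nat nat

fun bound_val :: "memory \<Rightarrow> bound \<Rightarrow> nat" where
  "bound_val s (Fixed k) = k"
| "bound_val s (Times k v) = nat (int k * s v 0)"

fun op_val :: "binop \<Rightarrow> int \<Rightarrow> int \<Rightarrow> int" where
  "op_val Plus_Op = (+)"
| "op_val Minus_Op = (-)"
| "op_val Quot_Op = (div)"

fun op_expr :: "binop \<Rightarrow> expr \<Rightarrow> expr \<Rightarrow> expr" where
  "op_expr Plus_Op = Add"
| "op_expr Minus_Op = Sub"
| "op_expr Quot_Op = Div"

lemma linear_op_expr [simp]: "linear_expr (op_expr op e1 e2) \<longleftrightarrow> linear_expr e1 \<and> linear_expr e2"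
  by (cases op) auto

lemma ev_op_expr [simp]: "ev s (op_expr op e1 e2) = op_val op (ev s e1) (ev s e2)"
  by (cases op) auto

fun val :: "memory \<Rightarrow> (nat \<Rightarrow> int) \<Rightarrow> tm \<Rightarrow> int" where
  "val s \<rho> (Num c) = c"
| "val s \<rho> (Var x) = \<rho> x"
| "val s \<rho> (Arr a t) = s a (val s \<rho> t)"
| "val s \<rho> (Bin op t u) = op_val op (val s \<rho> t) (val s \<rho> u)"
| "val s \<rho> (Scale c t) = c * val s \<rho> t"
| "val s \<rho> (Cond t u v) = (if val s \<rho> t > 0 then val s \<rho> u else val s \<rho> v)"
| "val s \<rho> (Sum x b t) = (\<Sum>i<bound_val s b. val s (\<rho>(x := int i)) t)"

fun run :: "(nat \<Rightarrow> int list \<Rightarrow> int) \<Rightarrow> stm \<Rightarrow> (nat \<Rightarrow> int) \<Rightarrow> memory \<Rightarrow> memory" where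
  "run \<O> (Assign a t u) \<rho> s = store s a (val s \<rho> t) (val s \<rho> u)"
| "run \<O> (Then c1 c2) \<rho> s = run \<O> c2 \<rho> (run \<O> c1 \<rho> s)"
| "run \<O> (For x b c) \<rho> s = fold (\<lambda>i. run \<O> c (\<rho>(x := int i))) [0..<bound_val s b] s"
| "run \<O> (Ask j a b) \<rho> s = store s b 0 (\<O> j (read_list s a))"

text \<open>Arrays from \<open>10\<close> on are registers; \<open>V\<close> is the set of the arrays that hold loop bounds.\<close>

fun wf_bound :: "nat set \<Rightarrow> bound \<Rightarrow> bool" where
  "wf_bound V (Fixed k) = True"
| "wf_bound V (Times k v) = (v \<in> V)"

fun wf_tm :: "nat set \<Rightarrow> tm \<Rightarrow> bool" where
  "wf_tm V (Num c) = True"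
| "wf_tm V (Var x) = True"
| "wf_tm V (Arr a t) = (a < 10 \<and> wf_tm V t)"
| "wf_tm V (Bin op t u) = (wf_tm V t \<and> wf_tm V u)"
| "wf_tm V (Scale c t) = wf_tm V t"
| "wf_tm V (Cond t u v) = (wf_tm V t \<and> wf_tm V u \<and> wf_tm V v)"
| "wf_tm V (Sum x b t) = (wf_bound V b \<and> wf_tm V t)"

fun wf_stm :: "nat set \<Rightarrow> stm \<Rightarrow> bool" where
  "wf_stm V (Assign a t u) = (a < 10 \<and> a \<notin> V \<and> wf_tm V t \<and> wf_tm V u)"
| "wf_stm V (Then c1 c2) = (wf_stm V c1 \<and> wf_stm V c2)"
| "wf_stm V (For x b c) = (wf_bound V b \<and> wf_stm V c)"
| "wf_stm V (Ask j a b) = (a < 10 \<and> b < 10 \<and> b \<notin> V)"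

text \<open>Whether a query is short, and its answer small, depends on the memory at the moment of
  the call. So this condition follows the run instead of being read off the syntax like
  \<open>wf_stm\<close>.\<close>

fun safe :: "(nat \<Rightarrow> int list \<Rightarrow> int) \<Rightarrow> nat \<Rightarrow> nat \<Rightarrow> stm \<Rightarrow> (nat \<Rightarrow> int) \<Rightarrow> memory \<Rightarrow> bool" where
  "safe \<O> W L (Assign a t u) \<rho> s = True"
| "safe \<O> W L (Then c1 c2) \<rho> s = (safe \<O> W L c1 \<rho> s \<and> safe \<O> W L c2 \<rho> (run \<O> c1 \<rho> s))"
| "safe \<O> W L (For x b c) \<rho> s = (\<forall>i<bound_val s b. safe \<O> W L c (\<rho>(x := int i))
     (fold (\<lambda>i. run \<O> c (\<rho>(x := int i))) [0..<i] s))"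
| "safe \<O> W L (Ask j a b) \<rho> s = (int_size (\<O> j (read_list s a)) \<le> W \<and> s a 0 \<le> int L)"

section \<open>Compilation into machine programs with polynomially many steps\<close>

fun bound_poly :: "bound \<Rightarrow> nat poly" where
  "bound_poly (Fixed k) = [:k:]"
| "bound_poly (Times k v) = [:0, k:]"

text \<open>The constants count the instructions that the compiler inserts. For a sum, each round
  has a test, an addition and an increment, and outside the rounds there are two initialisations and
  the final test.\<close>

fun tm_steps :: "tm \<Rightarrow> nat poly" where
  "tm_steps (Num c) = [:1:]"
| "tm_steps (Var x) = [:1:]"
| "tm_steps (Arr a t) = tm_steps t + [:1:]"
| "tm_steps (Bin op t u) = tm_steps t + tm_steps u + [:1:]"
| "tm_steps (Scale c t) = tm_steps t + [:1:]"
| "tm_steps (Cond t u v) = tm_steps t + tm_steps u + tm_steps v + [:1:]"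
| "tm_steps (Sum x b t) = bound_poly b * (tm_steps t + [:3:]) + [:3:]"

fun stm_steps :: "stm \<Rightarrow> nat poly" where
  "stm_steps (Assign a t u) = tm_steps t + tm_steps u + [:1:]"
| "stm_steps (Then c1 c2) = stm_steps c1 + stm_steps c2"
| "stm_steps (For x b c) = bound_poly b * (stm_steps c + [:2:]) + [:2:]"
| "stm_steps (Ask j a b) = [:1:]"

abbreviation reg :: "nat \<Rightarrow> expr" where "reg d \<equiv> Get d (Const 0)"

fun bound_expr :: "bound \<Rightarrow> expr" where
  "bound_expr (Fixed k) = Const (int k)"
| "bound_expr (Times k v) = Mul (Const (int k)) (reg v)"

text \<open>The result goes to register \<open>d\<close>, registers above \<open>d\<close> are scratch space, and \<open>\<eta>\<close> assigns
  registers below \<open>d\<close> to the variables.\<close>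

fun comp_tm :: "nat \<Rightarrow> (nat \<Rightarrow> nat) \<Rightarrow> tm \<Rightarrow> prog" where
  "comp_tm d \<eta> (Num c) = Store d (Const 0) (Const c)"
| "comp_tm d \<eta> (Var x) = Store d (Const 0) (reg (\<eta> x))"
| "comp_tm d \<eta> (Arr a t) = Seq (comp_tm d \<eta> t) (Store d (Const 0) (Get a (reg d)))"
| "comp_tm d \<eta> (Bin op t u) = Seq (comp_tm d \<eta> t) (Seq (comp_tm (Suc d) \<eta> u)
     (Store d (Const 0) (op_expr op (reg d) (reg (Suc d)))))"
| "comp_tm d \<eta> (Scale c t) = Seq (comp_tm d \<eta> t) (Store d (Const 0) (Mul (Const c) (reg d)))"
| "comp_tm d \<eta> (Cond t u v) = Seq (comp_tm d \<eta> t)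
     (If_Pos (reg d) (comp_tm d \<eta> u) (comp_tm d \<eta> v))"
| "comp_tm d \<eta> (Sum x b t) = Seq (Store d (Const 0) (Const 0)) (Seq (Store (Suc d) (Const 0) (Const 0))
     (While_Pos (Sub (bound_expr b) (reg (Suc d)))
       (Seq (comp_tm (Suc (Suc d)) (\<eta>(x := Suc d)) t)
         (Seq (Store d (Const 0) (Add (reg d) (reg (Suc (Suc d)))))
           (Store (Suc d) (Const 0) (Add (reg (Suc d)) (Const 1)))))))"

fun comp_stm :: "nat \<Rightarrow> (nat \<Rightarrow> nat) \<Rightarrow> stm \<Rightarrow> prog" where
  "comp_stm d \<eta> (Assign a t u) = Seq (comp_tm d \<eta> t) (Seq (comp_tm (Suc d) \<eta> u)
     (Store a (reg d) (reg (Suc d))))"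
| "comp_stm d \<eta> (Then c1 c2) = Seq (comp_stm d \<eta> c1) (comp_stm d \<eta> c2)"
| "comp_stm d \<eta> (For x b c) = Seq (Store d (Const 0) (Const 0))
     (While_Pos (Sub (bound_expr b) (reg d))
       (Seq (comp_stm (Suc d) (\<eta>(x := d)) c) (Store d (Const 0) (Add (reg d) (Const 1)))))"
| "comp_stm d \<eta> (Ask j a b) = Query j a b"

lemma linear_bound_expr [simp]: "linear_expr (bound_expr b)"
  by (cases b) auto

lemma linear_comp_tm [simp]: "linear_prog (comp_tm d \<eta> t)"
  by (induction t arbitrary: d \<eta>) auto

lemma linear_comp_stm [simp]: "linear_prog (comp_stm d \<eta> c)"
  by (induction c arbitrary: d \<eta>) auto

text \<open>Induction on the number of rounds still to be done. Of the bound, \<open>N + 1\<close>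
  steps are tests of the loop condition.\<close>

lemma steps_count_loop:
  assumes step: "\<And>i s. i < N \<Longrightarrow> P i s \<Longrightarrow> ev s e > 0 \<and>
      (\<exists>n s'. steps \<O> W L c s n s' \<and> n \<le> m \<and> P (Suc i) s')"
    and stop: "\<And>s. P N s \<Longrightarrow> \<not> ev s e > 0"
    and "P 0 s"
  shows "\<exists>n s'. steps \<O> W L (While_Pos e c) s n s' \<and> n \<le> N * (m + 1) + 1 \<and> P N s'"
proof -
  have "i \<le> N \<Longrightarrow> P (N - i) s \<Longrightarrow>
      \<exists>n s'. steps \<O> W L (While_Pos e c) s n s' \<and> n \<le> i * (m + 1) + 1 \<and> P N s'" for i s
  proof (induction i arbitrary: s)
    case 0
    then show ?case using steps_While_False[OF stop] by fastforce
  next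
    case (Suc i)
    then have "N - Suc i < N" by simp
    from step[OF this Suc.prems(2)] obtain n1 s1 where 1: "ev s e > 0" "steps \<O> W L c s n1 s1"
      "n1 \<le> m" "P (N - i) s1"
      using Suc.prems(1) by (auto simp: Suc_diff_Suc)
    obtain n2 s2 where 2: "steps \<O> W L (While_Pos e c) s1 n2 s2" "n2 \<le> i * (m + 1) + 1" "P N s2"
      using Suc.IH[OF _ 1(4)] Suc.prems(1) by auto
    have "1 + n1 + n2 \<le> Suc i * (m + 1) + 1" using 1(3) 2(2) by simp
    then show ?case using steps_While_True[OF 1(1,2) 2(1)] 2(3) by blast
  qed
  from this[of N s] \<open>P 0 s\<close> show ?thesis by simp
qed

lemma bound_val_le:
  assumes "wf_bound V b" and "\<forall>v\<in>V. s v 0 \<le> int N"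
  shows "bound_val s b \<le> poly (bound_poly b) N"
proof (cases b)
  case (Times k v)
  then have "s v 0 \<le> int N" using assms by simp
  then have "int k * s v 0 \<le> int (k * N)" by (simp add: mult_left_mono)
  then have "nat (int k * s v 0) \<le> k * N" by linarith
  then show ?thesis using Times by (simp add: mult.commute)
qed simp

lemma ev_bound_expr:
  assumes "wf_bound V b" and "V \<subseteq> {..<10}" and "\<forall>a<10. s a = s0 a"
  shows "ev s (bound_expr b) > int i \<longleftrightarrow> i < bound_val s0 b"
  using assms by (cases b) auto

text \<open>\<open>s0\<close> is the memory in which the term has its meaning. The machine memory
  \<open>s\<close> only has to agree with it on the ten arrays visible to terms and may differ in
  the registers. Preservation of everything below \<open>d\<close> is what keeps the variables and
  partial results of enclosing code intact.\<close>

lemma steps_comp_tm: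
  assumes V: "V \<subseteq> {..<10}" and N: "\<forall>v\<in>V. s0 v 0 \<le> int N"
  shows "wf_tm V t \<Longrightarrow> 10 \<le> d \<Longrightarrow> \<forall>a<10. s a = s0 a \<Longrightarrow> \<forall>x. \<eta> x < d \<and> s (\<eta> x) 0 = \<rho> x \<Longrightarrow>
    \<exists>n s'. steps \<O> W L (comp_tm d \<eta> t) s n s' \<and> n \<le> poly (tm_steps t) N \<and>
       (\<forall>a<d. s' a = s a) \<and> s' d 0 = val s0 \<rho> t"
proof (induction t arbitrary: d s \<eta> \<rho>)
  case (Num c)
  have *: "steps \<O> W L (comp_tm d \<eta> (Num c)) s 1 (store s d 0 c)"
    by (simp only: comp_tm.simps, rule steps_Store) simp
  show ?case by (intro exI conjI, rule *) (auto simp: store_def)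
next
  case (Var x)
  have *: "steps \<O> W L (comp_tm d \<eta> (Var x)) s 1 (store s d 0 (\<rho> x))"
    by (simp only: comp_tm.simps, rule steps_Store) (simp add: Var)
  show ?case by (intro exI conjI, rule *) (auto simp: store_def)
next
  case (Arr a t)
  obtain n1 s1 where 1: "steps \<O> W L (comp_tm d \<eta> t) s n1 s1" "n1 \<le> poly (tm_steps t) N"
      "\<forall>a<d. s1 a = s a" "s1 d 0 = val s0 \<rho> t"
    using Arr.IH[of d s \<eta> \<rho>] Arr.prems by auto
  have 2: "steps \<O> W L (comp_tm d \<eta> (Arr a t)) s (n1 + 1) (store s1 d 0 (s1 a (s1 d 0)))"
    by (simp only: comp_tm.simps comp_stm.simps, rule steps_Seq[OF 1(1) steps_Store]) simp
  show ?case using Arr.prems 1(2-4)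
    by (intro exI[of _ "n1 + 1"] exI[of _ "store s1 d 0 (s1 a (s1 d 0))"] conjI 2)
       (auto simp: store_def)
next
  case (Bin op t u)
  obtain n1 s1 where 1: "steps \<O> W L (comp_tm d \<eta> t) s n1 s1" "n1 \<le> poly (tm_steps t) N"
      "\<forall>a<d. s1 a = s a" "s1 d 0 = val s0 \<rho> t"
    using Bin.IH(1)[of d s \<eta> \<rho>] Bin.prems by auto
  obtain n2 s2 where 2: "steps \<O> W L (comp_tm (Suc d) \<eta> u) s1 n2 s2" "n2 \<le> poly (tm_steps u) N"
      "\<forall>a<Suc d. s2 a = s1 a" "s2 (Suc d) 0 = val s0 \<rho> u"
    using Bin.IH(2)[of "Suc d" s1 \<eta> \<rho>] Bin.prems 1 by (auto simp: less_Suc_eq)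
  have 3: "steps \<O> W L (comp_tm d \<eta> (Bin op t u)) s (n1 + (n2 + 1)) (store s2 d 0 (op_val op (s2 d 0) (s2 (Suc d) 0)))"
    by (simp only: comp_tm.simps comp_stm.simps, rule steps_Seq[OF 1(1) steps_Seq[OF 2(1) steps_Store]]) simp
  show ?case
      by (intro exI conjI, rule 3) (use Bin.prems 1(2-4) 2(2-4) in \<open>auto simp: store_def\<close>)
next
  case (Scale c t)
  obtain n1 s1 where 1: "steps \<O> W L (comp_tm d \<eta> t) s n1 s1" "n1 \<le> poly (tm_steps t) N"
      "\<forall>a<d. s1 a = s a" "s1 d 0 = val s0 \<rho> t"
    using Scale.IH[of d s \<eta> \<rho>] Scale.prems by auto
  have 2: "steps \<O> W L (comp_tm d \<eta> (Scale c t)) s (n1 + 1) (store s1 d 0 (c * s1 d 0))"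
    by (simp only: comp_tm.simps comp_stm.simps, rule steps_Seq[OF 1(1) steps_Store]) simp
  show ?case
      by (intro exI conjI, rule 2) (use Scale.prems 1(2-4) in \<open>auto simp: store_def\<close>)
next
  case (Cond t u v)
  obtain n1 s1 where 1: "steps \<O> W L (comp_tm d \<eta> t) s n1 s1" "n1 \<le> poly (tm_steps t) N"
      "\<forall>a<d. s1 a = s a" "s1 d 0 = val s0 \<rho> t"
    using Cond.IH(1)[of d s \<eta> \<rho>] Cond.prems by auto
  show ?case
  proof (cases "val s0 \<rho> t > 0")
    case True
    obtain n2 s2 where 2: "steps \<O> W L (comp_tm d \<eta> u) s1 n2 s2" "n2 \<le> poly (tm_steps u) N"
        "\<forall>a<d. s2 a = s1 a" "s2 d 0 = val s0 \<rho> u"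
      using Cond.IH(2)[of d s1 \<eta> \<rho>] Cond.prems 1 by auto
    have 3: "steps \<O> W L (comp_tm d \<eta> (Cond t u v)) s (n1 + (1 + n2)) s2"
      by (simp only: comp_tm.simps, rule steps_Seq[OF 1(1) steps_If_True[OF _ 2(1)]]) (use True 1 in simp)
    show ?thesis
      by (intro exI conjI, rule 3) (use Cond.prems 1(2-4) 2(2-4) True in \<open>auto\<close>)
  next
    case False
    obtain n2 s2 where 2: "steps \<O> W L (comp_tm d \<eta> v) s1 n2 s2" "n2 \<le> poly (tm_steps v) N"
        "\<forall>a<d. s2 a = s1 a" "s2 d 0 = val s0 \<rho> v"
      using Cond.IH(3)[of d s1 \<eta> \<rho>] Cond.prems 1 by auto
    have 3: "steps \<O> W L (comp_tm d \<eta> (Cond t u v)) s (n1 + (1 + n2)) s2"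
      by (simp only: comp_tm.simps, rule steps_Seq[OF 1(1) steps_If_False[OF _ 2(1)]]) (use False 1 in simp)
    show ?thesis
      by (intro exI conjI, rule 3) (use Cond.prems 1(2-4) 2(2-4) False in \<open>auto\<close>)
  qed
next
  case (Sum x b t)
  define M where "M = bound_val s0 b"
  define m where "m = poly (tm_steps t) N + 2"
  define P where "P = (\<lambda>i s'. (\<forall>a<d. s' a = s a) \<and> s' (Suc d) 0 = int i \<and>
      s' d 0 = (\<Sum>j<i. val s0 (\<rho>(x := int j)) t))"
  define e where "e = Sub (bound_expr b) (reg (Suc d))"
  define body where "body = Seq (comp_tm (Suc (Suc d)) (\<eta>(x := Suc d)) t)
         (Seq (Store d (Const 0) (Add (reg d) (reg (Suc (Suc d)))))
           (Store (Suc d) (Const 0) (Add (reg (Suc d)) (Const 1))))"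
  define s1 where "s1 = store (store s d 0 0) (Suc d) 0 0"
  have user: "\<forall>a<10. s' a = s0 a" if "\<forall>a<d. s' a = s a" for s'
    using that Sum.prems by auto
  have e: "ev s' e > 0 \<longleftrightarrow> i < M" if "P i s'" for i s'
    using that ev_bound_expr[of V b s' s0 i] Sum.prems V user[of s']
    unfolding P_def M_def e_def by auto
  have "\<exists>n s'. steps \<O> W L (While_Pos e body) s1 n s' \<and> n \<le> M * (m + 1) + 1 \<and> P M s'"
  proof (rule steps_count_loop[of M P])
    fix i s' assume i: "i < M" and P: "P i s'"
    define \<eta>' where "\<eta>' = \<eta>(x := Suc d)"
    define \<rho>' where "\<rho>' = \<rho>(x := int i)"
    have "\<forall>y. \<eta>' y < Suc (Suc d) \<and> s' (\<eta>' y) 0 = \<rho>' y"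
      using P Sum.prems by (auto simp: P_def less_Suc_eq \<eta>'_def \<rho>'_def)
    then obtain n2 s2 where 2: "steps \<O> W L (comp_tm (Suc (Suc d)) \<eta>' t) s' n2 s2"
        "n2 \<le> poly (tm_steps t) N" "\<forall>a<Suc (Suc d). s2 a = s' a"
        "s2 (Suc (Suc d)) 0 = val s0 \<rho>' t"
      using Sum.IH[of "Suc (Suc d)" s' \<eta>' \<rho>'] Sum.prems P user[of s']
      by (auto simp: P_def)
    note 2 = 2[unfolded \<eta>'_def \<rho>'_def]
    define s3 where "s3 = store s2 d 0 (s2 d 0 + s2 (Suc (Suc d)) 0)"
    define s4 where "s4 = store s3 (Suc d) 0 (s3 (Suc d) 0 + 1)"
    have 3: "steps \<O> W L (Store d (Const 0) (Add (reg d) (reg (Suc (Suc d))))) s2 1 s3"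
      by (rule steps_Store) (simp add: s3_def)
    have 4: "steps \<O> W L (Store (Suc d) (Const 0) (Add (reg (Suc d)) (Const 1))) s3 1 s4"
      by (rule steps_Store) (simp add: s4_def)
    have 5: "steps \<O> W L body s' (n2 + (1 + 1)) s4"
      unfolding body_def by (rule steps_Seq[OF 2(1) steps_Seq[OF 3 4]])
    have "P (Suc i) s4" using P 2 unfolding P_def s4_def s3_def by (auto simp: store_def)
    then show "ev s' e > 0 \<and> (\<exists>n s''. steps \<O> W L body s' n s'' \<and> n \<le> m \<and> P (Suc i) s'')"
      using 5 2(2) e[OF P] i unfolding m_def by fastforce
  next
    fix s' assume "P M s'" then show "\<not> 0 < ev s' e" using e by blast
  next
    show "P 0 s1" by (auto simp: P_def s1_def store_def)
  qed
  then obtain n s' where 6: "steps \<O> W L (While_Pos e body) s1 n s'" "n \<le> M * (m + 1) + 1" "P M s'"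
    by blast
  have 7: "steps \<O> W L (comp_tm d \<eta> (Sum x b t)) s (1 + (1 + n)) s'"
    unfolding comp_tm.simps e_def[symmetric] body_def[symmetric]
    by (rule steps_Seq[OF steps_Store steps_Seq[OF steps_Store]], rule refl, rule refl)
       (use 6(1) in \<open>simp add: s1_def\<close>)
  have "M \<le> poly (bound_poly b) N"
    unfolding M_def using bound_val_le[of V b s0 N] Sum.prems N by auto
  then have "M * (m + 1) \<le> poly (bound_poly b) N * (m + 1)" by (rule mult_le_mono1)
  then have 8: "1 + (1 + n) \<le> poly (tm_steps (Sum x b t)) N"
    using 6(2) by (simp add: m_def algebra_simps)
  show ?case
    by (intro exI conjI, rule 7, rule 8) (use 6(3) in \<open>auto simp: P_def M_def\<close>)
qed

text \<open>The compiled loop evaluates its bound anew before each round, whereas \<open>run\<close>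
  fixes it on entry. The two agree because arrays that hold loop bounds are never written.\<close>

lemma run_bounds: "wf_stm V c \<Longrightarrow> v \<in> V \<Longrightarrow> run \<O> c \<rho> s v = s v"
proof (induction c arbitrary: \<rho> s)
  case (For x b c)
  have "fold (\<lambda>i. run \<O> c (\<rho>(x := int i))) is s v = s v" for "is"
    using For by (induction "is" arbitrary: s) auto
  then show ?case by simp
qed (auto simp: store_def)

lemma steps_comp_stm:
  assumes V: "V \<subseteq> {..<10}"
  shows "\<forall>v\<in>V. s0 v 0 \<le> int N \<Longrightarrow> wf_stm V c \<Longrightarrow> 10 \<le> d \<Longrightarrow> \<forall>a<10. s a = s0 a \<Longrightarrow>
    \<forall>x. 10 \<le> \<eta> x \<and> \<eta> x < d \<and> s (\<eta> x) 0 = \<rho> x \<Longrightarrow> safe \<O> W L c \<rho> s0 \<Longrightarrow>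
    \<exists>n s'. steps \<O> W L (comp_stm d \<eta> c) s n s' \<and> n \<le> poly (stm_steps c) N \<and>
       (\<forall>a<10. s' a = run \<O> c \<rho> s0 a) \<and> (\<forall>a. 10 \<le> a \<and> a < d \<longrightarrow> s' a = s a)"
proof (induction c arbitrary: d s s0 \<eta> \<rho>)
  case (Assign a t u)
  obtain n1 s1 where 1: "steps \<O> W L (comp_tm d \<eta> t) s n1 s1" "n1 \<le> poly (tm_steps t) N"
      "\<forall>a<d. s1 a = s a" "s1 d 0 = val s0 \<rho> t"
    using steps_comp_tm[OF V, of s0 N t d s \<eta> \<rho> \<O> W L] Assign.prems by auto
  obtain n2 s2 where 2: "steps \<O> W L (comp_tm (Suc d) \<eta> u) s1 n2 s2" "n2 \<le> poly (tm_steps u) N"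
      "\<forall>a<Suc d. s2 a = s1 a" "s2 (Suc d) 0 = val s0 \<rho> u"
    using steps_comp_tm[OF V, of s0 N u "Suc d" s1 \<eta> \<rho> \<O> W L] Assign.prems 1
    by (auto simp: less_Suc_eq)
  have 3: "steps \<O> W L (comp_stm d \<eta> (Assign a t u)) s (n1 + (n2 + 1)) (store s2 a (s2 d 0) (s2 (Suc d) 0))"
    by (simp only: comp_tm.simps comp_stm.simps, rule steps_Seq[OF 1(1) steps_Seq[OF 2(1) steps_Store]]) simp
  show ?case
      by (intro exI conjI, rule 3) (use Assign.prems 1(2-4) 2(2-4) in \<open>auto simp: store_def fun_eq_iff\<close>)
next
  case (Then c1 c2)
  obtain n1 s1 where 1: "steps \<O> W L (comp_stm d \<eta> c1) s n1 s1" "n1 \<le> poly (stm_steps c1) N"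
      "\<forall>a<10. s1 a = run \<O> c1 \<rho> s0 a" "\<forall>a. 10 \<le> a \<and> a < d \<longrightarrow> s1 a = s a"
    using Then.IH(1)[of s0 d s \<eta> \<rho>] Then.prems by auto
  have "\<forall>v\<in>V. run \<O> c1 \<rho> s0 v 0 \<le> int N" using Then.prems run_bounds[of V c1] by simp
  moreover have "\<forall>x. 10 \<le> \<eta> x \<and> \<eta> x < d \<and> s1 (\<eta> x) 0 = \<rho> x" using Then.prems 1(4) by auto
  ultimately obtain n2 s2 where 2: "steps \<O> W L (comp_stm d \<eta> c2) s1 n2 s2" "n2 \<le> poly (stm_steps c2) N"
      "\<forall>a<10. s2 a = run \<O> c2 \<rho> (run \<O> c1 \<rho> s0) a" "\<forall>a. 10 \<le> a \<and> a < d \<longrightarrow> s2 a = s1 a"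
    using Then.IH(2)[of "run \<O> c1 \<rho> s0" d s1 \<eta> \<rho>] Then.prems 1(3) by auto
  show ?case using steps_Seq[OF 1(1) 2(1)] 1 2 by (intro exI[of _ "n1 + n2"] exI[of _ s2]) auto
next
  case (For x b c)
  define M where "M = bound_val s0 b"
  define m where "m = poly (stm_steps c) N + 1"
  define S where "S = (\<lambda>i. fold (\<lambda>i. run \<O> c (\<rho>(x := int i))) [0..<i] s0)"
  define P where "P = (\<lambda>i s'. (\<forall>a<10. s' a = S i a) \<and> (\<forall>a. 10 \<le> a \<and> a < d \<longrightarrow> s' a = s a)
      \<and> s' d 0 = int i)"
  define e where "e = Sub (bound_expr b) (reg d)"
  define body where "body = Seq (comp_stm (Suc d) (\<eta>(x := d)) c) (Store d (Const 0) (Add (reg d) (Const 1)))"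
  define s1 where "s1 = store s d 0 0"
  have S_Suc: "S (Suc i) = run \<O> c (\<rho>(x := int i)) (S i)" for i by (simp add: S_def)
  have SV: "v \<in> V \<Longrightarrow> S i v = s0 v" for i v
    by (induction i) (use For.prems run_bounds[of V c] S_Suc in \<open>auto simp: S_def\<close>)
  have bS: "bound_val (S i) b = M" for i
    unfolding M_def using For.prems SV by (cases b) auto
  have e: "ev s' e > 0 \<longleftrightarrow> i < M" if "P i s'" for i s'
    using that ev_bound_expr[of V b s' "S i" i] For.prems V bS
    unfolding P_def e_def by auto
  have "\<exists>n s'. steps \<O> W L (While_Pos e body) s1 n s' \<and> n \<le> M * (m + 1) + 1 \<and> P M s'"
  proof (rule steps_count_loop[of M P])
    fix i s' assume i: "i < M" and P: "P i s'"
    define \<eta>' where "\<eta>' = \<eta>(x := d)"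
    define \<rho>' where "\<rho>' = \<rho>(x := int i)"
    have "\<forall>y. 10 \<le> \<eta>' y \<and> \<eta>' y < Suc d \<and> s' (\<eta>' y) 0 = \<rho>' y"
      using P For.prems by (auto simp: P_def less_Suc_eq \<eta>'_def \<rho>'_def)
    moreover have "\<forall>v\<in>V. S i v 0 \<le> int N" using SV For.prems by auto
    moreover have "safe \<O> W L c \<rho>' (S i)" using i For.prems unfolding S_def M_def \<rho>'_def by auto
    moreover have "\<forall>a<10. s' a = S i a" using P by (simp add: P_def)
    moreover have "wf_stm V c" "10 \<le> Suc d" using For.prems by auto
    ultimately obtain n2 s2 where 2: "steps \<O> W L (comp_stm (Suc d) \<eta>' c) s' n2 s2"
        "n2 \<le> poly (stm_steps c) N" "\<forall>a<10. s2 a = run \<O> c \<rho>' (S i) a"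
        "\<forall>a. 10 \<le> a \<and> a < Suc d \<longrightarrow> s2 a = s' a"
      using For.IH[of "S i" "Suc d" s' \<eta>' \<rho>'] by blast
    note 2 = 2[unfolded \<eta>'_def \<rho>'_def, folded S_Suc]
    define s3 where "s3 = store s2 d 0 (s2 d 0 + 1)"
    have 3: "steps \<O> W L (Store d (Const 0) (Add (reg d) (Const 1))) s2 1 s3"
      by (rule steps_Store) (simp add: s3_def)
    have 5: "steps \<O> W L body s' (n2 + 1) s3"
      unfolding body_def by (rule steps_Seq[OF 2(1) 3])
    have "P (Suc i) s3" using P 2 For.prems unfolding P_def s3_def by (auto simp: store_def)
    then show "ev s' e > 0 \<and> (\<exists>n s''. steps \<O> W L body s' n s'' \<and> n \<le> m \<and> P (Suc i) s'')"
      using 5 2(2) e[OF P] i unfolding m_def by fastforce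
  next
    fix s' assume "P M s'" then show "\<not> 0 < ev s' e" using e by blast
  next
    show "P 0 s1" using For.prems by (auto simp: P_def s1_def store_def S_def)
  qed
  then obtain n s' where 6: "steps \<O> W L (While_Pos e body) s1 n s'" "n \<le> M * (m + 1) + 1" "P M s'"
    by blast
  have 7: "steps \<O> W L (comp_stm d \<eta> (For x b c)) s (1 + n) s'"
    unfolding comp_stm.simps e_def[symmetric] body_def[symmetric]
    by (rule steps_Seq[OF steps_Store], rule refl) (use 6(1) in \<open>simp add: s1_def\<close>)
  have "M \<le> poly (bound_poly b) N"
    unfolding M_def using bound_val_le[of V b s0 N] For.prems by auto
  then have "M * (m + 1) \<le> poly (bound_poly b) N * (m + 1)" by (rule mult_le_mono1)
  then have 8: "1 + n \<le> poly (stm_steps (For x b c)) N"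
    using 6(2) by (simp add: m_def algebra_simps)
  show ?case
    by (intro exI conjI, rule 7, rule 8) (use 6(3) in \<open>auto simp: P_def M_def S_def\<close>)
next
  case (Ask j a b)
  have "read_list s a = read_list s0 a" "s a 0 = s0 a 0" using Ask.prems by (auto simp: read_list_def)
  then have "steps \<O> W L (comp_stm d \<eta> (Ask j a b)) s 1 (store s b 0 (\<O> j (read_list s0 a)))"
    unfolding comp_stm.simps by (intro steps_Query) (use Ask.prems in auto)
  moreover have "\<forall>a'<10. store s b 0 (\<O> j (read_list s0 a)) a' = run \<O> (Ask j a b) \<rho> s0 a'"
    using Ask.prems by (auto simp: store_def)
  moreover have "\<forall>a'. 10 \<le> a' \<and> a' < d \<longrightarrow> store s b 0 (\<O> j (read_list s0 a)) a' = s a'"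
    using Ask.prems by (auto simp: store_def)
  ultimately show ?case by (intro exI[of _ 1] exI conjI) auto
qed

text \<open>Variables start out as register 10, which is never written and thus holds 0.\<close>

definition compile :: "stm \<Rightarrow> prog" where
  "compile c = comp_stm 11 (\<lambda>_. 10) c"

lemma linear_compile [simp]: "linear_prog (compile c)"
  by (simp add: compile_def)

lemma steps_compile:
  assumes "V \<subseteq> {..<10}" and "\<forall>v\<in>V. s v 0 \<le> int N" and "wf_stm V c" and "s 10 0 = 0"
    and "\<forall>a<10. s0 a = s a" and "safe \<O> W L c (\<lambda>_. 0) s0"
  obtains n s' where "steps \<O> W L (compile c) s n s'" "n \<le> poly (stm_steps c) N"
    "\<forall>a<10. s' a = run \<O> c (\<lambda>_. 0) s0 a" "s' 10 0 = 0"
proof -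
  have "\<forall>v\<in>V. s0 v 0 \<le> int N" using assms(1,2,5) by auto
  moreover have "\<forall>a<10. s a = s0 a" using assms(5) by simp
  moreover have "\<forall>x::nat. (10::nat) \<le> 10 \<and> (10::nat) < 11 \<and> s 10 0 = (0::int)" using assms(4) by simp
  ultimately show thesis
    using steps_comp_stm[OF assms(1), of s0 N c 11 s "\<lambda>_. 10" "\<lambda>_. 0" \<O> W L] assms(3,4,6) that
    unfolding compile_def by auto
qed

fun asks :: "stm \<Rightarrow> bool" where
  "asks (Assign a t u) = False"
| "asks (Then c1 c2) = (asks c1 \<or> asks c2)"
| "asks (For x b c) = asks c"
| "asks (Ask j a b) = True"

lemma safe_of_no_asks: "\<not> asks c \<Longrightarrow> safe \<O> W L c \<rho> s"
  by (induction c arbitrary: \<rho> s) auto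

definition two_phase :: "stm \<Rightarrow> stm \<Rightarrow> prog" where
  "two_phase c1 c2 = Seq (compile c1) (compile c2)"

definition two_phase_steps :: "stm \<Rightarrow> stm \<Rightarrow> nat poly" where
  "two_phase_steps c1 c2 = stm_steps c1 + stm_steps c2"

definition two_phase_time :: "stm \<Rightarrow> stm \<Rightarrow> nat \<Rightarrow> nat \<Rightarrow> nat \<Rightarrow> nat" where
  "two_phase_time c1 c2 N L B = (let K = prog_length (two_phase c1 c2); t = poly (two_phase_steps c1 c2) N
     in t * step_cost K L (B + K * t))"

text \<open>The first phase computes the loop bounds of the second.\<close>

lemma exec_two_phase:
  assumes c1: "wf_stm {} c1" "\<not> asks c1" and c2: "wf_stm V c2" "V \<subseteq> {..<10}"
    and s: "s 10 0 = 0" "\<And>a i. int_size (s a i) \<le> B" "W \<le> B"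
    and s1_def: "s1 = run \<O> c1 (\<lambda>_. 0) s"
    and le: "\<forall>v\<in>V. s1 v 0 \<le> int N" and safe: "safe \<O> W L c2 (\<lambda>_. 0) s1"
  obtains m k s' where "exec \<O> (two_phase c1 c2) s m k s'" "k \<le> poly (two_phase_steps c1 c2) N"
    "m \<le> two_phase_time c1 c2 N L B" "\<forall>a<10. s' a = run \<O> c2 (\<lambda>_. 0) s1 a"
proof -
  obtain n1 s1' where 1: "steps \<O> W L (compile c1) s n1 s1'" "n1 \<le> poly (stm_steps c1) N"
    "\<forall>a<10. s1' a = s1 a" "s1' 10 0 = 0"
    by (rule steps_compile[of "{}" s N c1 s \<O> W L]) (use c1 s safe_of_no_asks in \<open>auto simp: s1_def\<close>)
  obtain n2 s2 where 2: "steps \<O> W L (compile c2) s1' n2 s2" "n2 \<le> poly (stm_steps c2) N"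
    "\<forall>a<10. s2 a = run \<O> c2 (\<lambda>_. 0) s1 a" "s2 10 0 = 0"
    by (rule steps_compile[of V s1' N c2 s1 \<O> W L]) (use c2 1 le safe in \<open>auto simp: subset_iff\<close>)
  define K where "K = prog_length (two_phase c1 c2)"
  define t where "t = poly (two_phase_steps c1 c2) N"
  have t: "n1 + n2 \<le> t" using 1(2) 2(2) by (simp add: t_def two_phase_steps_def)
  obtain m k where 3: "exec \<O> (two_phase c1 c2) s m k s2" "k \<le> n1 + n2"
    "m \<le> (n1 + n2) * step_cost K L (B + K * (n1 + n2))"
    using exec_of_steps[OF steps_Seq[OF 1(1) 2(1)] _ _ s(2,3), of K] by (auto simp: K_def two_phase_def)
  have "m \<le> t * step_cost K L (B + K * t)"
    using 3(3) by (rule order_trans) (use t in \<open>intro mult_le_mono step_cost_mono add_left_mono mult_le_mono2\<close>)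
  then have "m \<le> two_phase_time c1 c2 N L B" by (simp add: two_phase_time_def K_def t_def Let_def)
  then show thesis using that[OF 3(1)] 3(2) t 2(3) by (simp add: t_def)
qed

text \<open>Loop bound, query length and initial bit length will themselves be polynomials in the
  input size; substituting them gives the single time polynomial that \<open>sharpP\<close> and
  \<open>reduces_by_poly_calls\<close> ask for.\<close>

lemma two_phase_time_poly:
  "\<exists>p. \<forall>x. poly p x = two_phase_time c1 c2 (poly N x) (poly L x) (poly B x)"
proof
  let ?K = "prog_length (two_phase c1 c2)" and ?t = "pcompose (two_phase_steps c1 c2) N"
  show "\<forall>x. poly (?t * ([:1:] + (L + [:2 * ?K + 2:]) * (B + smult ?K ?t + [:?K:]))) x =
      two_phase_time c1 c2 (poly N x) (poly L x) (poly B x)"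
    by (simp add: two_phase_time_def Let_def step_cost_def poly_pcompose algebra_simps)
qed

section \<open>Triangulations and their faces\<close>

locale gluing =
  fixes T :: triangulation
  assumes face_pairing: "face_pairing T"
begin

abbreviation "n \<equiv> num_tets T"

lemma
  assumes "t < n" "f < 4"
  shows adj_less: "adj T t f < n"
    and perm_bij: "bij_betw (perm T t f) {..<4} {..<4}"
    and adj_neq: "(adj T t f, perm T t f f) \<noteq> (t, f)"
    and adj_adj: "adj T (adj T t f) (perm T t f f) = t"
    and perm_perm: "v < 4 \<Longrightarrow> perm T (adj T t f) (perm T t f f) (perm T t f v) = v"
  using face_pairing assms unfolding face_pairing_def by auto

lemma perm_less: "t < n \<Longrightarrow> f < 4 \<Longrightarrow> v < 4 \<Longrightarrow> perm T t f v < 4"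
  using perm_bij[of t f] by (auto simp: bij_betw_def)

lemma perm_inj: "t < n \<Longrightarrow> f < 4 \<Longrightarrow> inj_on (perm T t f) {..<4}"
  using perm_bij[of t f] by (auto simp: bij_betw_def)

lemma perm_eq_iff: "t < n \<Longrightarrow> f < 4 \<Longrightarrow> v < 4 \<Longrightarrow> w < 4 \<Longrightarrow>
    perm T t f v = perm T t f w \<longleftrightarrow> v = w"
  using inj_on_eq_iff[OF perm_inj[of t f], of v w] by simp

lemma glue_facesI:
  "t < n \<Longrightarrow> f < 4 \<Longrightarrow> A \<subseteq> {..<4} - {f} \<Longrightarrow> ((t, A), (adj T t f, perm T t f ` A)) \<in> glue_faces T"
  by (auto simp: glue_faces_def)

lemma glue_facesE:
  assumes "((t, A), (u, B)) \<in> glue_faces T"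
  obtains f where "t < n" "f < 4" "A \<subseteq> {..<4} - {f}" "u = adj T t f" "B = perm T t f ` A"
  using assms by (auto simp: glue_faces_def)

text \<open>The neighbour sees the common face as the one opposite to its vertex
  \<open>perm T t f f\<close>, and crossing it from there undoes the gluing. Symmetry turns the
  reflexive transitive closure into an equivalence relation, so that \<open>face_class\<close>
  really produces classes.\<close>

lemma glue_faces_sym: "(p, p') \<in> glue_faces T \<Longrightarrow> (p', p) \<in> glue_faces T"
proof -
  assume "(p, p') \<in> glue_faces T"
  then obtain t A u B where p: "p = (t, A)" "p' = (u, B)" "((t, A), (u, B)) \<in> glue_faces T"
    by (metis prod.exhaust)
  from p(3) obtain f where f: "t < n" "f < 4" "A \<subseteq> {..<4} - {f}" "u = adj T t f" "B = perm T t f ` A"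
    by (rule glue_facesE)
  define g where "g = perm T t f f"
  have g: "g < 4" using f perm_less[of t f f] by (simp add: g_def)
  have u: "u < n" using f adj_less by simp
  have "perm T u g ` B = (\<lambda>v. perm T u g (perm T t f v)) ` A" by (simp add: f(5) image_image)
  also have "\<dots> = (\<lambda>v. v) ` A"
    by (rule image_cong) (use f perm_perm[OF f(1,2)] in \<open>auto simp: g_def\<close>)
  finally have "A = perm T u g ` B" by simp
  moreover have "B \<subseteq> {..<4} - {g}"
    using f perm_less[OF f(1,2)] perm_eq_iff[OF f(1,2)] by (auto simp: g_def)
  moreover have "t = adj T u g" using adj_adj[OF f(1,2)] by (simp add: g_def f(4))
  ultimately show ?thesis using u g p(1,2) by (auto simp: glue_faces_def)
qed

lemma glue_rtrancl_sym: "(p, p') \<in> (glue_faces T)\<^sup>* \<Longrightarrow> (p', p) \<in> (glue_faces T)\<^sup>*"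
  by (induction rule: rtrancl_induct) (auto intro: converse_rtrancl_into_rtrancl dest: glue_faces_sym)

lemma face_class_eq_iff:
  "face_class T t A = face_class T u B \<longleftrightarrow> ((t, A), (u, B)) \<in> (glue_faces T)\<^sup>*"
proof
  assume "face_class T t A = face_class T u B"
  moreover have "(u, B) \<in> face_class T u B" by (simp add: face_class_def)
  ultimately show "((t, A), (u, B)) \<in> (glue_faces T)\<^sup>*" by (auto simp: face_class_def)
next
  assume *: "((t, A), (u, B)) \<in> (glue_faces T)\<^sup>*"
  then have "((u, B), (t, A)) \<in> (glue_faces T)\<^sup>*" by (rule glue_rtrancl_sym)
  with * show "face_class T t A = face_class T u B"
    unfolding face_class_def by (auto intro: rtrancl_trans)
qed

lemma face_class_glue:
  "t < n \<Longrightarrow> f < 4 \<Longrightarrow> A \<subseteq> {..<4} - {f} \<Longrightarrow>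
    face_class T (adj T t f) (perm T t f ` A) = face_class T t A"
  using face_class_eq_iff[of t A] glue_facesI[of t f A] by auto

lemma face_class_self: "(t, A) \<in> face_class T t A"
  by (simp add: face_class_def)

lemma glue_rtrancl_faces:
  assumes "((t, A), (u, B)) \<in> (glue_faces T)\<^sup>*" and "t < n" and "A \<subseteq> {..<4}"
  shows "u < n \<and> B \<subseteq> {..<4} \<and> card B = card A"
  using assms
proof (induction "(u, B)" arbitrary: u B rule: rtrancl_induct)
  case (step y)
  obtain u' B' where y: "y = (u', B')" by (cases y)
  with step have *: "u' < n" "B' \<subseteq> {..<4}" "card B' = card A" by auto
  from step(2)[unfolded y] obtain f where f: "u' < n" "f < 4" "B' \<subseteq> {..<4} - {f}" "u = adj T u' f"
     "B = perm T u' f ` B'"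
    by (rule glue_facesE)
  have "card B = card B'"
    unfolding f(5) by (rule card_image) (rule inj_on_subset[OF perm_inj[OF f(1,2)] *(2)])
  then show ?case using f * adj_less[OF f(1,2)] perm_less[OF f(1,2)] by auto
qed auto

lemma mem_triangle: "F \<in> triangles T \<Longrightarrow> (t, A) \<in> F \<Longrightarrow>
    t < n \<and> A \<subseteq> {..<4} \<and> card A = 3 \<and> F = face_class T t A"
proof -
  assume "F \<in> triangles T" and m: "(t, A) \<in> F"
  then obtain u B where e: "F = face_class T u B" "u < n" "B \<subseteq> {..<4}" "card B = 3"
    by (auto simp: triangles_def)
  have "((u, B), (t, A)) \<in> (glue_faces T)\<^sup>*" using m e(1) by (simp add: face_class_def)
  then show ?thesis using glue_rtrancl_faces[of u B t A] e face_class_eq_iff[of u B t A] by auto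
qed

lemma edges_alt: "edges T = {face_class T t {a, b} | t a b. t < n \<and> a < 4 \<and> b < 4 \<and> a \<noteq> b}"
proof -
  have "A \<subseteq> {..<4} \<and> card A = 2 \<longleftrightarrow> (\<exists>a b. A = {a, b} \<and> a < 4 \<and> b < 4 \<and> a \<noteq> b)" for A :: "nat set"
    unfolding card_2_iff by auto
  then show ?thesis unfolding edges_def by auto
qed

lemma edgeI: "t < n \<Longrightarrow> a < 4 \<Longrightarrow> b < 4 \<Longrightarrow> a \<noteq> b \<Longrightarrow> face_class T t {a, b} \<in> edges T"
  unfolding edges_alt by blast

lemma card_3_subset_4:
  assumes "A \<subseteq> {..<4::nat}" "card A = 3"
  obtains f where "f < 4" "A = {..<4} - {f}"
proof -
  have "card ({..<4} - A) = 1"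
    using assms by (subst card_Diff_subset) (auto intro: finite_subset)
  then obtain f where "{..<4} - A = {f}" by (auto simp: card_1_singleton_iff)
  then show thesis using that[of f] assms(1) by blast
qed

definition face :: "nat \<times> nat \<Rightarrow> (nat \<times> nat set) set" where
  "face = (\<lambda>(t, f). face_class T t ({..<4} - {f}))"

lemma triangles_alt: "triangles T = face ` ({..<n} \<times> {..<4})"
proof -
  have "A \<subseteq> {..<4} \<and> card A = 3 \<longleftrightarrow> (\<exists>f<4. A = {..<4} - {f})" for A :: "nat set"
    using card_3_subset_4[of A] by auto
  then show ?thesis unfolding triangles_def face_def by (auto simp: image_iff)
qed

lemma finite_edges: "finite (edges T)"
proof -
  have "edges T \<subseteq> (\<lambda>(t, a, b). face_class T t {a, b}) ` ({..<n} \<times> {..<4} \<times> {..<4})"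
    unfolding edges_alt by force
  then show ?thesis by (rule finite_subset) simp
qed

lemma finite_triangles: "finite (triangles T)"
  unfolding triangles_alt by simp

lemma perm_opposite:
  assumes "t < n" "f < 4"
  shows "perm T t f ` ({..<4} - {f}) = {..<4} - {perm T t f f}"
  using perm_bij[OF assms] assms(2) by (auto simp: bij_betw_def inj_on_eq_iff image_iff)

text \<open>A triangle of a tetrahedron misses just one vertex, so just one gluing applies to it,
  and the gluing that applies to its image leads back. The orbit therefore has no third
  member.\<close>

lemma mem_face:
  assumes "t < n" "f < 4" "(u, B) \<in> face (t, f)"
  shows "(u, B) = (t, {..<4} - {f}) \<or> (u, B) = (adj T t f, {..<4} - {perm T t f f})"
proof -
  have "((t, {..<4} - {f}), (u, B)) \<in> (glue_faces T)\<^sup>*"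
    using assms(3) by (simp add: face_def face_class_def)
  then show ?thesis
  proof (induction "(u, B)" arbitrary: u B rule: rtrancl_induct)
    case (step y)
    obtain u' B' where y: "y = (u', B')" by (cases y)
    from step(2)[unfolded y] obtain g where g: "u' < n" "g < 4" "B' \<subseteq> {..<4} - {g}" "u = adj T u' g"
       "B = perm T u' g ` B'"
      by (rule glue_facesE)
    show ?case
    proof (cases "y = (t, {..<4} - {f})")
      case True
      then have "{..<4} - {f} \<subseteq> {..<4} - {g}" using g(3) y by simp
      then have "g = f" using g(2) assms(2) by auto
      then show ?thesis using g True y perm_opposite[OF assms(1,2)] by auto
    next
      case False
      then have u': "u' = adj T t f" "B' = {..<4} - {perm T t f f}" using step(3)[of u' B'] y by auto
      then have "{..<4} - {perm T t f f} \<subseteq> {..<4} - {g}" using g(3) by simp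
      then have "g = perm T t f f" using g(2) by auto
      then show ?thesis
        using g u' perm_opposite[OF g(1,2)] adj_adj[OF assms(1,2)] perm_perm[OF assms(1,2,2)] by auto
    qed
  qed auto
qed

lemma face_fibre:
  assumes "t < n" "f < 4"
  shows "{p \<in> {..<n} \<times> {..<4}. face p = face (t, f)} = {(t, f), (adj T t f, perm T t f f)}" (is "?L = ?R")
proof
  show "?L \<subseteq> ?R"
  proof
    fix p assume "p \<in> ?L"
    then obtain u g where p: "p = (u, g)" "u < n" "g < 4" "face (u, g) = face (t, f)" by auto
    then have "(u, {..<4} - {g}) \<in> face (t, f)"
      using face_class_self[of u "{..<4} - {g}"] by (simp add: face_def)
    from mem_face[OF assms this]
    have "(u, {..<4} - {g}) = (t, {..<4} - {f}) \<or> (u, {..<4} - {g}) = (adj T t f, {..<4} - {perm T t f f})" .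
    moreover have "{..<4} - {g} = {..<4} - {h} \<Longrightarrow> h < 4 \<Longrightarrow> g = h" for h using p(3) by auto
    ultimately show "p \<in> ?R" using p(1) assms(2) perm_less[OF assms assms(2)] by auto
  qed
next
  have "face (adj T t f, perm T t f f) = face (t, f)"
    using face_class_glue[OF assms, of "{..<4} - {f}"] perm_opposite[OF assms] by (simp add: face_def)
  then show "?R \<subseteq> ?L" using assms adj_less[OF assms] perm_less[OF assms assms(2)] by auto
qed

text \<open>Double counting of sides. Every class has exactly two sides, since
  \<open>face_pairing\<close> forbids gluing a face to itself. Both the cancellation of signs and
  the count of segments rest on this identity.\<close>

lemma sum_faces:
  fixes h :: "(nat \<times> nat set) set \<Rightarrow> nat"
  shows "(\<Sum>t<n. \<Sum>f<4. h (face (t, f))) = 2 * (\<Sum>F\<in>triangles T. h F)"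
proof -
  let ?P = "{..<n} \<times> {..<4::nat}"
  have "(\<Sum>t<n. \<Sum>f<4. h (face (t, f))) = (\<Sum>p\<in>?P. h (face p))"
    by (simp add: sum.cartesian_product split_beta)
  also have "\<dots> = (\<Sum>F\<in>face ` ?P. \<Sum>p\<in>{p \<in> ?P. face p = F}. h (face p))"
    by (rule sum.image_gen) simp
  also have "\<dots> = (\<Sum>F\<in>face ` ?P. 2 * h F)"
  proof (rule sum.cong, rule refl)
    fix F assume "F \<in> face ` ?P"
    then obtain t f where tf: "t < n" "f < 4" "F = face (t, f)" by auto
    have "card {p \<in> ?P. face p = F} = 2"
      unfolding tf(3) face_fibre[OF tf(1,2)] using adj_neq[OF tf(1,2)] by auto
    then show "(\<Sum>p\<in>{p \<in> ?P. face p = F}. h (face p)) = 2 * h F" by simp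
  qed
  finally show ?thesis by (simp add: triangles_alt sum_distrib_left)
qed

text \<open>The induction follows a labelled triple of vertices, so that the three edges are matched
  one by one and not merely as a set.\<close>

lemma glue_rtrancl_triangle:
  assumes "((t, {a, b, c}), (u, B)) \<in> (glue_faces T)\<^sup>*" and "a \<noteq> b" "a \<noteq> c" "b \<noteq> c"
  shows "\<exists>a' b' c'. B = {a', b', c'} \<and> a' \<noteq> b' \<and> a' \<noteq> c' \<and> b' \<noteq> c' \<and>
    face_class T u {a', b'} = face_class T t {a, b} \<and>
    face_class T u {a', c'} = face_class T t {a, c} \<and>
    face_class T u {b', c'} = face_class T t {b, c}"
  using assms(1)
proof (induction "(u, B)" arbitrary: u B rule: rtrancl_induct)
  case base
  then show ?case using assms(2-4) by blast
next
  case (step y)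
  obtain u' B' where y: "y = (u', B')" by (cases y)
  from step(2)[unfolded y] obtain g where g: "u' < n" "g < 4" "B' \<subseteq> {..<4} - {g}" "u = adj T u' g"
     "B = perm T u' g ` B'"
    by (rule glue_facesE)
  obtain a' b' c' where *: "B' = {a', b', c'}" "a' \<noteq> b'" "a' \<noteq> c'" "b' \<noteq> c'"
    "face_class T u' {a', b'} = face_class T t {a, b}"
    "face_class T u' {a', c'} = face_class T t {a, c}"
    "face_class T u' {b', c'} = face_class T t {b, c}"
    using step(3)[OF y] by blast
  let ?p = "perm T u' g"
  have "face_class T u {?p a', ?p b'} = face_class T u' {a', b'}"
    "face_class T u {?p a', ?p c'} = face_class T u' {a', c'}"
    "face_class T u {?p b', ?p c'} = face_class T u' {b', c'}"
    using face_class_glue[OF g(1,2), of "{a', b'}"] face_class_glue[OF g(1,2), of "{a', c'}"]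
      face_class_glue[OF g(1,2), of "{b', c'}"] g(3,4) * by auto
  moreover have "?p a' \<noteq> ?p b'" "?p a' \<noteq> ?p c'" "?p b' \<noteq> ?p c'"
    using perm_eq_iff[OF g(1,2)] g(3) * by auto
  moreover have "B = {?p a', ?p b', ?p c'}" using g(5) *(1) by simp
  ultimately show ?case unfolding *(5-7) by blast
qed

text \<open>\<open>triangle_coloured\<close> leaves open both the tetrahedron that represents the
  triangle and the order of its edges. Only the order remains ambiguous, and triangle weights are
  symmetric, so the \<open>THE\<close> in \<open>weight\<close> is well defined.\<close>

lemma triangle_coloured_unique:
  assumes "F \<in> triangles T" "triangle_coloured T \<theta> F i j k" "triangle_coloured T \<theta> F i' j' k'"
  shows "(i', j', k') \<in> {(i,j,k), (i,k,j), (j,i,k), (j,k,i), (k,i,j), (k,j,i)}"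
proof -
  obtain t a b c where 1: "(t, {a, b, c}) \<in> F" "a \<noteq> b" "a \<noteq> c" "b \<noteq> c"
    "i = colour T \<theta> t {a, b}" "j = colour T \<theta> t {a, c}" "k = colour T \<theta> t {b, c}"
    using assms(2) unfolding triangle_coloured_def by blast
  obtain u x y z where 2: "(u, {x, y, z}) \<in> F" "x \<noteq> y" "x \<noteq> z" "y \<noteq> z"
    "i' = colour T \<theta> u {x, y}" "j' = colour T \<theta> u {x, z}" "k' = colour T \<theta> u {y, z}"
    using assms(3) unfolding triangle_coloured_def by blast
  have "((t, {a, b, c}), (u, {x, y, z})) \<in> (glue_faces T)\<^sup>*"
    using mem_triangle[OF assms(1) 1(1)] mem_triangle[OF assms(1) 2(1)] face_class_eq_iff by metis
  from glue_rtrancl_triangle[OF this 1(2-4)] obtain a' b' c' where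
    3: "{x, y, z} = {a', b', c'}" "a' \<noteq> b'" "a' \<noteq> c'" "b' \<noteq> c'"
    "face_class T u {a', b'} = face_class T t {a, b}"
    "face_class T u {a', c'} = face_class T t {a, c}"
    "face_class T u {b', c'} = face_class T t {b, c}" by blast
  have "(x = a' \<and> y = b' \<and> z = c') \<or> (x = a' \<and> y = c' \<and> z = b') \<or> (x = b' \<and> y = a' \<and> z = c')
     \<or> (x = b' \<and> y = c' \<and> z = a') \<or> (x = c' \<and> y = a' \<and> z = b') \<or> (x = c' \<and> y = b' \<and> z = a')"
    using 3(1-4) 2(2-4) by (metis insert_iff singletonD insertE)
  then show ?thesis unfolding 1(5-7) 2(5-7) using 3(5-7)
    by (elim disjE conjE) (simp_all add: insert_commute)
qed

lemma triangle_colouredI: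
  assumes "t < n" "a < 4" "b < 4" "c < 4" "a \<noteq> b" "a \<noteq> c" "b \<noteq> c"
  shows "triangle_coloured T \<theta> (face_class T t {a, b, c})
    (colour T \<theta> t {a, b}) (colour T \<theta> t {a, c}) (colour T \<theta> t {b, c})"
    and "face_class T t {a, b, c} \<in> triangles T"
proof -
  show "triangle_coloured T \<theta> (face_class T t {a, b, c})
    (colour T \<theta> t {a, b}) (colour T \<theta> t {a, c}) (colour T \<theta> t {b, c})"
    unfolding triangle_coloured_def using assms face_class_self by blast
  have "card {a, b, c} = 3" using assms by simp
  then show "face_class T t {a, b, c} \<in> triangles T"
    unfolding triangles_def using assms by (auto intro!: exI[of _ t] exI[of _ "{a, b, c}"])
qed

end

section \<open>Weights and octagons\<close>

text \<open>The quantum integer [2] = 2 cos (\<pi> q / 4) for \<open>q\<close> in {1, 3}.\<close>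

definition root2 :: "nat \<Rightarrow> real" where
  "root2 q = (if q = 1 then sqrt 2 else - sqrt 2)"

lemma root2_square: "root2 q * root2 q = 2"
  by (simp add: root2_def)

lemma zeta_eq_cis: "zeta q = cis (real q * pi / 4)"
  unfolding zeta_def cis_conv_exp by (simp add: algebra_simps)

lemma qint_eq_sin:
  assumes "k > 0"
  shows "qint q k = of_real (sin (real k * (real q * pi / 4)) / sin (real q * pi / 4))"
proof -
  have "cis t - inverse (cis t) = 2 * \<i> * of_real (sin t)" for t
    by (simp add: complex_eq_iff)
  moreover have "zeta q ^ k = cis (real k * (real q * pi / 4))" "inverse (zeta q) ^ k = inverse (cis (real k * (real q * pi / 4)))"
    by (simp_all add: zeta_eq_cis Complex.DeMoivre power_inverse del: cis_inverse)
  ultimately show ?thesis using assms by (simp add: qint_def zeta_eq_cis del: cis_inverse)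
qed

lemma sin_multiples_45:
  "sin (3 * pi / 4) = sqrt 2 / 2" "sin (9 * pi / 4) = sqrt 2 / 2" "sin (3 * pi / 2) = - 1"
proof -
  have "3 * pi / 4 = pi - pi / 4" by simp
  then show "sin (3 * pi / 4) = sqrt 2 / 2" by (simp only: sin_pi_minus sin_45)
  have "sin (9 * pi / 4) = sin (pi / 4 + 2 * pi)" by (simp add: field_simps)
  then show "sin (9 * pi / 4) = sqrt 2 / 2" by (simp only: sin_periodic sin_45)
  have "sin (3 * pi / 2) = sin (pi / 2 + pi)" by (simp add: field_simps)
  then show "sin (3 * pi / 2) = - 1" by (simp only: sin_periodic_pi sin_pi_half)
qed

lemma qint_values:
  assumes "q \<in> {1, 3}"
  shows "qint q 0 = 1" "qint q 1 = 1" "qint q 2 = of_real (root2 q)" "qint q 3 = 1"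
proof -
  have *: "2 * (3 * pi / 4) = 3 * pi / 2" "3 * (3 * pi / 4) = 9 * pi / 4" "2 * (pi / 4) = pi / 2" by auto
  show "qint q 0 = 1" by (simp add: qint_def)
  have s: "sin (real q * pi / 4) = sqrt 2 / 2" "sin (2 * (real q * pi / 4)) = root2 q * (sqrt 2 / 2)"
      "sin (3 * (real q * pi / 4)) = sqrt 2 / 2"
    using assms sin_multiples_45
    by (auto simp: * sin_45 sin_multiples_45 sin_multiples_45(3)[unfolded mult.commute[of 3 pi]] root2_def)
  show "qint q 1 = 1" using qint_eq_sin[of 1 q] s(1) by simp
  have "qint q 2 = of_real (sin (2 * (real q * pi / 4)) / sin (real q * pi / 4))"
    using qint_eq_sin[of 2 q] by (simp only: of_nat_numeral zero_less_numeral)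
  then show "qint q 2 = of_real (root2 q)" unfolding s by simp
  have "qint q 3 = of_real (sin (3 * (real q * pi / 4)) / sin (real q * pi / 4))"
    using qint_eq_sin[of 3 q] by (simp only: of_nat_numeral zero_less_numeral)
  then show "qint q 3 = 1" unfolding s by simp
qed

lemma qfact_values:
  assumes "q \<in> {1, 3}"
  shows "qfact q 0 = 1" "qfact q (Suc 0) = 1" "qfact q 2 = of_real (root2 q)" "qfact q 3 = of_real (root2 q)"
    "qfact q (Suc (Suc 0)) = of_real (root2 q)" "qfact q (Suc (Suc (Suc 0))) = of_real (root2 q)"
proof -
  have "{..0} = {0::nat}" "{..Suc 0} = {0, 1}" "{..2} = {0, 1, 2::nat}" "{..3} = {0, 1, 2, 3::nat}" by auto
  then show "qfact q 0 = 1" "qfact q (Suc 0) = 1" "qfact q 2 = of_real (root2 q)" "qfact q 3 = of_real (root2 q)"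
    using qint_values[OF assms] by (simp_all add: qfact_def)
  then show "qfact q (Suc (Suc 0)) = of_real (root2 q)" "qfact q (Suc (Suc (Suc 0))) = of_real (root2 q)"
    by (simp_all add: numeral_eq_Suc)
qed

text \<open>Admissibility of a triangle in doubled colours, which are the natural numbers 0, 1, 2;
  the bound \<open>r - 2 = 2\<close> doubles to 4.\<close>

definition adm3 :: "nat \<Rightarrow> nat \<Rightarrow> nat \<Rightarrow> bool" where
  "adm3 a b c \<longleftrightarrow> even (a + b + c) \<and> a \<le> b + c \<and> b \<le> a + c \<and> c \<le> a + b \<and> a + b + c \<le> 4"

lemma adm3_cases:
  assumes "adm3 a b c" "a \<le> 2" "b \<le> 2" "c \<le> 2"
  shows "(a, b, c) \<in> {(0,0,0), (0,1,1), (1,0,1), (1,1,0), (0,2,2), (2,0,2), (2,2,0), (1,1,2), (1,2,1), (2,1,1)}"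
proof -
  have "a \<in> {0, 1, 2}" "b \<in> {0, 1, 2}" "c \<in> {0, 1, 2}" using assms by auto
  then show ?thesis using assms(1) unfolding adm3_def by (elim insertE emptyE) simp_all
qed

lemma edge_weight_values:
  assumes "q \<in> {1, 3}" "a \<le> 2"
  shows "edge_weight q (real a / 2) = (if a = 1 then - of_real (root2 q) else 1)"
proof -
  have "a \<in> {0, 1, 2}" using assms by auto
  then show ?thesis using qint_values[OF assms(1)] by (auto simp: edge_weight_def)
qed

text \<open>Up to order the doubled colours are (0,0,0), (0,2,2), (0,1,1) or (1,1,2). The first two
  have weight 1, and the other two, which carry a segment of the surface, have weights -1/x and 1/x.
  The second factor is the sign by which these differ.\<close>

lemma triangle_weight_values:
  assumes "q \<in> {1, 3}" "adm3 a b c" "a \<le> 2" "b \<le> 2" "c \<le> 2"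
  shows "triangle_weight q (real a / 2) (real b / 2) (real c / 2) =
    (if a = 1 \<or> b = 1 \<or> c = 1 then inverse (- of_real (root2 q)) else 1) *
    (if (a = 1 \<or> b = 1 \<or> c = 1) \<and> (a = 2 \<or> b = 2 \<or> c = 2) then - 1 else 1)"
proof -
  have "root2 q \<noteq> 0" by (simp add: root2_def)
  then show ?thesis
    using adm3_cases[OF assms(2-5)] qfact_values[OF assms(1)]
    by (elim insertE emptyE) (simp_all add: triangle_weight_def field_simps)
qed

text \<open>The summation index runs from the largest half-sum over a triangle, the
  \<open>l\<close>s, to the smallest half-sum over a quadrilateral, the \<open>u\<close>s. If both
  equal \<open>m\<close>, one term survives. At r = 4 this happens for every admissible colouring of
  a tetrahedron, as \<open>tet_weight_values\<close> checks.\<close>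

lemma tet_weight_single_term:
  fixes a0 a1 a2 a3 a4 a5 m l1 l2 l3 l4 u1 u2 u3 :: nat
  assumes l: "a0 + a1 + a3 = 2 * l1" "a0 + a2 + a4 = 2 * l2" "a1 + a2 + a5 = 2 * l3" "a3 + a4 + a5 = 2 * l4"
    and u: "a0 + a1 + a4 + a5 = 2 * u1" "a0 + a2 + a3 + a5 = 2 * u2" "a1 + a2 + a3 + a4 = 2 * u3"
    and m: "m \<in> {l1, l2, l3, l4}" "m \<in> {u1, u2, u3}"
    and le: "l1 \<le> m" "l2 \<le> m" "l3 \<le> m" "l4 \<le> m" "m \<le> u1" "m \<le> u2" "m \<le> u3"
  shows "tet_weight q (real a0 / 2) (real a1 / 2) (real a2 / 2) (real a3 / 2) (real a4 / 2) (real a5 / 2) =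
    (-1) ^ m * qfact q (m + 1) /
    (qfact q (m - l1) * qfact q (m - l2) * qfact q (m - l3) * qfact q (m - l4) *
     (qfact q (u1 - m) * qfact q (u2 - m) * qfact q (u3 - m)))"
proof -
  have L: "real a0 / 2 + real a1 / 2 + real a3 / 2 = of_int (int l1)"
      "real a0 / 2 + real a2 / 2 + real a4 / 2 = of_int (int l2)"
      "real a1 / 2 + real a2 / 2 + real a5 / 2 = of_int (int l3)"
      "real a3 / 2 + real a4 / 2 + real a5 / 2 = of_int (int l4)"
    using arg_cong[OF l(1), of real] arg_cong[OF l(2), of real] arg_cong[OF l(3), of real] arg_cong[OF l(4), of real]
    by auto
  have U: "real a0 / 2 + real a1 / 2 + real a4 / 2 + real a5 / 2 = of_int (int u1)"
      "real a0 / 2 + real a2 / 2 + real a3 / 2 + real a5 / 2 = of_int (int u2)"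
      "real a1 / 2 + real a2 / 2 + real a3 / 2 + real a4 / 2 = of_int (int u3)"
    using arg_cong[OF u(1), of real] arg_cong[OF u(2), of real] arg_cong[OF u(3), of real]
    by auto
  have 1: "0 \<le> real_of_int s - of_int (int l) \<longleftrightarrow> int l \<le> s" for s l by linarith
  have 2: "0 \<le> of_int (int l) - real_of_int s \<longleftrightarrow> s \<le> int l" for s l by linarith
  have "{s. (\<forall>x\<in>set [of_int (int l1), of_int (int l2), of_int (int l3), of_int (int l4)]. 0 \<le> real_of_int s - x)
      \<and> (\<forall>x\<in>set [of_int (int u1), of_int (int u2), of_int (int u3)]. 0 \<le> x - real_of_int s)} = {int m}"
    (is "?S = _")
  proof -
    have "?S = {s. int l1 \<le> s \<and> int l2 \<le> s \<and> int l3 \<le> s \<and> int l4 \<le> s \<and> s \<le> int u1 \<and> s \<le> int u2 \<and> s \<le> int u3}"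
      unfolding set_simps ball_simps 1 2 by auto
    also have "\<dots> = {int m}" using m le by auto
    finally show ?thesis .
  qed
  moreover have "nat \<lfloor>real_of_int (int m) - real_of_int (int l)\<rfloor> = m - l" for m l
    unfolding of_int_diff[symmetric] floor_of_int by simp
  moreover have "nat (int m + 1) = m + 1" by simp
  ultimately show ?thesis
    unfolding tet_weight_def Let_def L U by (simp add: mult.assoc)
qed

text \<open>Among admissible triples this singles out (1,1,2) up to order, the only kind whose
  weight carries a sign besides that of -1/x.\<close>

definition mixed :: "nat \<Rightarrow> nat \<Rightarrow> nat \<Rightarrow> nat" where
  "mixed a b c = (if (a = 1 \<or> b = 1 \<or> c = 1) \<and> (a = 2 \<or> b = 2 \<or> c = 2) then 1 else 0)"

text \<open>The sign exponent counts the faces coloured \<open>(1/2, 1/2, 1)\<close>, two at a time, and the octagons;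
  only the latter survive globally because each face also contributes a sign of its own.\<close>

lemma tet_weight_values:
  assumes q: "q \<in> {1, 3}"
    and "adm3 a0 a1 a3" "adm3 a0 a2 a4" "adm3 a1 a2 a5" "adm3 a3 a4 a5"
    and "a0 \<le> 2" "a1 \<le> 2" "a2 \<le> 2" "a3 \<le> 2" "a4 \<le> 2" "a5 \<le> 2"
  defines "k \<equiv> mixed a0 a1 a3 + mixed a0 a2 a4 + mixed a1 a2 a5 + mixed a3 a4 a5"
  shows "even k"
    and "tet_weight q (real a0 / 2) (real a1 / 2) (real a2 / 2) (real a3 / 2) (real a4 / 2) (real a5 / 2) =
      (if 1 \<in> {a0, a1, a2, a3, a4, a5} then - of_real (root2 q) else 1) *
      (-1) ^ (k div 2 + (if 0 \<in> {a0, a1, a2, a3, a4, a5} then 0 else 1))"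
    and "1 \<in> {a0, a1, a2, a3, a4, a5} \<longleftrightarrow>
      (\<exists>v<4. (a0 = 1 \<longleftrightarrow> v = 0 \<or> v = 1) \<and> (a1 = 1 \<longleftrightarrow> v = 0 \<or> v = 2) \<and> (a2 = 1 \<longleftrightarrow> v = 0 \<or> v = 3) \<and>
         (a3 = 1 \<longleftrightarrow> v = 1 \<or> v = 2) \<and> (a4 = 1 \<longleftrightarrow> v = 1 \<or> v = 3) \<and> (a5 = 1 \<longleftrightarrow> v = 2 \<or> v = (3::nat))) \<or>
      (a0 \<noteq> 1 \<and> a1 = 1 \<and> a2 = 1 \<and> a3 = 1 \<and> a4 = 1 \<and> a5 \<noteq> 1) \<or>
      (a0 = 1 \<and> a1 \<noteq> 1 \<and> a2 = 1 \<and> a3 = 1 \<and> a4 \<noteq> 1 \<and> a5 = 1) \<or>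
      (a0 = 1 \<and> a1 = 1 \<and> a2 \<noteq> 1 \<and> a3 \<noteq> 1 \<and> a4 = 1 \<and> a5 = 1)" (is ?half)
    and "0 \<notin> {a0, a1, a2, a3, a4, a5} \<longleftrightarrow>
      (a0 = 2 \<and> a1 = 1 \<and> a2 = 1 \<and> a3 = 1 \<and> a4 = 1 \<and> a5 = 2) \<or>
      (a0 = 1 \<and> a1 = 2 \<and> a2 = 1 \<and> a3 = 1 \<and> a4 = 2 \<and> a5 = 1) \<or>
      (a0 = 1 \<and> a1 = 1 \<and> a2 = 2 \<and> a3 = 2 \<and> a4 = 1 \<and> a5 = 1)" (is ?full)
proof -
  have 4: "(\<exists>v<4. P v) \<longleftrightarrow> P 0 \<or> P 1 \<or> P 2 \<or> P (3::nat)" for P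
    by (auto simp: numeral_eq_Suc less_Suc_eq)
  define l1 l2 l3 l4 where "l1 = (a0 + a1 + a3) div 2" "l2 = (a0 + a2 + a4) div 2"
    "l3 = (a1 + a2 + a5) div 2" "l4 = (a3 + a4 + a5) div 2"
  define u1 u2 u3 where "u1 = (a0 + a1 + a4 + a5) div 2" "u2 = (a0 + a2 + a3 + a5) div 2"
    "u3 = (a1 + a2 + a3 + a4) div 2"
  note lu = l1_l2_l3_l4_def u1_u2_u3_def
  define m where "m = max (max l1 l2) (max l3 l4)"
  note c = adm3_cases[OF assms(2)] adm3_cases[OF assms(3)] adm3_cases[OF assms(4)] adm3_cases[OF assms(5)]
  have e: "even (a0 + a1 + a3)" "even (a0 + a2 + a4)" "even (a1 + a2 + a5)" "even (a3 + a4 + a5)"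
    using assms(2-5) by (simp_all only: adm3_def)
  then have l: "a0 + a1 + a3 = 2 * l1" "a0 + a2 + a4 = 2 * l2" "a1 + a2 + a5 = 2 * l3" "a3 + a4 + a5 = 2 * l4"
    unfolding lu by (simp_all only: dvd_mult_div_cancel)
  have "even (a0 + a1 + a4 + a5)" "even (a0 + a2 + a3 + a5)" "even (a1 + a2 + a3 + a4)"
    using e unfolding even_add by blast+
  then have u: "a0 + a1 + a4 + a5 = 2 * u1" "a0 + a2 + a3 + a5 = 2 * u2" "a1 + a2 + a3 + a4 = 2 * u3"
    unfolding lu by (simp_all only: dvd_mult_div_cancel)
  have m: "m \<in> {l1, l2, l3, l4}" "l1 \<le> m" "l2 \<le> m" "l3 \<le> m" "l4 \<le> m" by (auto simp: m_def max_def)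
  \<comment> \<open>Completions of an edge coloured \<open>a0\<close> to an admissible triangle. The
    two triangles at this edge restrict (\<open>a1\<close>, \<open>a3\<close>) and
    (\<open>a2\<close>, \<open>a4\<close>) to this list, after which only \<open>a5\<close> has to
    be tried.\<close>
  let ?pairs = "\<lambda>a0. if a0 = 0 then {(0, 0), (1, 1), (2, 2)} else
    if a0 = 1 then {(0, 1), (1, 0), (1, 2), (2, 1)} else {(0, 2), (2, 0), (1, 1::nat)}"
  have a: "a0 \<in> {0, 1, 2}" "a5 \<in> {0, 1, 2}" using assms by auto
  have p: "(a1, a3) \<in> ?pairs a0" "(a2, a4) \<in> ?pairs a0" using c(1,2) assms(6-11) by auto
  \<comment> \<open>All 36 admissible colourings: 8 integral ones, 16 whose edges coloured 1/2 are
    those at one vertex (4 per vertex), and 12 whose edges coloured 1/2 avoid a pair of opposite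
    edges (4 per pair, one of them the octagon).\<close>
  have "(a0, a1, a2, a3, a4, a5) \<in> {(0,0,0,0,0,0),
      (1,1,1,0,0,0), (1,0,0,1,1,0), (0,1,0,1,0,1), (0,0,1,0,1,1),
      (2,2,2,0,0,0), (2,0,0,2,2,0), (0,2,0,2,0,2), (0,0,2,0,2,2),
      (2,2,0,0,2,2), (2,0,2,2,0,2), (0,2,2,2,2,0),
      (1,1,1,2,2,0), (1,1,1,2,0,2), (1,1,1,0,2,2),
      (1,2,2,1,1,0), (1,2,0,1,1,2), (1,0,2,1,1,2),
      (2,1,2,1,0,1), (2,1,0,1,2,1), (0,1,2,1,2,1),
      (2,2,1,0,1,1), (2,0,1,2,1,1), (0,2,1,2,1,1),
      (0,1,1,1,1,0), (2,1,1,1,1,0), (0,1,1,1,1,2), (2,1,1,1,1,2),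
      (1,0,1,1,0,1), (1,2,1,1,0,1), (1,0,1,1,2,1), (1,2,1,1,2,1),
      (1,1,0,0,1,1), (1,1,2,0,1,1), (1,1,0,2,1,1), (1,1,2,2,1,1)}" (is "?a \<in> ?C")
    using a(1)
  proof (elim insertE emptyE)
    assume "a0 = 0"
    then show ?thesis using p a(2) by (simp, elim disjE conjE; use c(3,4) assms(6-11) in simp)
  next
    assume "a0 = 1"
    then show ?thesis using p a(2) by (simp, elim disjE conjE; use c(3,4) assms(6-11) in simp)
  next
    assume "a0 = 2"
    then show ?thesis using p a(2) by (simp, elim disjE conjE; use c(3,4) assms(6-11) in simp)
  qed
  then show "even k" and ?half and ?full
    unfolding k_def mixed_def 4 by (elim insertE emptyE Pair_inject; simp)+
  have m': "m \<in> {u1, u2, u3}" "m \<le> u1" "m \<le> u2" "m \<le> u3"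
    using \<open>?a \<in> ?C\<close> unfolding m_def lu by (elim insertE emptyE Pair_inject; simp)+
  have "root2 q \<noteq> 0" by (simp add: root2_def)
  moreover have "of_real (root2 q) * of_real (root2 q) = (2::complex)"
    by (metis of_real_mult of_real_numeral root2_square)
  ultimately show "tet_weight q (real a0 / 2) (real a1 / 2) (real a2 / 2) (real a3 / 2) (real a4 / 2) (real a5 / 2) =
      (if 1 \<in> {a0, a1, a2, a3, a4, a5} then - of_real (root2 q) else 1) *
      (-1) ^ (k div 2 + (if 0 \<in> {a0, a1, a2, a3, a4, a5} then 0 else 1))"
    unfolding tet_weight_single_term[OF l u m(1) m'(1) m(2-5) m'(2-4)]
    using \<open>?a \<in> ?C\<close> qfact_values[OF q] unfolding m_def lu k_def mixed_def
    by (elim insertE emptyE Pair_inject) (simp_all add: field_simps)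
qed

lemma prod_if_const:
  fixes c :: "'a :: comm_monoid_mult"
  assumes "finite A"
  shows "(\<Prod>x\<in>A. if P x then c else 1) = c ^ card {x \<in> A. P x}"
  using assms by (simp add: prod.inter_filter[symmetric])

lemma less_4_cases: "(\<forall>v<4. P v) \<longleftrightarrow> P 0 \<and> P 1 \<and> P 2 \<and> P (3::nat)" "(\<exists>v<4. P v) \<longleftrightarrow> P 0 \<or> P 1 \<or> P 2 \<or> P (3::nat)"
  by (auto simp: numeral_eq_Suc less_Suc_eq)

lemma pairs_of_4:
  "(A \<subseteq> {..<4} \<and> card A = 2) \<longleftrightarrow> A \<in> {{0,1}, {0,2}, {0,3}, {1,2}, {1,3}, {2,3::nat}}"
proof
  assume "A \<subseteq> {..<4} \<and> card A = 2"
  then obtain a b where ab: "A = {a, b}" "a \<noteq> b" "a < 4" "b < 4" unfolding card_2_iff by auto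
  have "a \<in> {0, 1, 2, 3}" "b \<in> {0, 1, 2, 3}" using ab by auto
  then show "A \<in> {{0,1}, {0,2}, {0,3}, {1,2}, {1,3}, {2,3}}"
    using ab(1,2) by (elim insertE emptyE) (simp_all add: doubleton_eq_iff)
qed auto

lemma all_pairs_of_4:
  "(\<forall>A\<subseteq>{..<4::nat}. card A = 2 \<longrightarrow> Q A) \<longleftrightarrow>
    Q {0,1} \<and> Q {0,2} \<and> Q {0,3} \<and> Q {1,2} \<and> Q {1,3} \<and> Q {2,3}"
proof -
  have "(\<forall>A\<subseteq>{..<4::nat}. card A = 2 \<longrightarrow> Q A) \<longleftrightarrow> (\<forall>A. A \<subseteq> {..<4} \<and> card A = 2 \<longrightarrow> Q A)" by blast
  then show ?thesis unfolding pairs_of_4 by (simp add: all_conj_distrib)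
qed

lemma ex_pairs_of_4:
  "(\<exists>A\<subseteq>{..<4::nat}. card A = 2 \<and> Q A) \<longleftrightarrow>
    Q {0,1} \<or> Q {0,2} \<or> Q {0,3} \<or> Q {1,2} \<or> Q {1,3} \<or> Q {2,3}"
  using all_pairs_of_4[of "\<lambda>A. \<not> Q A"] by blast

lemma complement_pairs_of_4:
  "{..<4} - {0, 1} = {2, 3::nat}" "{..<4} - {0, 2} = {1, 3::nat}" "{..<4} - {0, 3} = {1, 2::nat}"
  "{..<4} - {1, 2} = {0, 3::nat}" "{..<4} - {1, 3} = {0, 2::nat}" "{..<4} - {2, 3} = {0, 1::nat}"
  by auto

lemma complement_vertices_of_4:
  "{..<4} - {3} = {0, 1, 2::nat}" "{..<4} - {2} = {0, 1, 3::nat}" "{..<4} - {1} = {0, 2, 3::nat}"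
  "{..<4} - {0} = {1, 2, 3::nat}"
  by auto

lemma triangle_weight_commute:
  "triangle_weight q i k j = triangle_weight q i j k" "triangle_weight q j i k = triangle_weight q i j k"
  by (simp_all add: triangle_weight_def ac_simps)

definition twice :: "colouring \<Rightarrow> (nat \<times> nat set) set \<Rightarrow> nat" where
  "twice \<theta> e = nat \<lfloor>2 * \<theta> e\<rfloor>"

lemma adm3_halves:
  "(real a / 2 + real b / 2 + real c / 2 \<in> \<int> \<and> real a / 2 \<le> real b / 2 + real c / 2 \<and>
    real b / 2 \<le> real a / 2 + real c / 2 \<and> real c / 2 \<le> real a / 2 + real b / 2 \<and>
    real a / 2 + real b / 2 + real c / 2 \<le> real 4 - 2) \<longleftrightarrow> adm3 a b c"
proof -
  have "real m / 2 \<in> \<int> \<longleftrightarrow> even m" for m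
  proof
    assume "real m / 2 \<in> \<int>"
    then obtain z where "real m / 2 = of_int z" by (auto elim: Ints_cases)
    then have "real_of_int (int m) = of_int (2 * z)" by simp
    then have "int m = 2 * z" by (simp only: of_int_eq_iff)
    then show "even m" by presburger
  qed (auto elim!: evenE)
  moreover have "real a / 2 + real b / 2 + real c / 2 = real (a + b + c) / 2" by simp
  ultimately have "real a / 2 + real b / 2 + real c / 2 \<in> \<int> \<longleftrightarrow> even (a + b + c)" by (simp only:)
  then show ?thesis unfolding adm3_def by auto
qed

section \<open>Weight of an admissible colouring of a triangulation\<close>

context gluing begin

text \<open>Replaces the quantification over triangle classes by one over vertex triples of single
  tetrahedra. In this local form admissibility can be used for tetrahedron weights and tested by a
  program.\<close>

lemma Adm_iff:
  "\<theta> \<in> Adm T 4 \<longleftrightarrow> \<theta> \<in> extensional (edges T) \<and>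
    (\<forall>e\<in>edges T. \<theta> e = real (twice \<theta> e) / 2 \<and> twice \<theta> e \<le> 2) \<and>
    (\<forall>t<n. \<forall>a<4. \<forall>b<4. \<forall>c<4. a \<noteq> b \<longrightarrow> a \<noteq> c \<longrightarrow> b \<noteq> c \<longrightarrow>
       adm3 (twice \<theta> (face_class T t {a, b})) (twice \<theta> (face_class T t {a, c}))
         (twice \<theta> (face_class T t {b, c})))" (is "?L \<longleftrightarrow> ?E \<and> ?H \<and> ?A")
proof -
  have 1: "\<theta> \<in> edges T \<rightarrow>\<^sub>E {real c / 2 | c. c \<le> 4 - 2} \<longleftrightarrow> ?E \<and> ?H"
  proof -
    have "x \<in> {real c / 2 | c. c \<le> 4 - 2} \<longleftrightarrow> x = real (nat \<lfloor>2 * x\<rfloor>) / 2 \<and> nat \<lfloor>2 * x\<rfloor> \<le> 2" for x :: real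
    proof
      assume "x \<in> {real c / 2 | c. c \<le> 4 - 2}"
      then obtain c where c: "x = real c / 2" "c \<le> 2" by auto
      show "x = real (nat \<lfloor>2 * x\<rfloor>) / 2 \<and> nat \<lfloor>2 * x\<rfloor> \<le> 2" unfolding c(1) using c(2) by simp
    next
      assume *: "x = real (nat \<lfloor>2 * x\<rfloor>) / 2 \<and> nat \<lfloor>2 * x\<rfloor> \<le> 2"
      show "x \<in> {real c / 2 | c. c \<le> 4 - 2}"
        by (rule CollectI, rule exI[of _ "nat \<lfloor>2 * x\<rfloor>"]) (use * in simp)
    qed
    then show ?thesis by (auto simp: PiE_def Pi_def twice_def)
  qed
  have 2: "(\<forall>F \<in> triangles T. \<forall>i j k. triangle_coloured T \<theta> F i j k \<longrightarrow>
       i + j + k \<in> \<int> \<and> i \<le> j + k \<and> j \<le> i + k \<and> k \<le> i + j \<and> i + j + k \<le> real 4 - 2) \<longleftrightarrow> ?A"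
    (is "?B \<longleftrightarrow> _") if H: ?H
  proof
    assume B: ?B
    show ?A
    proof (intro allI impI)
      fix t a b c :: nat assume *: "t < n" "a < 4" "b < 4" "c < 4" "a \<noteq> b" "a \<noteq> c" "b \<noteq> c"
      note B[rule_format, OF triangle_colouredI(2)[OF *] triangle_colouredI(1)[OF *]]
      moreover have "colour T \<theta> t {a, b} = real (twice \<theta> (face_class T t {a, b})) / 2"
        "colour T \<theta> t {a, c} = real (twice \<theta> (face_class T t {a, c})) / 2"
        "colour T \<theta> t {b, c} = real (twice \<theta> (face_class T t {b, c})) / 2"
        using * edgeI H by simp_all
      ultimately show "adm3 (twice \<theta> (face_class T t {a, b})) (twice \<theta> (face_class T t {a, c}))
         (twice \<theta> (face_class T t {b, c}))"
        unfolding adm3_halves[symmetric] by metis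
    qed
  next
    assume A: ?A
    show ?B
    proof (intro ballI allI impI)
      fix F i j k assume F: "F \<in> triangles T" "triangle_coloured T \<theta> F i j k"
      then obtain t a b c where t: "(t, {a, b, c}) \<in> F" "a \<noteq> b" "a \<noteq> c" "b \<noteq> c"
        "i = colour T \<theta> t {a, b}" "j = colour T \<theta> t {a, c}" "k = colour T \<theta> t {b, c}"
        unfolding triangle_coloured_def by blast
      have *: "t < n" "a < 4" "b < 4" "c < 4" using mem_triangle[OF F(1) t(1)] by auto
      have ijk: "i = real (twice \<theta> (face_class T t {a, b})) / 2"
        "j = real (twice \<theta> (face_class T t {a, c})) / 2"
        "k = real (twice \<theta> (face_class T t {b, c})) / 2"
        unfolding t(5-7) using * t(2-4) edgeI H by simp_all
      show "i + j + k \<in> \<int> \<and> i \<le> j + k \<and> j \<le> i + k \<and> k \<le> i + j \<and> i + j + k \<le> real 4 - 2"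
        unfolding ijk adm3_halves using A * t(2-4) by blast
    qed
  qed
  show ?thesis unfolding Adm_def mem_Collect_eq 1 using 2 by blast
qed

lemma finite_Adm: "finite (Adm T r)"
proof -
  have "{real c / 2 | c. c \<le> r - 2} = (\<lambda>c. real c / 2) ` {..r - 2}" by auto
  then have "finite {real c / 2 | c. c \<le> r - 2}" by simp
  then have "finite (edges T \<rightarrow>\<^sub>E {real c / 2 | c. c \<le> r - 2})" using finite_edges by (intro finite_PiE)
  then show ?thesis by (rule rev_finite_subset) (auto simp: Adm_def)
qed

lemma triangle_coloured_perms:
  assumes "triangle_coloured T \<theta> F i j k"
  shows "triangle_coloured T \<theta> F i k j" "triangle_coloured T \<theta> F j i k"
proof -
  obtain t a b c where *: "(t, {a, b, c}) \<in> F" "a \<noteq> b" "a \<noteq> c" "b \<noteq> c"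
    "i = colour T \<theta> t {a, b}" "j = colour T \<theta> t {a, c}" "k = colour T \<theta> t {b, c}"
    using assms unfolding triangle_coloured_def by blast
  have "triangle_coloured T \<theta> F (colour T \<theta> t {a, c}) (colour T \<theta> t {a, b}) (colour T \<theta> t {c, b})"
    unfolding triangle_coloured_def
    by (intro exI[of _ t] exI[of _ a] exI[of _ c] exI[of _ b]) (use * in \<open>simp add: insert_commute\<close>)
  then show "triangle_coloured T \<theta> F j i k" unfolding *(5-7) by (simp only: insert_commute)
  have "triangle_coloured T \<theta> F (colour T \<theta> t {b, a}) (colour T \<theta> t {b, c}) (colour T \<theta> t {a, c})"
    unfolding triangle_coloured_def
    by (intro exI[of _ t] exI[of _ b] exI[of _ a] exI[of _ c]) (use * in \<open>simp add: insert_commute\<close>)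
  then show "triangle_coloured T \<theta> F i k j" unfolding *(5-7) by (simp only: insert_commute)
qed

definition some_colour :: "colouring \<Rightarrow> (nat \<times> nat set) set \<Rightarrow> real \<Rightarrow> bool" where
  "some_colour \<theta> F i \<longleftrightarrow> (\<exists>j k. triangle_coloured T \<theta> F i j k)"

lemma some_colour_iff:
  assumes "F \<in> triangles T" "triangle_coloured T \<theta> F i j k"
  shows "some_colour \<theta> F x \<longleftrightarrow> x = i \<or> x = j \<or> x = k"
proof
  assume "some_colour \<theta> F x"
  then obtain y z where "triangle_coloured T \<theta> F x y z" by (auto simp: some_colour_def)
  from triangle_coloured_unique[OF assms(1,2) this] show "x = i \<or> x = j \<or> x = k" by auto
next
  have "triangle_coloured T \<theta> F j i k" "triangle_coloured T \<theta> F k i j"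
    using triangle_coloured_perms[OF assms(2)] triangle_coloured_perms(2) by blast+
  then show "x = i \<or> x = j \<or> x = k \<Longrightarrow> some_colour \<theta> F x" using assms(2) unfolding some_colour_def by blast
qed

definition mixed_face :: "colouring \<Rightarrow> (nat \<times> nat set) set \<Rightarrow> nat" where
  "mixed_face \<theta> F = (if some_colour \<theta> F (1/2) \<and> some_colour \<theta> F 1 then 1 else 0)"

context
  fixes \<theta> assumes Adm: "\<theta> \<in> Adm T 4"
begin

lemma edge_colour: "e \<in> edges T \<Longrightarrow> \<theta> e = real (twice \<theta> e) / 2" "e \<in> edges T \<Longrightarrow> twice \<theta> e \<le> 2"
  using Adm unfolding Adm_iff by blast+

lemma reduction_eq:
  assumes "e \<in> edges T"
  shows "reduction T \<theta> e = (if twice \<theta> e = 1 then 1/2 else 0)"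
proof -
  have "reduction T \<theta> e = real (twice \<theta> e) / 2 - \<lfloor>real (twice \<theta> e) / 2\<rfloor>"
    unfolding edge_colour(1)[OF assms, symmetric] using assms by (simp add: reduction_def)
  moreover have "twice \<theta> e \<in> {0, 1, 2}" using edge_colour(2)[OF assms] by auto
  ultimately show ?thesis by auto
qed

lemma tet_adm3:
  "t < n \<Longrightarrow> a < 4 \<Longrightarrow> b < 4 \<Longrightarrow> c < 4 \<Longrightarrow> a \<noteq> b \<Longrightarrow> a \<noteq> c \<Longrightarrow> b \<noteq> c \<Longrightarrow>
    adm3 (twice \<theta> (face_class T t {a, b})) (twice \<theta> (face_class T t {a, c}))
      (twice \<theta> (face_class T t {b, c}))"
  using Adm unfolding Adm_iff by blast

lemma triangle_colours:
  assumes "F \<in> triangles T"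
  obtains a b c where "triangle_coloured T \<theta> F (real a / 2) (real b / 2) (real c / 2)"
    "adm3 a b c" "a \<le> 2" "b \<le> 2" "c \<le> 2"
proof -
  obtain t A where t: "F = face_class T t A" "t < n" "A \<subseteq> {..<4}" "card A = 3"
    using assms by (auto simp: triangles_def)
  then obtain a b c where A: "A = {a, b, c}" "a \<noteq> b" "a \<noteq> c" "b \<noteq> c" by (auto simp: card_3_iff)
  have *: "t < n" "a < 4" "b < 4" "c < 4" "a \<noteq> b" "a \<noteq> c" "b \<noteq> c" using t A by auto
  show thesis
    using that[OF _ tet_adm3[OF *]] triangle_colouredI(1)[OF *, of \<theta>] edge_colour edgeI * t(1) A(1)
    by metis
qed

lemma mixed_face_eq:
  assumes "t < n" "a < 4" "b < 4" "c < 4" "a \<noteq> b" "a \<noteq> c" "b \<noteq> c"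
  shows "mixed_face \<theta> (face_class T t {a, b, c}) =
    mixed (twice \<theta> (face_class T t {a, b})) (twice \<theta> (face_class T t {a, c})) (twice \<theta> (face_class T t {b, c}))"
proof -
  have "colour T \<theta> t {a, b} = real (twice \<theta> (face_class T t {a, b})) / 2"
    "colour T \<theta> t {a, c} = real (twice \<theta> (face_class T t {a, c})) / 2"
    "colour T \<theta> t {b, c} = real (twice \<theta> (face_class T t {b, c})) / 2"
    using assms edgeI edge_colour by simp_all
  then show ?thesis
    unfolding mixed_face_def some_colour_iff[OF triangle_colouredI(2)[OF assms] triangle_colouredI(1)[OF assms]]
      mixed_def by auto
qed

lemma edges_product:
  assumes "q \<in> {1, 3}"
  shows "(\<Prod>e\<in>edges T. edge_weight q (\<theta> e)) = (- of_real (root2 q)) ^ card {e \<in> edges T. twice \<theta> e = 1}"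
proof -
  have "edge_weight q (\<theta> e) = (if twice \<theta> e = 1 then - of_real (root2 q) else 1)" if "e \<in> edges T" for e
    using edge_weight_values[OF assms edge_colour(2)[OF that]] unfolding edge_colour(1)[OF that, symmetric] .
  then show ?thesis
    unfolding prod_if_const[OF finite_edges, symmetric] by (intro prod.cong) auto
qed

lemma triangles_product:
  assumes q: "q \<in> {1, 3}"
  shows "(\<Prod>F\<in>triangles T. THE w. \<exists>i j k. triangle_coloured T \<theta> F i j k \<and> w = triangle_weight q i j k) =
    inverse (- of_real (root2 q)) ^ card {F \<in> triangles T. some_colour \<theta> F (1/2)} *
    (-1) ^ (\<Sum>F\<in>triangles T. mixed_face \<theta> F)"
proof -
  have "(THE w. \<exists>i j k. triangle_coloured T \<theta> F i j k \<and> w = triangle_weight q i j k) =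
      (if some_colour \<theta> F (1/2) then inverse (- of_real (root2 q)) else 1) * (- 1) ^ mixed_face \<theta> F"
    (is "?L = ?R") if F: "F \<in> triangles T" for F
  proof (rule the_equality)
    obtain a b c where abc: "triangle_coloured T \<theta> F (real a / 2) (real b / 2) (real c / 2)"
      "adm3 a b c" "a \<le> 2" "b \<le> 2" "c \<le> 2" using triangle_colours[OF F] .
    have R: "triangle_weight q (real a / 2) (real b / 2) (real c / 2) = ?R"
      unfolding triangle_weight_values[OF q abc(2-5)] mixed_face_def some_colour_iff[OF F abc(1)]
      by auto
    then show "\<exists>i j k. triangle_coloured T \<theta> F i j k \<and> ?R = triangle_weight q i j k"
      using abc(1) by metis
    fix w assume "\<exists>i j k. triangle_coloured T \<theta> F i j k \<and> w = triangle_weight q i j k"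
    then obtain i j k where ijk: "triangle_coloured T \<theta> F i j k" "w = triangle_weight q i j k" by blast
    show "w = ?R"
      using triangle_coloured_unique[OF F abc(1) ijk(1)] unfolding R[symmetric] ijk(2)
      by (elim insertE emptyE Pair_inject) (simp_all only: triangle_weight_commute)
  qed
  then have "(\<Prod>F\<in>triangles T. THE w. \<exists>i j k. triangle_coloured T \<theta> F i j k \<and> w = triangle_weight q i j k) =
    (\<Prod>F\<in>triangles T. (if some_colour \<theta> F (1/2) then inverse (- of_real (root2 q)) else 1) * (- 1) ^ mixed_face \<theta> F)"
    by (intro prod.cong refl)
  then show ?thesis by (simp only: prod.distrib prod_if_const[OF finite_triangles] power_sum)
qed

text \<open>Under admissibility one edge coloured 1/2 already forces a disc, and the absence of
  edges coloured 0 (the negation of \<open>tet_zero\<close>) forces an octagon; see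
  \<open>tet_facts\<close>. These two tests replace the shape conditions in the definitions of discs
  and octagons.\<close>

definition tet_half :: "nat \<Rightarrow> bool" where
  "tet_half t \<longleftrightarrow> (\<exists>a<4. \<exists>b<4. a \<noteq> b \<and> twice \<theta> (face_class T t {a, b}) = 1)"

definition tet_zero :: "nat \<Rightarrow> bool" where
  "tet_zero t \<longleftrightarrow> (\<exists>a<4. \<exists>b<4. a \<noteq> b \<and> twice \<theta> (face_class T t {a, b}) = 0)"

abbreviation tw :: "nat \<Rightarrow> nat \<Rightarrow> nat \<Rightarrow> nat" where
  "tw t a b \<equiv> twice \<theta> (face_class T t {a, b})"

lemma tet_half_iff: "tet_half t \<longleftrightarrow> 1 \<in> {tw t 0 1, tw t 0 2, tw t 0 3, tw t 1 2, tw t 1 3, tw t 2 3}"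
  unfolding tet_half_def less_4_cases by (simp add: insert_commute) metis

lemma tet_zero_iff: "tet_zero t \<longleftrightarrow> 0 \<in> {tw t 0 1, tw t 0 2, tw t 0 3, tw t 1 2, tw t 1 3, tw t 2 3}"
  unfolding tet_zero_def less_4_cases by (simp add: insert_commute) metis

lemma tet_facts:
  assumes q: "q \<in> {1, 3}" and t: "t < n"
  defines "k \<equiv> \<Sum>f<4. mixed_face \<theta> (face (t, f))"
  shows "even k"
    and "tet_weight q (colour T \<theta> t {0,1}) (colour T \<theta> t {0,2}) (colour T \<theta> t {0,3})
           (colour T \<theta> t {1,2}) (colour T \<theta> t {1,3}) (colour T \<theta> t {2,3}) =
      (if tet_half t then - of_real (root2 q) else 1) * (-1) ^ (k div 2 + (if tet_zero t then 0 else 1))"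
    and "t \<in> triangular_discs T (reduction T \<theta>) \<union> quadrilateral_discs T (reduction T \<theta>) \<longleftrightarrow> tet_half t"
    and "t \<in> octagons T \<theta> \<longleftrightarrow> \<not> tet_zero t"
proof -
  have k: "k = mixed (tw t 0 1) (tw t 0 2) (tw t 1 2) + mixed (tw t 0 1) (tw t 0 3) (tw t 1 3) +
      mixed (tw t 0 2) (tw t 0 3) (tw t 2 3) + mixed (tw t 1 2) (tw t 1 3) (tw t 2 3)"
  proof -
    have 4: "{..<4} = {0, 1, 2, 3::nat}" by auto
    have "k = mixed_face \<theta> (face_class T t {0, 1, 2}) + mixed_face \<theta> (face_class T t {0, 1, 3}) +
      mixed_face \<theta> (face_class T t {0, 2, 3}) + mixed_face \<theta> (face_class T t {1, 2, 3})"
      unfolding k_def face_def prod.case complement_vertices_of_4[symmetric] by (simp add: 4)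
    then show ?thesis
      using mixed_face_eq[OF t, of 0 1 2] mixed_face_eq[OF t, of 0 1 3]
        mixed_face_eq[OF t, of 0 2 3] mixed_face_eq[OF t, of 1 2 3] by simp
  qed
  have adm: "adm3 (tw t 0 1) (tw t 0 2) (tw t 1 2)" "adm3 (tw t 0 1) (tw t 0 3) (tw t 1 3)"
    "adm3 (tw t 0 2) (tw t 0 3) (tw t 2 3)" "adm3 (tw t 1 2) (tw t 1 3) (tw t 2 3)"
    using tet_adm3[OF t] by simp_all
  have e: "face_class T t {0,1} \<in> edges T" "face_class T t {0,2} \<in> edges T" "face_class T t {0,3} \<in> edges T"
    "face_class T t {1,2} \<in> edges T" "face_class T t {1,3} \<in> edges T" "face_class T t {2,3} \<in> edges T"
    using t edgeI by simp_all
  have le: "tw t 0 1 \<le> 2" "tw t 0 2 \<le> 2" "tw t 0 3 \<le> 2" "tw t 1 2 \<le> 2" "tw t 1 3 \<le> 2" "tw t 2 3 \<le> 2"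
    using e edge_colour(2) by simp_all
  note tet = tet_weight_values(1-3)[OF q adm le, folded k tet_half_iff tet_zero_iff]
  note tet_octagon = tet_weight_values(4)[OF q adm le]
  show "even k" by (rule tet(1))
  show "tet_weight q (colour T \<theta> t {0,1}) (colour T \<theta> t {0,2}) (colour T \<theta> t {0,3})
           (colour T \<theta> t {1,2}) (colour T \<theta> t {1,3}) (colour T \<theta> t {2,3}) =
      (if tet_half t then - of_real (root2 q) else 1) * (-1) ^ (k div 2 + (if tet_zero t then 0 else 1))"
    using tet(2) by (simp only: edge_colour(1)[OF e(1)] edge_colour(1)[OF e(2)] edge_colour(1)[OF e(3)]
      edge_colour(1)[OF e(4)] edge_colour(1)[OF e(5)] edge_colour(1)[OF e(6)])
  have half: "reduction T \<theta> x = 1/2 \<longleftrightarrow> twice \<theta> x = 1" if x: "x \<in> edges T" for x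
    by (simp add: reduction_eq[OF x])
  note half = half[OF e(1)] half[OF e(2)] half[OF e(3)] half[OF e(4)] half[OF e(5)] half[OF e(6)]
  have tri: "t \<in> triangular_discs T (reduction T \<theta>) \<longleftrightarrow>
      (\<exists>v<4. (tw t 0 1 = 1 \<longleftrightarrow> v = 0 \<or> v = 1) \<and> (tw t 0 2 = 1 \<longleftrightarrow> v = 0 \<or> v = 2) \<and>
         (tw t 0 3 = 1 \<longleftrightarrow> v = 0 \<or> v = 3) \<and> (tw t 1 2 = 1 \<longleftrightarrow> v = 1 \<or> v = 2) \<and>
         (tw t 1 3 = 1 \<longleftrightarrow> v = 1 \<or> v = 3) \<and> (tw t 2 3 = 1 \<longleftrightarrow> v = 2 \<or> v = (3::nat)))"
    unfolding triangular_discs_def all_pairs_of_4 half mem_Collect_eq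
    by (simp only: t insert_iff empty_iff simp_thms)
  have quad: "t \<in> quadrilateral_discs T (reduction T \<theta>) \<longleftrightarrow>
      (tw t 0 1 \<noteq> 1 \<and> tw t 0 2 = 1 \<and> tw t 0 3 = 1 \<and> tw t 1 2 = 1 \<and> tw t 1 3 = 1 \<and> tw t 2 3 \<noteq> 1) \<or>
      (tw t 0 1 = 1 \<and> tw t 0 2 \<noteq> 1 \<and> tw t 0 3 = 1 \<and> tw t 1 2 = 1 \<and> tw t 1 3 \<noteq> 1 \<and> tw t 2 3 = 1) \<or>
      (tw t 0 1 = 1 \<and> tw t 0 2 = 1 \<and> tw t 0 3 \<noteq> 1 \<and> tw t 1 2 \<noteq> 1 \<and> tw t 1 3 = 1 \<and> tw t 2 3 = 1)"
    unfolding quadrilateral_discs_def mem_Collect_eq all_pairs_of_4 ex_pairs_of_4 complement_pairs_of_4 half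
    using t by (simp add: doubleton_eq_iff disj_ac)
  show "t \<in> triangular_discs T (reduction T \<theta>) \<union> quadrilateral_discs T (reduction T \<theta>) \<longleftrightarrow> tet_half t"
    unfolding Un_iff tri quad tet(3) ..
  have "colour T \<theta> t B = (if Q then 1 else 1/2) \<longleftrightarrow> twice \<theta> (face_class T t B) = (if Q then 2 else 1)"
    if "face_class T t B \<in> edges T" for B Q
    using edge_colour(1)[OF that] by auto
  note col = this[OF e(1)] this[OF e(2)] this[OF e(3)] this[OF e(4)] this[OF e(5)] this[OF e(6)]
  show "t \<in> octagons T \<theta> \<longleftrightarrow> \<not> tet_zero t"
    unfolding tet_zero_iff tet_octagon
    unfolding octagons_def mem_Collect_eq all_pairs_of_4 ex_pairs_of_4 complement_pairs_of_4 col
    using t by (simp add: doubleton_eq_iff disj_ac)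
qed

lemma octagons_eq: "octagons T \<theta> = {t \<in> {..<n}. \<not> tet_zero t}"
proof -
  have "octagons T \<theta> \<subseteq> {..<n}" by (auto simp: octagons_def)
  then show ?thesis using tet_facts(4)[of 1] by blast
qed

lemma discs_eq:
  "triangular_discs T (reduction T \<theta>) \<union> quadrilateral_discs T (reduction T \<theta>) = {t \<in> {..<n}. tet_half t}"
proof -
  have "triangular_discs T (reduction T \<theta>) \<union> quadrilateral_discs T (reduction T \<theta>) \<subseteq> {..<n}"
    by (auto simp: triangular_discs_def quadrilateral_discs_def)
  then show ?thesis using tet_facts(3)[of 1] by blast
qed

lemma points_eq: "surface_points T (reduction T \<theta>) = {e \<in> edges T. twice \<theta> e = 1}"
proof -
  have "2 * reduction T \<theta> x = 1 \<longleftrightarrow> twice \<theta> x = 1" if x: "x \<in> edges T" for x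
    by (simp add: reduction_eq[OF x])
  then show ?thesis unfolding surface_points_def by auto
qed

lemma triangle_coloured_reduction:
  assumes "F \<in> triangles T"
  shows "triangle_coloured T (reduction T \<theta>) F i' j' k' \<longleftrightarrow>
    (\<exists>i j k. triangle_coloured T \<theta> F i j k \<and> i' = i - \<lfloor>i\<rfloor> \<and> j' = j - \<lfloor>j\<rfloor> \<and> k' = k - \<lfloor>k\<rfloor>)"
proof -
  have "colour T (reduction T \<theta>) t {a, b} = colour T \<theta> t {a, b} - \<lfloor>colour T \<theta> t {a, b}\<rfloor>"
     "colour T (reduction T \<theta>) t {a, c} = colour T \<theta> t {a, c} - \<lfloor>colour T \<theta> t {a, c}\<rfloor>"
     "colour T (reduction T \<theta>) t {b, c} = colour T \<theta> t {b, c} - \<lfloor>colour T \<theta> t {b, c}\<rfloor>"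
    if "(t, {a, b, c}) \<in> F" "a \<noteq> b" "a \<noteq> c" "b \<noteq> c" for t a b c
    using mem_triangle[OF assms that(1)] that(2-4) edgeI by (simp_all add: reduction_def)
  note red = this
  show ?thesis
  proof
    assume "triangle_coloured T (reduction T \<theta>) F i' j' k'"
    then obtain t a b c where *: "(t, {a, b, c}) \<in> F" "a \<noteq> b" "a \<noteq> c" "b \<noteq> c"
      "i' = colour T (reduction T \<theta>) t {a, b}" "j' = colour T (reduction T \<theta>) t {a, c}"
      "k' = colour T (reduction T \<theta>) t {b, c}"
      unfolding triangle_coloured_def by blast
    have "triangle_coloured T \<theta> F (colour T \<theta> t {a, b}) (colour T \<theta> t {a, c}) (colour T \<theta> t {b, c})"
      unfolding triangle_coloured_def using *(1-4) by blast
    then show "\<exists>i j k. triangle_coloured T \<theta> F i j k \<and> i' = i - \<lfloor>i\<rfloor> \<and> j' = j - \<lfloor>j\<rfloor> \<and> k' = k - \<lfloor>k\<rfloor>"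
      unfolding *(5-7) red[OF *(1-4)] by blast
  next
    assume "\<exists>i j k. triangle_coloured T \<theta> F i j k \<and> i' = i - \<lfloor>i\<rfloor> \<and> j' = j - \<lfloor>j\<rfloor> \<and> k' = k - \<lfloor>k\<rfloor>"
    then obtain t a b c where *: "(t, {a, b, c}) \<in> F" "a \<noteq> b" "a \<noteq> c" "b \<noteq> c"
      "i' = colour T \<theta> t {a, b} - \<lfloor>colour T \<theta> t {a, b}\<rfloor>"
      "j' = colour T \<theta> t {a, c} - \<lfloor>colour T \<theta> t {a, c}\<rfloor>"
      "k' = colour T \<theta> t {b, c} - \<lfloor>colour T \<theta> t {b, c}\<rfloor>"
      unfolding triangle_coloured_def by blast
    show "triangle_coloured T (reduction T \<theta>) F i' j' k'"
      unfolding triangle_coloured_def *(5-7) red[OF *(1-4), symmetric] using *(1-4) by blast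
  qed
qed

text \<open>An admissible triangle with one edge coloured 1/2 has exactly two of them, by parity;
  its third edge is coloured 0 or 1, and reduction makes it 0 in both cases.\<close>

lemma segments_eq:
  "surface_segments T (reduction T \<theta>) = {F \<in> triangles T. some_colour \<theta> F (1/2)}"
proof -
  have "triangle_coloured T (reduction T \<theta>) F 0 (1/2) (1/2) \<longleftrightarrow> some_colour \<theta> F (1/2)"
    if F: "F \<in> triangles T" for F
  proof
    assume "triangle_coloured T (reduction T \<theta>) F 0 (1/2) (1/2)"
    then obtain i j k where ijk: "triangle_coloured T \<theta> F i j k" "j - \<lfloor>j\<rfloor> = 1/2"
      unfolding triangle_coloured_reduction[OF F] by metis
    obtain a b c where abc: "triangle_coloured T \<theta> F (real a / 2) (real b / 2) (real c / 2)"
      "adm3 a b c" "a \<le> 2" "b \<le> 2" "c \<le> 2" using triangle_colours[OF F] .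
    have "j \<in> {real a / 2, real b / 2, real c / 2}"
      using triangle_coloured_unique[OF F abc(1) ijk(1)] by auto
    moreover have "a \<in> {0,1,2}" "b \<in> {0,1,2}" "c \<in> {0,1,2}" using abc(3-5) by auto
    ultimately have "j = 1/2" using ijk(2) by auto
    then show "some_colour \<theta> F (1/2)" using some_colour_iff[OF F ijk(1)] by simp
  next
    assume s: "some_colour \<theta> F (1/2)"
    obtain a b c where abc: "triangle_coloured T \<theta> F (real a / 2) (real b / 2) (real c / 2)"
      "adm3 a b c" "a \<le> 2" "b \<le> 2" "c \<le> 2" using triangle_colours[OF F] .
    note perms = abc(1) triangle_coloured_perms[OF abc(1)]
      triangle_coloured_perms(2)[OF triangle_coloured_perms(1)[OF abc(1)]]
    have "a = 1 \<or> b = 1 \<or> c = 1" using s some_colour_iff[OF F abc(1)] by auto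
    then have "triangle_coloured T \<theta> F 0 (1/2) (1/2) \<or> triangle_coloured T \<theta> F 1 (1/2) (1/2)"
      using adm3_cases[OF abc(2-5)] by (elim insertE emptyE; use perms in simp)
    then show "triangle_coloured T (reduction T \<theta>) F 0 (1/2) (1/2)"
      unfolding triangle_coloured_reduction[OF F]
    proof
      assume "triangle_coloured T \<theta> F 0 (1/2) (1/2)"
      then show "\<exists>i j k. triangle_coloured T \<theta> F i j k \<and> 0 = i - \<lfloor>i\<rfloor> \<and> 1/2 = j - \<lfloor>j\<rfloor> \<and> 1/2 = k - \<lfloor>k\<rfloor>"
        by (rule_tac exI[of _ 0], rule_tac exI[of _ "1/2"], rule_tac exI[of _ "1/2"]) simp
    next
      assume "triangle_coloured T \<theta> F 1 (1/2) (1/2)"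
      then show "\<exists>i j k. triangle_coloured T \<theta> F i j k \<and> 0 = i - \<lfloor>i\<rfloor> \<and> 1/2 = j - \<lfloor>j\<rfloor> \<and> 1/2 = k - \<lfloor>k\<rfloor>"
        by (rule_tac exI[of _ 1], rule_tac exI[of _ "1/2"], rule_tac exI[of _ "1/2"]) simp
    qed
  qed
  then show ?thesis unfolding surface_segments_def by blast
qed

text \<open>Each tetrahedron has an even number of mixed faces and contributes half of it to the
  exponent of -1. As every triangle has two sides, these halves add up to the number of mixed
  triangles, which is the exponent in \<open>triangles_product\<close> as well.\<close>

lemma tets_product:
  assumes q: "q \<in> {1, 3}"
  shows "(\<Prod>t<n. tet_weight q (colour T \<theta> t {0,1}) (colour T \<theta> t {0,2}) (colour T \<theta> t {0,3})
           (colour T \<theta> t {1,2}) (colour T \<theta> t {1,3}) (colour T \<theta> t {2,3})) =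
    (- of_real (root2 q)) ^ card {t \<in> {..<n}. tet_half t} *
    (-1) ^ ((\<Sum>F\<in>triangles T. mixed_face \<theta> F) + card (octagons T \<theta>))"
proof -
  define k where "k t = (\<Sum>f<4. mixed_face \<theta> (face (t, f)))" for t
  have "(\<Sum>t<n. 2 * (k t div 2)) = (\<Sum>t<n. k t)"
    using tet_facts(1)[OF q] by (intro sum.cong) (auto simp: k_def)
  also have "\<dots> = 2 * (\<Sum>F\<in>triangles T. mixed_face \<theta> F)"
    unfolding k_def by (rule sum_faces)
  finally have k: "(\<Sum>t<n. k t div 2) = (\<Sum>F\<in>triangles T. mixed_face \<theta> F)"
    by (simp flip: sum_distrib_left)
  have o: "(\<Sum>t<n. if tet_zero t then 0 else 1) = card (octagons T \<theta>)"
    unfolding octagons_eq by (simp add: sum.If_cases Int_def)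
  have "(\<Prod>t<n. tet_weight q (colour T \<theta> t {0,1}) (colour T \<theta> t {0,2}) (colour T \<theta> t {0,3})
           (colour T \<theta> t {1,2}) (colour T \<theta> t {1,3}) (colour T \<theta> t {2,3})) =
    (\<Prod>t<n. (if tet_half t then - of_real (root2 q) else 1) * (-1) ^ (k t div 2 + (if tet_zero t then 0 else 1)))"
    using tet_facts(2)[OF q] by (intro prod.cong) (auto simp: k_def)
  then show ?thesis
    by (simp only: prod.distrib prod_if_const[OF finite_lessThan] power_sum[symmetric] sum.distrib k o)
qed

text \<open>Here the sign of the mixed triangles occurs twice, once from the triangles and once from
  the tetrahedra, and disappears. Integer powers are needed because every segment contributes an
  inverse.\<close>

lemma weight_eq:
  assumes q: "q \<in> {1, 3}"
  shows "weight T q \<theta> = (- of_real (root2 q)) powi euler_char_surface T (reduction T \<theta>) *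
    (-1) ^ card (octagons T \<theta>)"
proof -
  let ?x = "- complex_of_real (root2 q)"
  have "x ^ a * inverse x ^ b * x ^ c = x powi (int a - int b + int c)" if "x \<noteq> 0" for a b c and x :: complex
    using that by (simp add: power_int_add power_int_diff power_inverse divide_inverse)
  moreover have "?x \<noteq> 0" by (simp add: root2_def)
  moreover have "weight T q \<theta> = (?x ^ card {e \<in> edges T. twice \<theta> e = 1} *
      inverse ?x ^ card {F \<in> triangles T. some_colour \<theta> F (1/2)} * ?x ^ card {t \<in> {..<n}. tet_half t}) *
      ((-1) ^ (\<Sum>F\<in>triangles T. mixed_face \<theta> F) * (-1) ^ (\<Sum>F\<in>triangles T. mixed_face \<theta> F)) *
      (-1) ^ card (octagons T \<theta>)"
    unfolding weight_def edges_product[OF q] triangles_product[OF q] tets_product[OF q] power_add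
    by (simp only: ac_simps)
  moreover have "(-1) ^ m * (-1) ^ m = (1::complex)" for m by (simp flip: power_add)
  ultimately show ?thesis
    unfolding euler_char_surface_def points_eq segments_eq discs_eq by (simp only: mult_1_right simp_thms)
qed

end

end

section \<open>Colourings as bit strings\<close>

text \<open>Degenerate pairs with \<open>a = b\<close> get a number too: the numbering is then
  positional in base 4, and a program can decode it by divisions by constants.\<close>

definition slot :: "nat \<Rightarrow> nat \<Rightarrow> nat \<Rightarrow> nat" where
  "slot t a b = 16 * t + 4 * a + b"

text \<open>Remainders are spelled out by quotients and differences, the operations that the machine
  provides; the terms \<open>Tet_Of\<close>, \<open>Fst_Of\<close> and \<open>Snd_Of\<close> copy
  these formulas.\<close>

definition tet_of :: "nat \<Rightarrow> nat" where "tet_of z = z div 16"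
definition fst_of :: "nat \<Rightarrow> nat" where "fst_of z = z div 4 - 4 * (z div 16)"
definition snd_of :: "nat \<Rightarrow> nat" where "snd_of z = z - 4 * (z div 4)"

lemma slot_decode [simp]:
  assumes "a < 4" "b < 4"
  shows "tet_of (slot t a b) = t" "fst_of (slot t a b) = a" "snd_of (slot t a b) = b"
proof -
  have "slot t a b = t * 16 + (4 * a + b)" "4 * a + b < 16" using assms by (simp_all add: slot_def)
  then have 1: "slot t a b div 16 = t" by simp
  then show "tet_of (slot t a b) = t" by (simp add: tet_of_def)
  have "slot t a b = (4 * t + a) * 4 + b" by (simp add: slot_def)
  then have 2: "slot t a b div 4 = 4 * t + a" using assms by simp
  then show "fst_of (slot t a b) = a" "snd_of (slot t a b) = b" using 1 by (simp_all add: fst_of_def snd_of_def slot_def)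
qed

lemma slot_less: "t < n \<Longrightarrow> a < 4 \<Longrightarrow> b < 4 \<Longrightarrow> slot t a b < 16 * n"
  unfolding slot_def by linarith

lemma slot_exhaust:
  assumes "z < 16 * n"
  obtains t a b where "t < n" "a < 4" "b < 4" "z = slot t a b"
proof -
  have "z div 16 < n" using assms by (simp add: less_mult_imp_div_less mult.commute)
  moreover have "z = slot (z div 16) (z div 4 mod 4) (z mod 4)"
  proof -
    have "z div 16 = z div 4 div 4" by (simp flip: div_mult2_eq)
    then show ?thesis
      unfolding slot_def using mult_div_mod_eq[of 4 z] mult_div_mod_eq[of 4 "z div 4"] by linarith
  qed
  ultimately show thesis using that[of "z div 16" "z div 4 mod 4" "z mod 4"] by simp
qed

lemma slot_eq_iff: "a < 4 \<Longrightarrow> b < 4 \<Longrightarrow> a' < 4 \<Longrightarrow> b' < 4 \<Longrightarrow>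
    slot t a b = slot t' a' b' \<longleftrightarrow> t = t' \<and> a = a' \<and> b = b'"
  using slot_decode[of a b t] slot_decode[of a' b' t'] by metis

section \<open>Edges as reachability classes of slots\<close>

context gluing begin

text \<open>A slot names an ordered pair of vertices of a tetrahedron; reversing the pair and
  crossing a face generate the identifications of edges.\<close>

definition slot_steps :: "(nat \<times> nat) set" where
  "slot_steps = {(slot t a b, slot t b a) | t a b. t < n \<and> a < 4 \<and> b < 4} \<union>
    {(slot t a b, slot (adj T t f) (perm T t f a) (perm T t f b)) | t f a b.
       t < n \<and> f < 4 \<and> a < 4 \<and> b < 4 \<and> f \<noteq> a \<and> f \<noteq> b}"

lemma slot_steps_iff:
  assumes "t < n" "a < 4" "b < 4"
  shows "(slot t a b, k) \<in> slot_steps \<longleftrightarrow> k = slot t b a \<or>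
    (\<exists>f<4. f \<noteq> a \<and> f \<noteq> b \<and> k = slot (adj T t f) (perm T t f a) (perm T t f b))"
  using assms unfolding slot_steps_def by (auto simp: slot_eq_iff)

lemma slot_steps_range: "(z, z') \<in> slot_steps \<Longrightarrow> z < 16 * n \<and> z' < 16 * n"
  unfolding slot_steps_def using slot_less adj_less perm_less by auto

lemma finite_slot_steps: "finite slot_steps"
  by (rule finite_subset[of _ "{..<16 * n} \<times> {..<16 * n}"]) (auto dest: slot_steps_range)

text \<open>From each of the \<open>16 * n\<close> slots there are at most five moves: the reversal
  and the crossing of one of four faces.\<close>

lemma card_slot_steps: "card slot_steps \<le> 80 * n"
proof -
  \<comment> \<open>Index 4 stands for the reversal, the indices 0 to 3 for the faces.\<close>
  define g where "g = (\<lambda>(z, f). if f = (4::nat) then (z, slot (tet_of z) (snd_of z) (fst_of z)) else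
    (z, slot (adj T (tet_of z) f) (perm T (tet_of z) f (fst_of z)) (perm T (tet_of z) f (snd_of z))))"
  have "slot_steps \<subseteq> g ` ({..<16 * n} \<times> {..<5})"
  proof
    fix p assume "p \<in> slot_steps"
    then consider t a b where "p = (slot t a b, slot t b a)" "t < n" "a < 4" "b < 4"
      | t f a b where "p = (slot t a b, slot (adj T t f) (perm T t f a) (perm T t f b))"
          "t < n" "f < 4" "a < 4" "b < 4"
      unfolding slot_steps_def by blast
    then show "p \<in> g ` ({..<16 * n} \<times> {..<5})"
    proof cases
      case 1
      then have "p = g (slot t a b, 4)" by (simp add: g_def)
      then show ?thesis using 1 slot_less by auto
    next
      case 2
      then have "p = g (slot t a b, f)" by (simp add: g_def)
      then show ?thesis using 2 slot_less by auto
    qed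
  qed
  then have "card slot_steps \<le> card ({..<16 * n} \<times> {..<5::nat})"
    by (rule surj_card_le[rotated]) simp
  then show ?thesis by simp
qed

text \<open>Paths need not be longer than the number of pairs in a finite relation. This is the
  origin of the \<open>80 * n\<close> rounds in \<open>count_edges\<close>.\<close>

lemma rtrancl_slot_steps_iff_relpow:
  assumes "80 * n \<le> r"
  shows "p \<in> slot_steps\<^sup>* \<longleftrightarrow> (\<exists>k\<le>r. p \<in> slot_steps ^^ k)"
proof
  assume "p \<in> slot_steps\<^sup>*"
  then obtain k where k: "p \<in> slot_steps ^^ k" using rtrancl_power by blast
  have "slot_steps ^^ k \<subseteq> (\<Union>i\<in>{i. i \<le> card slot_steps}. slot_steps ^^ i)"
    by (rule relpow_finite_bounded[OF finite_slot_steps])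
  with k obtain i where "i \<le> card slot_steps" "p \<in> slot_steps ^^ i" by blast
  then show "\<exists>k\<le>r. p \<in> slot_steps ^^ k" using card_slot_steps assms by (intro exI[of _ i]) simp
qed (auto simp: rtrancl_power)

text \<open>Slots are ordered pairs while edges are unordered; the reversal steps bridge the
  difference. Gluings are injective on vertices, so a path that starts at a nondegenerate pair never
  meets a degenerate one.\<close>

lemma rtrancl_slot_steps_iff:
  assumes "t < n" "a < 4" "b < 4" "a \<noteq> b" "c < 4" "d < 4" "c \<noteq> d"
  shows "(slot t a b, slot u c d) \<in> slot_steps\<^sup>* \<longleftrightarrow> face_class T t {a, b} = face_class T u {c, d}"
proof
  assume "(slot t a b, slot u c d) \<in> slot_steps\<^sup>*"
  then have "\<exists>u' c' d'. slot u c d = slot u' c' d' \<and> u' < n \<and> c' < 4 \<and> d' < 4 \<and> c' \<noteq> d' \<and>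
      face_class T u' {c', d'} = face_class T t {a, b}"
  proof (induction rule: rtrancl_induct)
    case base
    then show ?case using assms by blast
  next
    case (step y z)
    then obtain u c d where y: "y = slot u c d" "u < n" "c < 4" "d < 4" "c \<noteq> d"
      "face_class T u {c, d} = face_class T t {a, b}" by blast
    from step(2)[unfolded y(1) slot_steps_iff[OF y(2-4)]] show ?case
    proof (elim disjE exE conjE)
      assume z: "z = slot u d c"
      have "face_class T u {d, c} = face_class T t {a, b}" using y(6) by (simp only: insert_commute)
      then show ?thesis using y(2-4) y(5)[symmetric] z by blast
    next
      fix f assume f: "f < 4" "f \<noteq> c" "f \<noteq> d" "z = slot (adj T u f) (perm T u f c) (perm T u f d)"
      have "face_class T (adj T u f) (perm T u f ` {c, d}) = face_class T u {c, d}"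
        using face_class_glue[OF y(2) f(1), of "{c, d}"] f y by auto
      then have "face_class T (adj T u f) {perm T u f c, perm T u f d} = face_class T t {a, b}"
        using y(6) by simp
      moreover have "adj T u f < n" "perm T u f c < 4" "perm T u f d < 4" "perm T u f c \<noteq> perm T u f d"
        using adj_less[OF y(2) f(1)] perm_less[OF y(2) f(1)] perm_eq_iff[OF y(2) f(1)] y by auto
      ultimately show ?thesis using f(4) by blast
    qed
  qed
  then show "face_class T t {a, b} = face_class T u {c, d}" using assms slot_eq_iff by metis
next
  assume "face_class T t {a, b} = face_class T u {c, d}"
  then have "((t, {a, b}), (u, {c, d})) \<in> (glue_faces T)\<^sup>*" by (simp add: face_class_eq_iff)
  then have "\<forall>c d. B = {c, d} \<longrightarrow> c \<noteq> d \<longrightarrow> (slot t a b, slot u c d) \<in> slot_steps\<^sup>*" if "B = {c, d}" for B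
    using that
  proof -
    \<comment> \<open>The claim covers both orders of the end pair, because an unordered edge does
      not determine its slot.\<close>
    have "\<forall>c d. snd q = {c, d} \<longrightarrow> c \<noteq> d \<longrightarrow> (slot t a b, slot (fst q) c d) \<in> slot_steps\<^sup>*"
      if "((t, {a, b}), q) \<in> (glue_faces T)\<^sup>*" for q
      using that
    proof (induction rule: rtrancl_induct)
      case base
      have "(slot t a b, slot t b a) \<in> slot_steps" using slot_steps_iff assms by blast
      then show ?case by (auto simp: doubleton_eq_iff)
    next
      case (step y z)
      obtain u B where y: "y = (u, B)" by (cases y)
      obtain v C where z: "z = (v, C)" by (cases z)
      from step(2)[unfolded y z] obtain f where f: "u < n" "f < 4" "B \<subseteq> {..<4} - {f}" "v = adj T u f"
         "C = perm T u f ` B"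
        by (rule glue_facesE)
      show ?case
      proof (intro allI impI)
        fix c' d' assume cd: "snd z = {c', d'}" "c' \<noteq> d'"
        have "c' \<in> C" "d' \<in> C" using cd(1) z by auto
        then obtain c d where c: "c \<in> B" "c' = perm T u f c" "d \<in> B" "d' = perm T u f d"
          using f(5) by auto
        have "perm T u f e \<in> {c', d'}" if "e \<in> B" for e using that f(5) cd(1) z by auto
        then have "B = {c, d}" using c f(3) perm_eq_iff[OF f(1,2)] by blast
        then have "(slot t a b, slot u c d) \<in> slot_steps\<^sup>*" using step(3) y cd(2) c by auto
        moreover have "(slot u c d, slot v c' d') \<in> slot_steps"
          using slot_steps_iff[of u c d] f c by blast
        ultimately show "(slot t a b, slot (fst z) c' d') \<in> slot_steps\<^sup>*" using z by auto
      qed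
    qed
    from this[OF \<open>((t, {a, b}), (u, {c, d})) \<in> (glue_faces T)\<^sup>*\<close>] that show ?thesis by simp
  qed
  then show "(slot t a b, slot u c d) \<in> slot_steps\<^sup>*" using assms(7) by blast
qed

definition slot_colour :: "colouring \<Rightarrow> nat \<Rightarrow> nat" where
  "slot_colour \<theta> z = (if fst_of z = snd_of z then 0
     else twice \<theta> (face_class T (tet_of z) {fst_of z, snd_of z}))"

lemma slot_colour_slot: "a < 4 \<Longrightarrow> b < 4 \<Longrightarrow>
    slot_colour \<theta> (slot t a b) = (if a = b then 0 else twice \<theta> (face_class T t {a, b}))"
  by (simp add: slot_colour_def)

text \<open>Every class is counted through its least slot. This expresses the only global quantity
  by comparisons and reachability, without ever forming a class.\<close>

lemma card_coloured_edges:
  "card {e \<in> edges T. twice \<theta> e = 1} =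
    card {z. z < 16 * n \<and> slot_colour \<theta> z = 1 \<and> \<not> (\<exists>i<z. (i, z) \<in> slot_steps\<^sup>*)}" (is "card ?E = card ?Z")
proof -
  define g where "g z = face_class T (tet_of z) {fst_of z, snd_of z}" for z
  have rel: "(y, z) \<in> slot_steps\<^sup>* \<longleftrightarrow> g y = g z"
    if yz: "y < 16 * n" "slot_colour \<theta> y = 1" "z < 16 * n" "slot_colour \<theta> z = 1" for y z
  proof -
    obtain t a b where y: "t < n" "a < 4" "b < 4" "y = slot t a b" using slot_exhaust[OF yz(1)] .
    obtain u c d where z: "u < n" "c < 4" "d < 4" "z = slot u c d" using slot_exhaust[OF yz(3)] .
    have "a \<noteq> b" "c \<noteq> d" using yz y z by (auto simp: slot_colour_slot split: if_splits)
    then show ?thesis using rtrancl_slot_steps_iff[of t a b c d u] y z by (simp add: g_def)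
  qed
  \<comment> \<open>Colours are constant along \<open>slot_steps\<close>, so the least slot of a
    class coloured 1/2 has that colour itself.\<close>
  have same: "slot_colour \<theta> y = slot_colour \<theta> z \<and> y < 16 * n" if yz: "(y, z) \<in> slot_steps\<^sup>*" "z < 16 * n" for y z
    using yz
  proof (induction rule: converse_rtrancl_induct)
    case (step x y)
    have "x < 16 * n" using slot_steps_range[OF step(1)] by simp
    then obtain t a b where x: "t < n" "a < 4" "b < 4" "x = slot t a b" using slot_exhaust by blast
    from step(1)[unfolded x(4) slot_steps_iff[OF x(1-3)]]
    have "slot_colour \<theta> x = slot_colour \<theta> y"
    proof (elim disjE exE conjE)
      assume "y = slot t b a"
      then show ?thesis using x by (simp add: slot_colour_slot insert_commute)
    next
      fix f assume f: "f < 4" "f \<noteq> a" "f \<noteq> b" "y = slot (adj T t f) (perm T t f a) (perm T t f b)"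
      have "face_class T (adj T t f) {perm T t f a, perm T t f b} = face_class T t {a, b}"
        using face_class_glue[OF x(1) f(1), of "{a, b}"] f x by auto
      then show ?thesis using f x perm_less perm_eq_iff by (simp add: slot_colour_slot)
    qed
    then show ?case using step \<open>x < 16 * n\<close> by simp
  qed auto
  have "bij_betw g ?Z ?E"
    unfolding bij_betw_def
  proof
    show "inj_on g ?Z"
    proof (rule inj_onI)
      fix y z assume yz: "y \<in> ?Z" "z \<in> ?Z" "g y = g z"
      then have "(y, z) \<in> slot_steps\<^sup>*" "(z, y) \<in> slot_steps\<^sup>*" using rel by auto
      then show "y = z" using yz by (metis (mono_tags, lifting) linorder_neqE_nat mem_Collect_eq)
    qed
    show "g ` ?Z = ?E"
    proof
      show "g ` ?Z \<subseteq> ?E"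
      proof
        fix e assume "e \<in> g ` ?Z"
        then obtain z where z: "z < 16 * n" "slot_colour \<theta> z = 1" "e = g z" by auto
        obtain t a b where "t < n" "a < 4" "b < 4" "z = slot t a b" using slot_exhaust[OF z(1)] .
        then show "e \<in> ?E" using z edgeI[of t a b] by (auto simp: slot_colour_slot g_def split: if_splits)
      qed
      show "?E \<subseteq> g ` ?Z"
      proof
        fix e assume e: "e \<in> ?E"
        then obtain t a b where t: "t < n" "a < 4" "b < 4" "a \<noteq> b" "e = face_class T t {a, b}"
          unfolding edges_alt by auto
        define y where "y = slot t a b"
        define P where "P z \<longleftrightarrow> (z, y) \<in> slot_steps\<^sup>*" for z
        define z where "z = (LEAST z. P z)"
        have y: "y < 16 * n" "slot_colour \<theta> y = 1" "g y = e"
          using t e slot_less by (auto simp: y_def slot_colour_slot g_def)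
        have P: "P z" unfolding z_def by (rule LeastI[of P y]) (simp add: P_def)
        then have z: "z < 16 * n" "slot_colour \<theta> z = 1" using same[of z y] y by (auto simp: P_def)
        have "\<not> (\<exists>i<z. (i, z) \<in> slot_steps\<^sup>*)"
        proof
          assume "\<exists>i<z. (i, z) \<in> slot_steps\<^sup>*"
          then obtain i where "i < z" "(i, z) \<in> slot_steps\<^sup>*" by blast
          then have "P i" using P by (auto simp: P_def)
          then show False using \<open>i < z\<close> not_less_Least[of i P] by (simp add: z_def)
        qed
        moreover have "g z = e" using rel[OF z y(1,2)] P y(3) by (simp add: P_def)
        ultimately show "e \<in> g ` ?Z" using z by auto
      qed
    qed
  qed
  then show ?thesis by (simp add: bij_betw_same_card)
qed

end

section \<open>Admissible colourings correspond to valid bit strings\<close>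

context gluing begin

text \<open>Degenerate slots belong to no edge; forcing them to 0 makes the slot colours of a
  colouring unique.\<close>

definition consistent :: "(nat \<Rightarrow> nat) \<Rightarrow> bool" where
  "consistent c \<longleftrightarrow> (\<forall>t<n. \<forall>a<4. \<forall>b<4. (a = b \<longrightarrow> c (slot t a b) = 0) \<and> c (slot t a b) = c (slot t b a) \<and>
     (\<forall>f<4. f \<noteq> a \<longrightarrow> f \<noteq> b \<longrightarrow> c (slot t a b) = c (slot (adj T t f) (perm T t f a) (perm T t f b))))"

definition admissible :: "(nat \<Rightarrow> nat) \<Rightarrow> bool" where
  "admissible c \<longleftrightarrow> (\<forall>t<n. \<forall>a<4. \<forall>b<4. \<forall>d<4. a \<noteq> b \<longrightarrow> a \<noteq> d \<longrightarrow> b \<noteq> d \<longrightarrow>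
     adm3 (c (slot t a b)) (c (slot t a d)) (c (slot t b d)))"

lemma slot_colour_Adm:
  assumes "\<theta> \<in> Adm T 4"
  shows "consistent (slot_colour \<theta>)" "admissible (slot_colour \<theta>)" "z < 16 * n \<Longrightarrow> slot_colour \<theta> z \<le> 2"
proof -
  show "consistent (slot_colour \<theta>)"
    unfolding consistent_def
  proof (intro allI impI conjI)
    fix t a b f :: nat assume *: "t < n" "a < 4" "b < 4" "f < 4" "f \<noteq> a" "f \<noteq> b"
    have "face_class T (adj T t f) {perm T t f a, perm T t f b} = face_class T t {a, b}"
      using face_class_glue[OF *(1,4), of "{a, b}"] * by auto
    then show "slot_colour \<theta> (slot t a b) = slot_colour \<theta> (slot (adj T t f) (perm T t f a) (perm T t f b))"
      using * perm_less perm_eq_iff by (simp add: slot_colour_slot)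
  qed (simp_all add: slot_colour_slot insert_commute)
  show "admissible (slot_colour \<theta>)"
    unfolding admissible_def using tet_adm3[OF assms] by (simp add: slot_colour_slot)
  show "z < 16 * n \<Longrightarrow> slot_colour \<theta> z \<le> 2"
    using edge_colour(2)[OF assms] edgeI slot_exhaust[of z n] by (metis slot_colour_slot zero_le)
qed

lemma slot_colour_inj:
  assumes "\<theta> \<in> Adm T 4" "\<theta>' \<in> Adm T 4" "\<And>z. z < 16 * n \<Longrightarrow> slot_colour \<theta> z = slot_colour \<theta>' z"
  shows "\<theta> = \<theta>'"
proof
  fix e
  show "\<theta> e = \<theta>' e"
  proof (cases "e \<in> edges T")
    case True
    then obtain t a b where t: "t < n" "a < 4" "b < 4" "a \<noteq> b" "e = face_class T t {a, b}"
      unfolding edges_alt by auto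
    then have "twice \<theta> e = twice \<theta>' e"
      using assms(3)[OF slot_less[of t n a b]] by (simp add: slot_colour_slot)
    then show ?thesis using edge_colour(1)[OF assms(1) True] edge_colour(1)[OF assms(2) True] by simp
  next
    case False
    then show ?thesis using assms(1,2) unfolding Adm_iff by (auto simp: extensional_def)
  qed
qed

text \<open>The colour of an edge class is read off an arbitrary slot of the class;
  \<open>consistent\<close> makes it independent of that choice.\<close>

lemma slot_colour_surj:
  assumes "consistent c" "admissible c" "\<And>z. z < 16 * n \<Longrightarrow> c z \<le> 2"
  obtains \<theta> where "\<theta> \<in> Adm T 4" "\<And>z. z < 16 * n \<Longrightarrow> slot_colour \<theta> z = c z"
proof -
  define edge_slot where "edge_slot e z \<longleftrightarrow> (\<exists>t a b. t < n \<and> a < 4 \<and> b < 4 \<and> a \<noteq> b \<and>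
    z = slot t a b \<and> e = face_class T t {a, b})" for e z
  define \<theta> where "\<theta> = (\<lambda>e\<in>edges T. real (c (SOME z. edge_slot e z)) / 2)"
  have const: "c y = c z" if "(y, z) \<in> slot_steps\<^sup>*" for y z
    using that
  proof (induction rule: rtrancl_induct)
    case (step y z)
    obtain t a b where y: "t < n" "a < 4" "b < 4" "y = slot t a b"
      using slot_exhaust slot_steps_range[OF step(2)] by blast
    have "c y = c z"
      using step(2) assms(1) y(1-3) unfolding y(4) slot_steps_iff[OF y(1-3)] consistent_def by blast
    then show ?case using step by simp
  qed simp
  have col: "twice \<theta> (face_class T t {a, b}) = c (slot t a b)"
    "\<theta> (face_class T t {a, b}) = real (c (slot t a b)) / 2"
    if t: "t < n" "a < 4" "b < 4" "a \<noteq> b" for t a b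
  proof -
    let ?e = "face_class T t {a, b}"
    have "edge_slot ?e (slot t a b)" unfolding edge_slot_def using t by blast
    then have "edge_slot ?e (SOME z. edge_slot ?e z)" by (rule someI)
    then obtain u d e where u: "u < n" "d < 4" "e < 4" "d \<noteq> e" "(SOME z. edge_slot ?e z) = slot u d e"
      "?e = face_class T u {d, e}" unfolding edge_slot_def by blast
    have "c (slot t a b) = c (slot u d e)"
      by (rule const) (use rtrancl_slot_steps_iff[OF t u(2-4)] u(6) in simp)
    then show *: "\<theta> ?e = real (c (slot t a b)) / 2"
      using edgeI[OF t] u(5) by (simp add: \<theta>_def)
    show "twice \<theta> ?e = c (slot t a b)" unfolding twice_def * by simp
  qed
  have "\<theta> \<in> Adm T 4"
    unfolding Adm_iff
  proof (intro conjI ballI allI impI)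
    show "\<theta> \<in> extensional (edges T)" by (simp add: \<theta>_def)
    fix e assume "e \<in> edges T"
    then obtain t a b where t: "t < n" "a < 4" "b < 4" "a \<noteq> b" "e = face_class T t {a, b}"
      unfolding edges_alt by auto
    then show "\<theta> e = real (twice \<theta> e) / 2" "twice \<theta> e \<le> 2"
      using col assms(3)[OF slot_less[OF t(1-3)]] by simp_all
  next
    fix t a b d :: nat assume "t < n" "a < 4" "b < 4" "d < 4" "a \<noteq> b" "a \<noteq> d" "b \<noteq> d"
    then show "adm3 (twice \<theta> (face_class T t {a, b})) (twice \<theta> (face_class T t {a, d}))
        (twice \<theta> (face_class T t {b, d}))"
      using assms(2) col by (simp add: admissible_def)
  qed
  moreover have "slot_colour \<theta> z = c z" if "z < 16 * n" for z
  proof -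
    obtain t a b where z: "t < n" "a < 4" "b < 4" "z = slot t a b"
      using slot_exhaust \<open>z < 16 * n\<close> by blast
    then show ?thesis using col assms(1) by (simp add: slot_colour_slot consistent_def)
  qed
  ultimately show thesis by (rule that)
qed

text \<open>Doubled colours in unary: 0, 1, 2 are written 00, 10, 11. The sum alone would also read
  01 as 1, which \<open>valid_bits\<close> rules out.\<close>

definition bits_colour :: "int list \<Rightarrow> nat \<Rightarrow> nat" where
  "bits_colour w z = nat (w ! (2 * z) + w ! (2 * z + 1))"

definition colouring_bits :: "nat \<Rightarrow> colouring \<Rightarrow> int list" where
  "colouring_bits l \<theta> = map (\<lambda>i. if i < 32 * n \<and> i mod 2 < slot_colour \<theta> (i div 2) then 1 else 0) [0..<l]"

text \<open>The length of a witness is a polynomial in the size of the instance and may exceed the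
  \<open>32 * n\<close> bits that carry colours. Surplus bits must vanish and the two bits of a slot
  must be ordered, as otherwise a colouring would be counted several times.\<close>

definition valid_bits :: "int list \<Rightarrow> bool" where
  "valid_bits w \<longleftrightarrow> (\<forall>i<length w. 32 * n \<le> i \<longrightarrow> w ! i \<le> 0) \<and> (\<forall>z<16 * n. w ! (2 * z + 1) \<le> w ! (2 * z)) \<and>
     consistent (bits_colour w) \<and> admissible (bits_colour w)"

lemma bits_colour_colouring_bits:
  assumes "\<theta> \<in> Adm T 4" "32 * n \<le> l" "z < 16 * n"
  shows "bits_colour (colouring_bits l \<theta>) z = slot_colour \<theta> z"
proof -
  have "slot_colour \<theta> z \<in> {0, 1, 2}" using slot_colour_Adm(3)[OF assms(1,3)] by auto
  then show ?thesis using assms(2,3) by (auto simp: bits_colour_def colouring_bits_def)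
qed

lemma consistent_cong: "(\<And>z. z < 16 * n \<Longrightarrow> c z = c' z) \<Longrightarrow> consistent c = consistent c'"
  unfolding consistent_def by (intro all_cong1 imp_cong conj_cong refl) (simp_all add: slot_less adj_less perm_less)

lemma admissible_cong: "(\<And>z. z < 16 * n \<Longrightarrow> c z = c' z) \<Longrightarrow> admissible c = admissible c'"
  unfolding admissible_def by (intro all_cong1 imp_cong refl) (simp_all add: slot_less)

lemma bij_betw_colouring_bits:
  assumes l: "32 * n \<le> l"
  shows "bij_betw (colouring_bits l) (Adm T 4) {w \<in> bit_strings l. valid_bits w}"
  unfolding bij_betw_def
proof
  show "inj_on (colouring_bits l) (Adm T 4)"
    by (rule inj_onI) (metis bits_colour_colouring_bits[OF _ l] slot_colour_inj)
  show "colouring_bits l ` Adm T 4 = {w \<in> bit_strings l. valid_bits w}"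
  proof
    show "colouring_bits l ` Adm T 4 \<subseteq> {w \<in> bit_strings l. valid_bits w}"
    proof
      fix w assume "w \<in> colouring_bits l ` Adm T 4"
      then obtain \<theta> where \<theta>: "\<theta> \<in> Adm T 4" "w = colouring_bits l \<theta>" by blast
      have "w \<in> bit_strings l" by (auto simp: \<theta>(2) bit_strings_def colouring_bits_def)
      moreover have "\<forall>i<length w. 32 * n \<le> i \<longrightarrow> w ! i \<le> 0"
        by (auto simp: \<theta>(2) colouring_bits_def)
      moreover have "\<forall>z<16 * n. w ! (2 * z + 1) \<le> w ! (2 * z)"
        using l by (auto simp: \<theta>(2) colouring_bits_def)
      moreover have "consistent (bits_colour w)" "admissible (bits_colour w)"
        using consistent_cong[OF bits_colour_colouring_bits[OF \<theta>(1) l]]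
          admissible_cong[OF bits_colour_colouring_bits[OF \<theta>(1) l]] slot_colour_Adm[OF \<theta>(1)]
        by (simp_all add: \<theta>(2))
      ultimately show "w \<in> {w \<in> bit_strings l. valid_bits w}" by (simp add: valid_bits_def)
    qed
    show "{w \<in> bit_strings l. valid_bits w} \<subseteq> colouring_bits l ` Adm T 4"
    proof
      fix w assume "w \<in> {w \<in> bit_strings l. valid_bits w}"
      then have w: "length w = l" "set w \<subseteq> {0, 1}" "valid_bits w" by (auto simp: bit_strings_def)
      have bit: "w ! i = 0 \<or> w ! i = 1" if "i < l" for i using w(1,2) that nth_mem by blast
      have le: "bits_colour w z \<le> 2" if "z < 16 * n" for z
        using bit[of "2 * z"] bit[of "2 * z + 1"] that l by (auto simp: bits_colour_def)
      obtain \<theta> where \<theta>: "\<theta> \<in> Adm T 4" "\<And>z. z < 16 * n \<Longrightarrow> slot_colour \<theta> z = bits_colour w z"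
        using slot_colour_surj[of "bits_colour w", OF _ _ le] w(3) unfolding valid_bits_def by blast
      have "w = colouring_bits l \<theta>"
      proof (rule nth_equalityI)
        show "length w = length (colouring_bits l \<theta>)" by (simp add: w colouring_bits_def)
        fix i assume i: "i < length w"
        show "w ! i = colouring_bits l \<theta> ! i"
        proof (cases "i < 32 * n")
          case True
          define z where "z = i div 2"
          have z: "z < 16 * n" using True by (simp add: z_def)
          have "w ! (2 * z + 1) \<le> w ! (2 * z)" using w(3) z by (simp add: valid_bits_def)
          moreover have "i = 2 * z \<or> i = 2 * z + 1" by (auto simp: z_def)
          ultimately show ?thesis
            using bit[of "2 * z"] bit[of "2 * z + 1"] z l i w(1) \<theta>(2)[OF z]
            by (auto simp: colouring_bits_def bits_colour_def)
        next
          case False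
          then have "w ! i \<le> 0" using w(3) i by (simp add: valid_bits_def)
          then show ?thesis using False bit[of i] i w(1) by (auto simp: colouring_bits_def)
        qed
      qed
      then show "w \<in> colouring_bits l ` Adm T 4" using \<theta>(1) by blast
    qed
  qed
qed

text \<open>Runs over the sides of triangles, so every segment of the surface is counted twice. This
  is why \<open>euler_char_surface_eq\<close> and the test of the verifier use the doubled Euler
  characteristic.\<close>

definition half_faces :: "(nat \<Rightarrow> nat) \<Rightarrow> nat" where
  "half_faces c = (\<Sum>t<n. \<Sum>f<4. if \<exists>a<4. \<exists>b<4. a \<noteq> f \<and> b \<noteq> f \<and> c (slot t a b) = 1 then 1 else 0)"

definition half_tets :: "(nat \<Rightarrow> nat) \<Rightarrow> nat" where
  "half_tets c = (\<Sum>t<n. if \<exists>a<4. \<exists>b<4. c (slot t a b) = 1 then 1 else 0)"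

definition full_tets :: "(nat \<Rightarrow> nat) \<Rightarrow> nat" where
  "full_tets c = (\<Sum>t<n. if \<forall>a<4. \<forall>b<4. a = b \<or> 0 < c (slot t a b) then 1 else 0)"

definition half_edges :: "(nat \<Rightarrow> nat) \<Rightarrow> nat" where
  "half_edges c = card {z. z < 16 * n \<and> c z = 1 \<and> \<not> (\<exists>i<z. (i, z) \<in> slot_steps\<^sup>*)}"

lemma some_colour_face:
  assumes "\<theta> \<in> Adm T 4" "t < n" "f < 4"
  shows "some_colour \<theta> (face (t, f)) (1/2) \<longleftrightarrow>
    (\<exists>a<4. \<exists>b<4. a \<noteq> f \<and> b \<noteq> f \<and> slot_colour \<theta> (slot t a b) = 1)"
proof -
  have tri: "some_colour \<theta> (face_class T t {a, b, d}) (1/2) \<longleftrightarrow>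
      twice \<theta> (face_class T t {a, b}) = 1 \<or> twice \<theta> (face_class T t {a, d}) = 1 \<or> twice \<theta> (face_class T t {b, d}) = 1"
    if "a < 4" "b < 4" "d < 4" "a \<noteq> b" "a \<noteq> d" "b \<noteq> d" for a b d
    using some_colour_iff[OF triangle_colouredI(2)[OF assms(2) that] triangle_colouredI(1)[OF assms(2) that, of \<theta>], of "1/2"]
      edge_colour(1)[OF assms(1)] edgeI[OF assms(2)] that by auto
  have "f = 0 \<or> f = 1 \<or> f = 2 \<or> f = 3" using assms(3) by auto
  then show ?thesis
  proof (elim disjE)
    assume f: "f = 0"
    show ?thesis unfolding f face_def prod.case complement_vertices_of_4 less_4_cases
      using tri[of 1 2 3] by (simp add: slot_colour_slot insert_commute) blast
  next
    assume f: "f = 1"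
    show ?thesis unfolding f face_def prod.case complement_vertices_of_4 less_4_cases
      using tri[of 0 2 3] by (simp add: slot_colour_slot insert_commute) blast
  next
    assume f: "f = 2"
    show ?thesis unfolding f face_def prod.case complement_vertices_of_4 less_4_cases
      using tri[of 0 1 3] by (simp add: slot_colour_slot insert_commute) blast
  next
    assume f: "f = 3"
    show ?thesis unfolding f face_def prod.case complement_vertices_of_4 less_4_cases
      using tri[of 0 1 2] by (simp add: slot_colour_slot insert_commute) blast
  qed
qed

lemma sum_indicator_card: "(\<Sum>x\<in>A. if P x then 1 else 0) = card {x \<in> A. P x}" if "finite A"
  using that by (simp add: sum.If_cases Int_def)

lemma euler_char_surface_eq:
  assumes "\<theta> \<in> Adm T 4"
  shows "2 * euler_char_surface T (reduction T \<theta>) =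
    2 * int (half_edges (slot_colour \<theta>)) - int (half_faces (slot_colour \<theta>)) + 2 * int (half_tets (slot_colour \<theta>))"
proof -
  have p: "card (surface_points T (reduction T \<theta>)) = half_edges (slot_colour \<theta>)"
    unfolding points_eq[OF assms] card_coloured_edges half_edges_def ..
  have s: "2 * card (surface_segments T (reduction T \<theta>)) = half_faces (slot_colour \<theta>)"
  proof -
    have "2 * card (surface_segments T (reduction T \<theta>)) =
        (\<Sum>t<n. \<Sum>f<4. if some_colour \<theta> (face (t, f)) (1/2) then 1 else 0)"
      unfolding sum_faces[of "\<lambda>F. if some_colour \<theta> F (1/2) then 1 else 0"]
        sum_indicator_card[OF finite_triangles] segments_eq[OF assms] ..
    then show ?thesis
      unfolding half_faces_def using some_colour_face[OF assms] by (auto intro!: sum.cong)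
  qed
  have d: "card (triangular_discs T (reduction T \<theta>) \<union> quadrilateral_discs T (reduction T \<theta>)) =
      half_tets (slot_colour \<theta>)"
  proof -
    have "slot_colour \<theta> (slot t a b) = 1 \<longleftrightarrow> a \<noteq> b \<and> twice \<theta> (face_class T t {a, b}) = 1"
      if "a < 4" "b < 4" for t a b
      using that by (simp add: slot_colour_slot)
    then have "tet_half \<theta> t \<longleftrightarrow> (\<exists>a<4. \<exists>b<4. slot_colour \<theta> (slot t a b) = 1)" for t
      unfolding tet_half_def[OF assms] by blast
    then show ?thesis
      unfolding discs_eq[OF assms] half_tets_def sum_indicator_card[OF finite_lessThan] by simp
  qed
  show ?thesis unfolding euler_char_surface_def p d s[symmetric] by simp
qed

lemma card_octagons_eq:
  assumes "\<theta> \<in> Adm T 4"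
  shows "card (octagons T \<theta>) = full_tets (slot_colour \<theta>)"
proof -
  have "a = b \<or> 0 < slot_colour \<theta> (slot t a b) \<longleftrightarrow> \<not> (a \<noteq> b \<and> twice \<theta> (face_class T t {a, b}) = 0)"
    if "a < 4" "b < 4" for t a b
    using that by (simp add: slot_colour_slot)
  then have "(\<forall>a<4. \<forall>b<4. a = b \<or> 0 < slot_colour \<theta> (slot t a b)) \<longleftrightarrow>
      (\<forall>a<4. \<forall>b<4. \<not> (a \<noteq> b \<and> twice \<theta> (face_class T t {a, b}) = 0))" for t
    by (intro all_cong1 imp_cong refl) simp
  then have "\<not> tet_zero \<theta> t \<longleftrightarrow> (\<forall>a<4. \<forall>b<4. a = b \<or> 0 < slot_colour \<theta> (slot t a b))" for t
    unfolding tet_zero_def[OF assms] by simp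
  then show ?thesis
    unfolding octagons_eq[OF assms] full_tets_def sum_indicator_card[OF finite_lessThan] by simp
qed

end

section \<open>The verifier\<close>

text \<open>A term counts as true when it is positive, in accordance with \<open>If_Pos\<close>.
  Hence a comparison is just a difference, and truth values need not be 1.\<close>

definition Neg :: "tm \<Rightarrow> tm" where "Neg t = Cond t (Num 0) (Num 1)"
definition Conj :: "tm \<Rightarrow> tm \<Rightarrow> tm" where "Conj t u = Cond t u (Num 0)"
definition Disj :: "tm \<Rightarrow> tm \<Rightarrow> tm" where "Disj t u = Cond t (Num 1) u"
definition Less :: "tm \<Rightarrow> tm \<Rightarrow> tm" where "Less t u = Minus u t"
definition Eq :: "tm \<Rightarrow> tm \<Rightarrow> tm" where "Eq t u = Conj (Neg (Less t u)) (Neg (Less u t))"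
definition Count :: "nat \<Rightarrow> bound \<Rightarrow> tm \<Rightarrow> tm" where "Count x b t = Sum x b (Cond t (Num 1) (Num 0))"
definition Forall :: "nat \<Rightarrow> bound \<Rightarrow> tm \<Rightarrow> tm" where "Forall x b t = Neg (Count x b (Neg t))"

definition holds :: "memory \<Rightarrow> (nat \<Rightarrow> int) \<Rightarrow> tm \<Rightarrow> bool" where
  "holds s \<rho> t \<longleftrightarrow> 0 < val s \<rho> t"

lemma val_Cond [simp]: "val s \<rho> (Cond t u v) = (if holds s \<rho> t then val s \<rho> u else val s \<rho> v)"
  by (simp add: holds_def)

text \<open>\<open>val_Cond\<close> takes over, so that conditions stay in the form
  \<open>holds\<close>, on which the rules for connectives act.\<close>

declare val.simps(6) [simp del]

lemma val_Count [simp]: "val s \<rho> (Count x b t) = (\<Sum>i<bound_val s b. if holds s (\<rho>(x := int i)) t then 1 else 0)"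
  by (simp add: Count_def cong: if_cong)

lemma holds_simps [simp]:
  "holds s \<rho> (Neg t) \<longleftrightarrow> \<not> holds s \<rho> t"
  "holds s \<rho> (Conj t u) \<longleftrightarrow> holds s \<rho> t \<and> holds s \<rho> u"
  "holds s \<rho> (Disj t u) \<longleftrightarrow> holds s \<rho> t \<or> holds s \<rho> u"
  "holds s \<rho> (Less t u) \<longleftrightarrow> val s \<rho> t < val s \<rho> u"
  "holds s \<rho> (Arr a t) \<longleftrightarrow> 0 < s a (val s \<rho> t)"
  by (simp_all add: holds_def Neg_def Conj_def Disj_def Less_def)

lemma holds_Eq [simp]: "holds s \<rho> (Eq t u) \<longleftrightarrow> val s \<rho> t = val s \<rho> u"
  by (auto simp: Eq_def)

lemma holds_Count [simp]: "holds s \<rho> (Count x b t) \<longleftrightarrow> (\<exists>i<bound_val s b. holds s (\<rho>(x := int i)) t)"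
proof -
  have "(\<Sum>i<bound_val s b. if holds s (\<rho>(x := int i)) t then 1 else 0) =
      int (card {i \<in> {..<bound_val s b}. holds s (\<rho>(x := int i)) t})"
    by (simp add: sum.If_cases Int_def)
  then show ?thesis unfolding holds_def[of _ _ "Count x b t"] val_Count by (auto simp: card_gt_0_iff)
qed

lemma holds_Forall [simp]: "holds s \<rho> (Forall x b t) \<longleftrightarrow> (\<forall>i<bound_val s b. holds s (\<rho>(x := int i)) t)"
  by (simp add: Forall_def)

fun reads :: "nat \<Rightarrow> tm \<Rightarrow> bool" where
  "reads a (Num c) = False"
| "reads a (Var x) = False"
| "reads a (Arr b t) = (a = b \<or> reads a t)"
| "reads a (Bin op t u) = (reads a t \<or> reads a u)"
| "reads a (Scale c t) = reads a t"
| "reads a (Cond t u v) = (reads a t \<or> reads a u \<or> reads a v)"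
| "reads a (Sum x b t) = ((\<exists>k. b = Times k a) \<or> reads a t)"

lemma val_fun_upd: "\<not> reads a t \<Longrightarrow> val (s(a := g)) \<rho> t = val s \<rho> t"
proof (induction t arbitrary: \<rho>)
  case (Sum x b t)
  then have "bound_val (s(a := g)) b = bound_val s b" by (cases b) auto
  moreover have "val (s(a := g)) \<rho>' t = val s \<rho>' t" for \<rho>' using Sum unfolding reads.simps by blast
  ultimately show ?case by (simp only: val.simps)
qed (auto simp: holds_def)

text \<open>As the term does not read the array being written, earlier rounds cannot influence later
  ones, and the loop amounts to a simultaneous update.\<close>

lemma run_For_Assign:
  assumes "\<not> reads a t"
  shows "run \<O> (For x b (Assign a (Var x) t)) \<rho> s =
    s(a := (\<lambda>i. if 0 \<le> i \<and> i < int (bound_val s b) then val s (\<rho>(x := i)) t else s a i))"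
proof -
  define G where "G k = (\<lambda>i. if 0 \<le> i \<and> i < int k then val s (\<rho>(x := i)) t else s a i)" for k
  have "fold (\<lambda>i. run \<O> (Assign a (Var x) t) (\<rho>(x := int i))) [0..<k] s = s(a := G k)" for k
  proof (induction k)
    case 0
    have "G 0 = s a" by (simp add: G_def fun_eq_iff)
    then show ?case by simp
  next
    case (Suc k)
    have "run \<O> (Assign a (Var x) t) (\<rho>(x := int k)) (s(a := G k)) =
        s(a := (G k)(int k := val s (\<rho>(x := int k)) t))"
      by (simp only: run.simps store_def val_fun_upd[OF assms] val.simps fun_upd_same fun_upd_upd)
    also have "(G k)(int k := val s (\<rho>(x := int k)) t) = G (Suc k)"
      by (auto simp: G_def fun_eq_iff)
    finally show ?case using Suc by simp
  qed
  then show ?thesis unfolding run.simps G_def .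
qed

lemma run_For_invariant:
  assumes "P 0 s" and "\<And>i s'. i < bound_val s b \<Longrightarrow> P i s' \<Longrightarrow> P (Suc i) (run \<O> c (\<rho>(x := int i)) s')"
  shows "P (bound_val s b) (run \<O> (For x b c) \<rho> s)"
proof -
  have "k \<le> bound_val s b \<Longrightarrow> P k (fold (\<lambda>i. run \<O> c (\<rho>(x := int i))) [0..<k] s)" for k
    by (induction k) (use assms in auto)
  then show ?thesis by simp
qed

section \<open>Terms and programs of the verifier\<close>

definition Slot :: "tm \<Rightarrow> tm \<Rightarrow> tm \<Rightarrow> tm" where
  "Slot t a b = Plus (Scale 16 t) (Plus (Scale 4 a) b)"
text \<open>The offsets here and below come from the storage format. Index 0 of an array holds the
  length, so list entries are shifted by one. In the instance, index 1 holds \<open>m\<close> and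
  index 2 the number of tetrahedra; then each tetrahedron takes 20 entries, namely four gluings of
  five numbers each.\<close>

definition Colour :: "tm \<Rightarrow> tm" where
  "Colour z = Plus (Arr 1 (Plus (Scale 2 z) (Num 1))) (Arr 1 (Plus (Scale 2 z) (Num 2)))"
definition Adj :: "tm \<Rightarrow> tm \<Rightarrow> tm" where
  "Adj t f = Arr 0 (Plus (Num 3) (Plus (Scale 20 t) (Scale 5 f)))"
definition Perm :: "tm \<Rightarrow> tm \<Rightarrow> tm \<Rightarrow> tm" where
  "Perm t f v = Arr 0 (Plus (Num 4) (Plus (Scale 20 t) (Plus (Scale 5 f) v)))"
definition Glue :: "tm \<Rightarrow> tm \<Rightarrow> tm \<Rightarrow> tm \<Rightarrow> tm" where
  "Glue t f a b = Slot (Adj t f) (Perm t f a) (Perm t f b)"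
definition Tet_Of :: "tm \<Rightarrow> tm" where "Tet_Of z = Quot z (Num 16)"
definition Fst_Of :: "tm \<Rightarrow> tm" where "Fst_Of z = Minus (Quot z (Num 4)) (Scale 4 (Quot z (Num 16)))"
definition Snd_Of :: "tm \<Rightarrow> tm" where "Snd_Of z = Minus z (Scale 4 (Quot z (Num 4)))"
definition Even :: "tm \<Rightarrow> tm" where "Even t = Eq t (Scale 2 (Quot t (Num 2)))"

text \<open>Arrays: 0 instance, 1 witness, 2 number of tetrahedra, 3 length of the witness,
  4 and 5 the set of the slots known to reach the slot \<open>z\<close> (variable 0), 6 number of edges coloured 1/2.\<close>

definition reach_tm :: tm where
  "reach_tm = Disj (Arr 4 (Var 2)) (Disj (Arr 4 (Slot (Tet_Of (Var 2)) (Snd_Of (Var 2)) (Fst_Of (Var 2))))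
     (Count 3 (Fixed 4) (Conj (Neg (Eq (Var 3) (Fst_Of (Var 2)))) (Conj (Neg (Eq (Var 3) (Snd_Of (Var 2))))
       (Arr 4 (Glue (Tet_Of (Var 2)) (Var 3) (Fst_Of (Var 2)) (Snd_Of (Var 2))))))))"

text \<open>The new set is built in array 5 and copied back afterwards. So a round reads only the
  old set, and \<open>r\<close> rounds capture exactly the paths of length at most
  \<open>r\<close>.\<close>

definition reach_round :: stm where
  "reach_round = Then (For 2 (Times 16 2) (Assign 5 (Var 2) reach_tm))
     (For 2 (Times 16 2) (Assign 4 (Var 2) (Arr 5 (Var 2))))"

definition start_tm :: tm where
  "start_tm = Cond (Eq (Var 2) (Var 0)) (Num 1) (Num 0)"

definition first_half_slot_tm :: tm where
  "first_half_slot_tm = Conj (Eq (Colour (Var 0)) (Num 1))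
     (Neg (Count 2 (Times 16 2) (Conj (Less (Var 2) (Var 0)) (Arr 4 (Var 2)))))"

definition count_edges :: stm where
  "count_edges = For 0 (Times 16 2) (Then (For 2 (Times 16 2) (Assign 4 (Var 2) start_tm))
    (Then (For 1 (Times 80 2) reach_round)
      (Assign 6 (Num 0) (Plus (Arr 6 (Num 0)) (Cond first_half_slot_tm (Num 1) (Num 0))))))"

definition trailing_zero_tm :: tm where
  "trailing_zero_tm = Disj (Less (Var 0) (Scale 32 (Arr 2 (Num 0)))) (Neg (Arr 1 (Plus (Var 0) (Num 1))))"

definition bits_sorted_tm :: tm where
  "bits_sorted_tm = Neg (Less (Arr 1 (Plus (Scale 2 (Var 0)) (Num 1))) (Arr 1 (Plus (Scale 2 (Var 0)) (Num 2))))"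

definition glue_consistent_tm :: tm where
  "glue_consistent_tm = Disj (Eq (Var 1) (Var 2)) (Disj (Eq (Var 1) (Var 3))
     (Eq (Colour (Slot (Var 0) (Var 2) (Var 3))) (Colour (Glue (Var 0) (Var 1) (Var 2) (Var 3)))))"

definition slot_consistent_tm :: tm where
  "slot_consistent_tm = Conj (Disj (Neg (Eq (Var 2) (Var 3))) (Eq (Colour (Slot (Var 0) (Var 2) (Var 3))) (Num 0)))
     (Conj (Eq (Colour (Slot (Var 0) (Var 2) (Var 3))) (Colour (Slot (Var 0) (Var 3) (Var 2))))
       (Forall 1 (Fixed 4) glue_consistent_tm))"

definition triangle_admissible_tm :: tm where
  "triangle_admissible_tm = Disj (Eq (Var 2) (Var 3)) (Disj (Eq (Var 2) (Var 4)) (Disj (Eq (Var 3) (Var 4))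
     (let x = Colour (Slot (Var 0) (Var 2) (Var 3)); y = Colour (Slot (Var 0) (Var 2) (Var 4));
          z = Colour (Slot (Var 0) (Var 3) (Var 4))
      in Conj (Even (Plus x (Plus y z))) (Conj (Neg (Less (Plus y z) x)) (Conj (Neg (Less (Plus x z) y))
        (Conj (Neg (Less (Plus x y) z)) (Neg (Less (Num 4) (Plus x (Plus y z))))))))))"

definition valid_tm :: tm where
  "valid_tm = Conj (Forall 0 (Times 1 3) trailing_zero_tm) (Conj (Forall 0 (Times 16 2) bits_sorted_tm)
    (Conj (Forall 0 (Times 1 2) (Forall 2 (Fixed 4) (Forall 3 (Fixed 4) slot_consistent_tm)))
      (Forall 0 (Times 1 2) (Forall 2 (Fixed 4) (Forall 3 (Fixed 4) (Forall 4 (Fixed 4) triangle_admissible_tm))))))"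

definition half_slot_tm :: tm where
  "half_slot_tm = Eq (Colour (Slot (Var 0) (Var 2) (Var 3))) (Num 1)"

definition half_face_tm :: tm where
  "half_face_tm = Conj (Neg (Eq (Var 2) (Var 1))) (Conj (Neg (Eq (Var 3) (Var 1))) half_slot_tm)"

definition full_slot_tm :: tm where
  "full_slot_tm = Disj (Eq (Var 2) (Var 3)) (Less (Num 0) (Colour (Slot (Var 0) (Var 2) (Var 3))))"

definition half_faces_tm :: tm where
  "half_faces_tm = Sum 0 (Times 1 2) (Count 1 (Fixed 4) (Count 2 (Fixed 4) (Count 3 (Fixed 4) half_face_tm)))"

definition half_tets_tm :: tm where
  "half_tets_tm = Count 0 (Times 1 2) (Count 2 (Fixed 4) (Count 3 (Fixed 4) half_slot_tm))"

definition full_tets_tm :: tm where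
  "full_tets_tm = Count 0 (Times 1 2) (Forall 2 (Fixed 4) (Forall 3 (Fixed 4) full_slot_tm))"

text \<open>The loop bounds are derived from the lengths of instance and witness. The entry of the
  instance that should state the number of tetrahedra may be exponentially large in an arbitrary
  input, and the verifier would then run too long. On an encoding the length is
  \<open>2 + 20 * n\<close>.\<close>

definition verifier_init :: stm where
  "verifier_init = Then (Assign 2 (Num 0) (Quot (Minus (Arr 0 (Num 0)) (Num 2)) (Num 20)))
     (Assign 3 (Num 0) (Arr 1 (Num 0)))"

definition verifier_main :: "bool \<Rightarrow> stm" where
  "verifier_main parity = Then count_edges (Assign 0 (Num 0) (Conj valid_tm
     (Conj (Eq (Plus (Minus (Scale 2 (Arr 6 (Num 0))) half_faces_tm) (Scale 2 half_tets_tm)) (Scale 2 (Arr 0 (Num 1))))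
       (if parity then Even full_tets_tm else Neg (Even full_tets_tm)))))"

section \<open>Correctness of the reachability computation\<close>

context gluing begin

text \<open>Speaks of arrays 0 to 3 only, so that writing to the work arrays 4 to 6 preserves
  it.\<close>

definition verifier_input :: "int \<Rightarrow> int list \<Rightarrow> memory \<Rightarrow> bool" where
  "verifier_input m w s \<longleftrightarrow> s 0 1 = m \<and>
    (\<forall>t<n. \<forall>f<4. s 0 (3 + (20 * int t + 5 * int f)) = int (adj T t f) \<and>
      (\<forall>v<4. s 0 (4 + (20 * int t + (5 * int f + int v))) = int (perm T t f v))) \<and>
    (\<forall>i<length w. s 1 (int i + 1) = w ! i) \<and> s 2 0 = int n \<and> s 3 0 = int (length w) \<and>
    32 * n \<le> length w \<and> set w \<subseteq> {0, 1}"

lemma verifier_input_fun_upd: "verifier_input m w s \<Longrightarrow> 4 \<le> a \<Longrightarrow> verifier_input m w (s(a := g))"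
  by (simp add: verifier_input_def)

lemma val_Slot: "val s \<rho> t = int x \<Longrightarrow> val s \<rho> a = int y \<Longrightarrow> val s \<rho> b = int z \<Longrightarrow>
    val s \<rho> (Slot t a b) = int (slot x y z)"
  by (simp add: Slot_def slot_def)

lemma bound_val_tets: "verifier_input m w s \<Longrightarrow> bound_val s (Times k 2) = k * n"
  by (simp add: verifier_input_def nat_mult_distrib)

lemma val_Adj: "verifier_input m w s \<Longrightarrow> val s \<rho> t = int x \<Longrightarrow> val s \<rho> f = int y \<Longrightarrow> x < n \<Longrightarrow> y < 4 \<Longrightarrow>
    val s \<rho> (Adj t f) = int (adj T x y)"
  by (simp add: Adj_def verifier_input_def)

lemma val_Perm: "verifier_input m w s \<Longrightarrow> val s \<rho> t = int x \<Longrightarrow> val s \<rho> f = int y \<Longrightarrow> val s \<rho> v = int z \<Longrightarrow>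
    x < n \<Longrightarrow> y < 4 \<Longrightarrow> z < 4 \<Longrightarrow> val s \<rho> (Perm t f v) = int (perm T x y z)"
  by (simp add: Perm_def verifier_input_def)

lemma val_Glue: "verifier_input m w s \<Longrightarrow> val s \<rho> t = int x \<Longrightarrow> val s \<rho> f = int y \<Longrightarrow> val s \<rho> a = int z \<Longrightarrow>
    val s \<rho> b = int z' \<Longrightarrow> x < n \<Longrightarrow> y < 4 \<Longrightarrow> z < 4 \<Longrightarrow> z' < 4 \<Longrightarrow>
    val s \<rho> (Glue t f a b) = int (slot (adj T x y) (perm T x y z) (perm T x y z'))"
  unfolding Glue_def by (intro val_Slot val_Adj val_Perm)

lemma bit_cases: "verifier_input m w s \<Longrightarrow> i < length w \<Longrightarrow> w ! i = 0 \<or> w ! i = 1"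
  unfolding verifier_input_def using nth_mem by blast

lemma val_Colour:
  assumes "verifier_input m w s" "val s \<rho> t = int z" "z < 16 * n"
  shows "val s \<rho> (Colour t) = int (bits_colour w z)"
proof -
  have z: "2 * z < length w" "2 * z + 1 < length w" using assms by (auto simp: verifier_input_def)
  then have "s 1 (int (2 * z) + 1) = w ! (2 * z)" "s 1 (int (2 * z + 1) + 1) = w ! (2 * z + 1)"
    using assms(1) unfolding verifier_input_def by blast+
  moreover have "int (2 * z + 1) + 1 = 2 * int z + 2" "int (2 * z) + 1 = 2 * int z + 1" by simp_all
  ultimately show ?thesis
    using bit_cases[OF assms(1) z(1)] bit_cases[OF assms(1) z(2)] assms(2)
    by (auto simp: Colour_def bits_colour_def add.commute simp del: One_nat_def)
qed

lemma val_decode: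
  assumes "val s \<rho> t = int z"
  shows "val s \<rho> (Tet_Of t) = int (tet_of z)" "val s \<rho> (Fst_Of t) = int (fst_of z)"
    "val s \<rho> (Snd_Of t) = int (snd_of z)"
proof -
  have "4 * (z div 16) \<le> z div 4" "4 * (z div 4) \<le> z" by linarith+
  then show "val s \<rho> (Tet_Of t) = int (tet_of z)" "val s \<rho> (Fst_Of t) = int (fst_of z)"
    "val s \<rho> (Snd_Of t) = int (snd_of z)"
    using assms by (simp_all add: Tet_Of_def Fst_Of_def Snd_Of_def tet_of_def fst_of_def snd_of_def
      of_nat_diff zdiv_int)
qed

definition reached :: "nat \<Rightarrow> nat \<Rightarrow> memory \<Rightarrow> bool" where
  "reached z r s \<longleftrightarrow> (\<forall>j<16 * n. 0 < s 4 (int j) \<longleftrightarrow> (\<exists>k\<le>r. (j, z) \<in> slot_steps ^^ k))"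

lemma relpow_le_Suc: "(\<exists>k\<le>Suc r. (x, z) \<in> R ^^ k) \<longleftrightarrow>
    (\<exists>k\<le>r. (x, z) \<in> R ^^ k) \<or> (\<exists>y. (x, y) \<in> R \<and> (\<exists>k\<le>r. (y, z) \<in> R ^^ k))"
proof
  assume "\<exists>k\<le>Suc r. (x, z) \<in> R ^^ k"
  then obtain k where k: "k \<le> Suc r" "(x, z) \<in> R ^^ k" by blast
  show "(\<exists>k\<le>r. (x, z) \<in> R ^^ k) \<or> (\<exists>y. (x, y) \<in> R \<and> (\<exists>k\<le>r. (y, z) \<in> R ^^ k))"
  proof (cases k)
    case (Suc i)
    then obtain y where "(x, y) \<in> R" "(y, z) \<in> R ^^ i" using k(2) by (metis relpow_Suc_E2)
    then show ?thesis using k(1) Suc by auto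
  qed (use k in auto)
next
  assume "(\<exists>k\<le>r. (x, z) \<in> R ^^ k) \<or> (\<exists>y. (x, y) \<in> R \<and> (\<exists>k\<le>r. (y, z) \<in> R ^^ k))"
  then show "\<exists>k\<le>Suc r. (x, z) \<in> R ^^ k"
    by (meson Suc_le_mono le_SucI relpow_Suc_I2)
qed

definition same_except :: "nat set \<Rightarrow> memory \<Rightarrow> memory \<Rightarrow> bool" where
  "same_except A s s' \<longleftrightarrow> (\<forall>a. a \<notin> A \<longrightarrow> s' a = s a)"

lemma verifier_input_same_except:
  "verifier_input m w s \<Longrightarrow> same_except A s s' \<Longrightarrow> \<forall>a\<in>A. 4 \<le> a \<Longrightarrow> verifier_input m w s'"
proof -
  assume *: "verifier_input m w s" "same_except A s s'" "\<forall>a\<in>A. 4 \<le> a"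
  then have "0 \<notin> A" "1 \<notin> A" "2 \<notin> A" "3 \<notin> A" by force+
  then have "s' 0 = s 0" "s' 1 = s 1" "s' 2 = s 2" "s' 3 = s 3"
    using *(2) by (simp_all add: same_except_def)
  then show "verifier_input m w s'" using *(1) by (simp add: verifier_input_def)
qed

text \<open>A slot reaches \<open>z\<close> within \<open>Suc r\<close> steps if it does so within
  \<open>r\<close> steps or has a successor that does. Searching backwards from \<open>z\<close> in
  this way, the program inspects only the successors of a slot, which the gluing table lists
  directly.\<close>

lemma run_reach_round:
  assumes in_s: "verifier_input m w s" and "reached z r s"
  shows "reached z (Suc r) (run \<O> reach_round \<rho> s) \<and> same_except {4, 5} s (run \<O> reach_round \<rho> s)"
proof -
  define s1 where "s1 = run \<O> (For 2 (Times 16 2) (Assign 5 (Var 2) reach_tm)) \<rho> s"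
  have s1: "s1 = s(5 := (\<lambda>i. if 0 \<le> i \<and> i < int (16 * n) then val s (\<rho>(2 := i)) reach_tm else s 5 i))"
    unfolding s1_def bound_val_tets[OF in_s, of 16, symmetric]
    by (rule run_For_Assign) (simp add: reach_tm_def Disj_def Conj_def Neg_def Eq_def Less_def Count_def
      Slot_def Glue_def Adj_def Perm_def Tet_Of_def Fst_Of_def Snd_Of_def)
  have in_s1: "verifier_input m w s1" unfolding s1 by (rule verifier_input_fun_upd[OF in_s]) simp
  have s2: "run \<O> reach_round \<rho> s = s1(4 := (\<lambda>i. if 0 \<le> i \<and> i < int (16 * n) then s1 5 i else s1 4 i))"
    unfolding reach_round_def run.simps(2) s1_def[symmetric]
      bound_val_tets[OF in_s1, of 16, symmetric]
    by (subst run_For_Assign) (simp_all cong: if_cong)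
  have "0 < val s (\<rho>(2 := int j)) reach_tm \<longleftrightarrow> (\<exists>k\<le>Suc r. (j, z) \<in> slot_steps ^^ k)" if j: "j < 16 * n" for j
  proof -
    let ?\<rho> = "\<rho>(2 := int j)"
    have R: "0 < s 4 (int i) \<longleftrightarrow> (\<exists>k\<le>r. (i, z) \<in> slot_steps ^^ k)" if "i < 16 * n" for i
      using assms(2) that by (simp add: reached_def)
    obtain t a b where tab: "t < n" "a < 4" "b < 4" "j = slot t a b" using slot_exhaust[OF j] .
    have dec: "val s \<rho>' (Tet_Of (Var 2)) = int t" "val s \<rho>' (Fst_Of (Var 2)) = int a"
        "val s \<rho>' (Snd_Of (Var 2)) = int b" if "\<rho>' 2 = int j" for \<rho>'
      using val_decode[of s \<rho>' "Var 2" j] tab that by simp_all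
    have sl: "val s ?\<rho> (Slot (Tet_Of (Var 2)) (Snd_Of (Var 2)) (Fst_Of (Var 2))) = int (slot t b a)"
      by (intro val_Slot dec) simp_all
    have gl: "val s (?\<rho>(3 := int f)) (Glue (Tet_Of (Var 2)) (Var 3) (Fst_Of (Var 2)) (Snd_Of (Var 2))) =
        int (slot (adj T t f) (perm T t f a) (perm T t f b))" if "f < 4" for f
      using that tab by (intro val_Glue[OF in_s] dec) simp_all
    have less: "slot t b a < 16 * n" "\<And>f. f < 4 \<Longrightarrow> slot (adj T t f) (perm T t f a) (perm T t f b) < 16 * n"
      using tab slot_less adj_less perm_less by simp_all
    have "holds s ?\<rho> reach_tm \<longleftrightarrow> 0 < s 4 (int j) \<or> 0 < s 4 (int (slot t b a)) \<or>
       (\<exists>f<4. f \<noteq> a \<and> f \<noteq> b \<and> 0 < s 4 (int (slot (adj T t f) (perm T t f a) (perm T t f b))))"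
      unfolding reach_tm_def using dec gl by (auto simp: sl)
    also have "\<dots> \<longleftrightarrow> (\<exists>k\<le>r. (j, z) \<in> slot_steps ^^ k) \<or> (\<exists>k\<le>r. (slot t b a, z) \<in> slot_steps ^^ k) \<or>
       (\<exists>f<4. f \<noteq> a \<and> f \<noteq> b \<and> (\<exists>k\<le>r. (slot (adj T t f) (perm T t f a) (perm T t f b), z) \<in> slot_steps ^^ k))"
      by (simp add: R[OF j] R[OF less(1)] R[OF less(2)] cong: conj_cong)
    also have "\<dots> \<longleftrightarrow> (\<exists>k\<le>r. (j, z) \<in> slot_steps ^^ k) \<or>
        (\<exists>y. (j, y) \<in> slot_steps \<and> (\<exists>k\<le>r. (y, z) \<in> slot_steps ^^ k))"
      unfolding tab(4) slot_steps_iff[OF tab(1-3)] by blast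
    finally show ?thesis unfolding relpow_le_Suc holds_def .
  qed
  then have "reached z (Suc r) (run \<O> reach_round \<rho> s)"
    unfolding reached_def s2 s1 by simp
  moreover have "same_except {4, 5} s (run \<O> reach_round \<rho> s)"
    unfolding s2 s1 by (simp add: same_except_def)
  ultimately show ?thesis ..
qed

lemma run_count_edges:
  assumes "verifier_input m w s" "s 6 0 = 0"
  shows "verifier_input m w (run \<O> count_edges \<rho> s) \<and>
    run \<O> count_edges \<rho> s 6 0 = int (half_edges (bits_colour w))"
proof -
  define Q where "Q z \<longleftrightarrow> bits_colour w z = 1 \<and> \<not> (\<exists>i<z. (i, z) \<in> slot_steps\<^sup>*)" for z
  define I where "I z s' \<longleftrightarrow> verifier_input m w s' \<and> s' 6 0 = int (card {y. y < z \<and> Q y})" for z s'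
  have "I (bound_val s (Times 16 2)) (run \<O> count_edges \<rho> s)"
    unfolding count_edges_def
  proof (rule run_For_invariant)
    show "I 0 s" using assms by (simp add: I_def)
    fix z s0 assume z: "z < bound_val s (Times 16 2)" and I: "I z s0"
    have z16: "z < 16 * n" using z unfolding bound_val_tets[OF assms(1)] .
    let ?\<rho> = "\<rho>(0 := int z)"
    have in0: "verifier_input m w s0" using I by (simp add: I_def)
    define s1 where "s1 = run \<O> (For 2 (Times 16 2) (Assign 4 (Var 2) start_tm)) ?\<rho> s0"
    have s1: "s1 = s0(4 := (\<lambda>i. if 0 \<le> i \<and> i < int (16 * n) then if i = int z then 1 else 0 else s0 4 i))"
    proof -
      have nr: "\<not> reads 4 start_tm"
        by (simp add: start_tm_def Eq_def Conj_def Neg_def Less_def)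
      have v: "val s0 (?\<rho>(2 := i)) start_tm = (if i = int z then 1 else 0)" for i
        by (simp add: start_tm_def cong: if_cong)
      show ?thesis unfolding s1_def run_For_Assign[OF nr] bound_val_tets[OF in0] v ..
    qed
    have in1: "verifier_input m w s1" unfolding s1 by (rule verifier_input_fun_upd[OF in0]) simp
    define s2 where "s2 = run \<O> (For 1 (Times 80 2) reach_round) ?\<rho> s1"
    have "reached z (bound_val s1 (Times 80 2)) s2 \<and> same_except {4, 5} s1 s2"
      unfolding s2_def
    proof (rule run_For_invariant)
      show "reached z 0 s1 \<and> same_except {4, 5} s1 s1" by (simp add: reached_def same_except_def s1)
      fix r s' assume *: "reached z r s' \<and> same_except {4, 5} s1 s'"
      then have "verifier_input m w s'" using verifier_input_same_except[OF in1, of "{4, 5}" s'] by simp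
      from run_reach_round[OF this, of z r \<O> "?\<rho>(1 := int r)"] *
      show "reached z (Suc r) (run \<O> reach_round (?\<rho>(1 := int r)) s') \<and>
          same_except {4, 5} s1 (run \<O> reach_round (?\<rho>(1 := int r)) s')"
        unfolding same_except_def by metis
    qed
    then have r2: "reached z (80 * n) s2" and e2: "same_except {4, 5} s1 s2"
      unfolding bound_val_tets[OF in1] by simp_all
    have in2: "verifier_input m w s2" by (rule verifier_input_same_except[OF in1 e2]) simp
    have reach: "0 < s2 4 (int i) \<longleftrightarrow> (i, z) \<in> slot_steps\<^sup>*" if "i < 16 * n" for i
      using r2 that rtrancl_slot_steps_iff_relpow[of "80 * n"] by (simp add: reached_def)
    have "holds s2 ?\<rho> first_half_slot_tm \<longleftrightarrow>
      bits_colour w z = 1 \<and> \<not> (\<exists>i<16 * n. i < z \<and> 0 < s2 4 (int i))"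
      using val_Colour[OF in2, of ?\<rho> "Var 0" z] z16
      by (simp add: first_half_slot_tm_def bound_val_tets[OF in2] del: bound_val.simps)
    also have "\<dots> \<longleftrightarrow> Q z" unfolding Q_def using reach z16 by auto
    finally have Q: "holds s2 ?\<rho> first_half_slot_tm \<longleftrightarrow> Q z" .
    have "s2 6 0 = int (card {y. y < z \<and> Q y})" using e2 I by (simp add: same_except_def s1 I_def)
    moreover have "{y. y < Suc z \<and> Q y} = (if Q z then insert z {y. y < z \<and> Q y} else {y. y < z \<and> Q y})"
      by (auto simp: less_Suc_eq)
    ultimately have "I (Suc z) (store s2 6 0 (s2 6 0 + (if Q z then 1 else 0)))"
      unfolding I_def using verifier_input_fun_upd[OF in2] by (auto simp: store_def)
    then show "I (Suc z) (run \<O> (Then (For 2 (Times 16 2) (Assign 4 (Var 2) start_tm))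
        (Then (For 1 (Times 80 2) reach_round)
          (Assign 6 (Num 0) (Plus (Arr 6 (Num 0)) (Cond first_half_slot_tm (Num 1) (Num 0)))))) ?\<rho> s0)"
      unfolding run.simps(2) s1_def[symmetric] s2_def[symmetric] run.simps(1) val.simps(1-4) op_val.simps val_Cond Q .
  qed
  then show ?thesis unfolding I_def half_edges_def Q_def bound_val_tets[OF assms(1)] by simp
qed

end

section \<open>Decoding the instance and checking the witness\<close>

lemma nth_concat_uniform:
  assumes "\<And>ys. ys \<in> set xs \<Longrightarrow> length ys = k" "i < length xs" "j < k"
  shows "concat xs ! (k * i + j) = xs ! i ! j"
  using assms
proof (induction xs arbitrary: i)
  case (Cons y xs)
  have y: "length y = k" using Cons.prems(1) by simp
  show ?case
  proof (cases i)
    case 0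
    then show ?thesis using y Cons.prems(3) by (simp add: nth_append)
  next
    case (Suc i')
    then have "concat xs ! (k * i' + j) = xs ! i' ! j" using Cons by simp
    then show ?thesis using y Suc by (simp add: nth_append)
  qed
qed simp

lemma length_concat_uniform: "(\<And>ys. ys \<in> set xs \<Longrightarrow> length ys = k) \<Longrightarrow> length (concat xs) = k * length xs"
  by (induction xs) auto

lemma even_quotient_iff: "(int k = 2 * (int k div 2)) \<longleftrightarrow> even k"
  by presburger

context gluing begin

lemma
  assumes "t < n"
  shows length_tet: "length (T ! t) = 4" and length_gluing: "f < 4 \<Longrightarrow> length (snd (T ! t ! f)) = 4"
  using face_pairing assms unfolding face_pairing_def by auto

lemma
  shows length_encode: "length (encode T) = 1 + 20 * n"
    and encode_adj: "t < n \<Longrightarrow> f < 4 \<Longrightarrow> encode T ! (1 + 20 * t + 5 * f) = int (adj T t f)"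
    and encode_perm: "t < n \<Longrightarrow> f < 4 \<Longrightarrow> v < 4 \<Longrightarrow> encode T ! (2 + 20 * t + 5 * f + v) = int (perm T t f v)"
proof -
  define g where "g = (\<lambda>(u, ps). int u # map int ps :: int list)"
  define h where "h = (\<lambda>gs. concat (map g gs))"
  have enc: "encode T = int n # concat (map h T)" by (simp add: encode_def g_def h_def)
  have g5: "length ys = 5" if ys: "ys \<in> set (map g gs)" and gs: "gs \<in> set T" for ys gs
  proof -
    obtain t where t: "t < n" "gs = T ! t" using gs by (auto simp: in_set_conv_nth)
    then obtain f where f: "f < 4" "ys = g (T ! t ! f)" using ys length_tet by (auto simp: in_set_conv_nth)
    show ?thesis using length_gluing[OF t(1) f(1)] by (simp add: f(2) g_def split_beta)
  qed
  have h20: "length ys = 20" if ys: "ys \<in> set (map h T)" for ys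
  proof -
    obtain gs where gs: "gs \<in> set T" "ys = h gs" using ys by auto
    then have "length gs = 4" using length_tet by (auto simp: in_set_conv_nth)
    then show ?thesis using length_concat_uniform[of "map g gs" 5] g5[OF _ gs(1)] by (simp add: gs(2) h_def)
  qed
  show "length (encode T) = 1 + 20 * n" using length_concat_uniform[of "map h T" 20, OF h20] by (simp add: enc)
  have nth: "encode T ! (1 + 20 * t + 5 * f + j) = g (T ! t ! f) ! j" if *: "t < n" "f < 4" "j < 5" for t f j
  proof -
    have "concat (map h T) ! (20 * t + (5 * f + j)) = map h T ! t ! (5 * f + j)"
      by (rule nth_concat_uniform[OF h20]) (use * in auto)
    also have "map h T ! t = concat (map g (T ! t))" using * by (simp add: h_def)
    also have "concat (map g (T ! t)) ! (5 * f + j) = map g (T ! t) ! f ! j"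
      by (rule nth_concat_uniform) (use * g5 length_tet in auto)
    finally show ?thesis using * length_tet by (simp add: enc add.assoc)
  qed
  show "encode T ! (1 + 20 * t + 5 * f) = int (adj T t f)" if "t < n" "f < 4"
    using nth[of t f 0] that by (simp add: g_def adj_def split_beta)
  show "encode T ! (2 + 20 * t + 5 * f + v) = int (perm T t f v)" if "t < n" "f < 4" "v < 4"
  proof -
    have "encode T ! (1 + 20 * t + 5 * f + (1 + v)) = g (T ! t ! f) ! (1 + v)" by (rule nth) (use that in auto)
    then show ?thesis using that length_gluing by (simp add: g_def perm_def split_beta add_ac)
  qed
qed

lemma val_Colour_Slot:
  assumes "verifier_input m w s" "t < n" "a < 4" "b < 4" "\<rho> x = int t" "\<rho> y = int a" "\<rho> z = int b"
  shows "val s \<rho> (Colour (Slot (Var x) (Var y) (Var z))) = int (bits_colour w (slot t a b))"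
  by (intro val_Colour[OF assms(1)] val_Slot slot_less) (use assms in simp_all)

lemma holds_valid_tm:
  assumes i: "verifier_input m w s"
  shows "holds s \<rho> valid_tm \<longleftrightarrow> valid_bits w"
proof -
  have w: "s 3 0 = int (length w)" "s 2 0 = int n" "32 * n \<le> length w" using i by (simp_all add: verifier_input_def)
  have bit: "s 1 (int k + 1) = w ! k" if "k < length w" for k using i that by (simp add: verifier_input_def)
  have b3: "bound_val s (Times 1 3) = length w" by (simp add: w)
  note b = bound_val_tets[OF i]
  have 1: "holds s \<rho> (Forall 0 (Times 1 3) trailing_zero_tm) \<longleftrightarrow> (\<forall>i<length w. 32 * n \<le> i \<longrightarrow> w ! i \<le> 0)"
  proof -
    have "holds s (\<rho>(0 := int k)) trailing_zero_tm \<longleftrightarrow> (32 * n \<le> k \<longrightarrow> w ! k \<le> 0)" if "k < length w" for k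
      using bit[OF that] w by (auto simp: trailing_zero_tm_def)
    then show ?thesis unfolding holds_Forall b3 by auto
  qed
  have 2: "holds s \<rho> (Forall 0 (Times 16 2) bits_sorted_tm) \<longleftrightarrow> (\<forall>z<16 * n. w ! (2 * z + 1) \<le> w ! (2 * z))"
  proof -
    have "holds s (\<rho>(0 := int z)) bits_sorted_tm \<longleftrightarrow> w ! (2 * z + 1) \<le> w ! (2 * z)" if z: "z < 16 * n" for z
    proof -
      have "s 1 (2 * int z + 1) = w ! (2 * z)" "s 1 (2 * int z + 2) = w ! (2 * z + 1)"
        using bit[of "2 * z"] bit[of "2 * z + 1"] z w by (simp_all add: add.commute)
      then show ?thesis by (auto simp: bits_sorted_tm_def)
    qed
    then show ?thesis unfolding holds_Forall b by auto
  qed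
  have 3: "holds s \<rho> (Forall 0 (Times 1 2) (Forall 2 (Fixed 4) (Forall 3 (Fixed 4) slot_consistent_tm))) \<longleftrightarrow>
      consistent (bits_colour w)"
  proof -
    have "holds s (\<rho>(0 := int t, 2 := int a, 3 := int b)) slot_consistent_tm \<longleftrightarrow>
      (a = b \<longrightarrow> bits_colour w (slot t a b) = 0) \<and> bits_colour w (slot t a b) = bits_colour w (slot t b a) \<and>
     (\<forall>f<4. f \<noteq> a \<longrightarrow> f \<noteq> b \<longrightarrow> bits_colour w (slot t a b) = bits_colour w (slot (adj T t f) (perm T t f a) (perm T t f b)))"
      (is "holds s ?\<rho> _ \<longleftrightarrow> _") if *: "t < n" "a < 4" "b < 4" for t a b
    proof -
      have ab: "val s ?\<rho> (Colour (Slot (Var 0) (Var 2) (Var 3))) = int (bits_colour w (slot t a b))"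
        "val s ?\<rho> (Colour (Slot (Var 0) (Var 3) (Var 2))) = int (bits_colour w (slot t b a))"
        by (rule val_Colour_Slot[OF i]; use * in simp)+
      have f: "holds s (?\<rho>(1 := int f)) glue_consistent_tm \<longleftrightarrow>
        (f \<noteq> a \<longrightarrow> f \<noteq> b \<longrightarrow> bits_colour w (slot t a b) = bits_colour w (slot (adj T t f) (perm T t f a) (perm T t f b)))"
        if "f < 4" for f
      proof -
        have "val s (?\<rho>(1 := int f)) (Colour (Slot (Var 0) (Var 2) (Var 3))) = int (bits_colour w (slot t a b))"
          by (rule val_Colour_Slot[OF i]; use * in simp)
        moreover have "val s (?\<rho>(1 := int f)) (Colour (Glue (Var 0) (Var 1) (Var 2) (Var 3))) =
            int (bits_colour w (slot (adj T t f) (perm T t f a) (perm T t f b)))"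
          by (rule val_Colour[OF i val_Glue[OF i]]) (use * that slot_less adj_less perm_less in simp_all)
        ultimately show ?thesis by (auto simp: glue_consistent_tm_def)
      qed
      show ?thesis
        unfolding slot_consistent_tm_def holds_simps holds_Eq holds_Forall bound_val.simps ab using f * by auto
    qed
    then show ?thesis unfolding holds_Forall consistent_def b bound_val.simps(1) by simp
  qed
  have 4: "holds s \<rho> (Forall 0 (Times 1 2) (Forall 2 (Fixed 4) (Forall 3 (Fixed 4) (Forall 4 (Fixed 4)
      triangle_admissible_tm)))) \<longleftrightarrow> admissible (bits_colour w)"
  proof -
    have "holds s (\<rho>(0 := int t, 2 := int a, 3 := int b, 4 := int d)) triangle_admissible_tm \<longleftrightarrow>
      (a \<noteq> b \<longrightarrow> a \<noteq> d \<longrightarrow> b \<noteq> d \<longrightarrow>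
        adm3 (bits_colour w (slot t a b)) (bits_colour w (slot t a d)) (bits_colour w (slot t b d)))"
      (is "holds s ?\<rho> _ \<longleftrightarrow> _") if *: "t < n" "a < 4" "b < 4" "d < 4" for t a b d
    proof -
      define x y z where "x = bits_colour w (slot t a b)" "y = bits_colour w (slot t a d)" "z = bits_colour w (slot t b d)"
      have ab: "val s ?\<rho> (Colour (Slot (Var 0) (Var 2) (Var 3))) = int x"
        "val s ?\<rho> (Colour (Slot (Var 0) (Var 2) (Var 4))) = int y"
        "val s ?\<rho> (Colour (Slot (Var 0) (Var 3) (Var 4))) = int z"
        unfolding x_y_z_def by (rule val_Colour_Slot[OF i]; use * in simp)+
      have "(int x + (int y + int z) = 2 * ((int x + (int y + int z)) div 2)) \<longleftrightarrow> even (x + y + z)"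
        using even_quotient_iff[of "x + y + z"] by (simp add: add.assoc)
      then show ?thesis
        unfolding triangle_admissible_tm_def Let_def x_y_z_def[symmetric] adm3_def holds_simps holds_Eq Even_def
          val.simps(1-5) op_val.simps ab
        by auto
    qed
    then show ?thesis unfolding holds_Forall admissible_def b bound_val.simps(1) by simp
  qed
  show ?thesis unfolding valid_tm_def holds_simps(2) 1 2 3 4 valid_bits_def ..
qed

lemma val_counts:
  assumes i: "verifier_input m w s"
  shows "val s \<rho> half_faces_tm = int (half_faces (bits_colour w))"
    and "val s \<rho> half_tets_tm = int (half_tets (bits_colour w))"
    and "val s \<rho> full_tets_tm = int (full_tets (bits_colour w))"
proof -
  note b = bound_val_tets[OF i]
  have colour: "val s \<rho>' (Colour (Slot (Var 0) (Var 2) (Var 3))) = int (bits_colour w (slot t a b))"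
    if "t < n" "a < 4" "b < 4" "\<rho>' 0 = int t" "\<rho>' 2 = int a" "\<rho>' 3 = int b" for \<rho>' t a b
    using val_Colour_Slot[OF i that] .
  have 1: "holds s (\<rho>(0 := int t, 1 := int f)) (Count 2 (Fixed 4) (Count 3 (Fixed 4) half_face_tm)) \<longleftrightarrow>
    (\<exists>a<4. \<exists>b<4. a \<noteq> f \<and> b \<noteq> f \<and> bits_colour w (slot t a b) = 1)" if "t < n" for t f
  proof -
    have "holds s (\<rho>(0 := int t, 1 := int f, 2 := int a, 3 := int b)) half_face_tm \<longleftrightarrow>
        a \<noteq> f \<and> b \<noteq> f \<and> bits_colour w (slot t a b) = 1" if "a < 4" "b < 4" for a b
      using colour[OF \<open>t < n\<close> that] by (simp add: half_face_tm_def half_slot_tm_def)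
    then show ?thesis unfolding holds_Count bound_val.simps(1) by auto
  qed
  have 2: "holds s (\<rho>(0 := int t)) (Count 2 (Fixed 4) (Count 3 (Fixed 4) half_slot_tm)) \<longleftrightarrow>
    (\<exists>a<4. \<exists>b<4. bits_colour w (slot t a b) = 1)" if "t < n" for t
  proof -
    have "holds s (\<rho>(0 := int t, 2 := int a, 3 := int b)) half_slot_tm \<longleftrightarrow> bits_colour w (slot t a b) = 1"
      if "a < 4" "b < 4" for a b
      using colour[OF \<open>t < n\<close> that] by (simp add: half_slot_tm_def)
    then show ?thesis unfolding holds_Count bound_val.simps(1) by auto
  qed
  have 3: "holds s (\<rho>(0 := int t)) (Forall 2 (Fixed 4) (Forall 3 (Fixed 4) full_slot_tm)) \<longleftrightarrow>
    (\<forall>a<4. \<forall>b<4. a = b \<or> 0 < bits_colour w (slot t a b))" if "t < n" for t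
  proof -
    have "holds s (\<rho>(0 := int t, 2 := int a, 3 := int b)) full_slot_tm \<longleftrightarrow>
        a = b \<or> 0 < bits_colour w (slot t a b)" if "a < 4" "b < 4" for a b
      using colour[OF \<open>t < n\<close> that] by (simp add: full_slot_tm_def)
    then show ?thesis unfolding holds_Forall bound_val.simps(1) by auto
  qed
  show "val s \<rho> half_faces_tm = int (half_faces (bits_colour w))"
    unfolding half_faces_tm_def half_faces_def val.simps(7) val_Count[of _ _ 1] b bound_val.simps(1) of_nat_sum
    using 1 by (auto intro!: sum.cong)
  show "val s \<rho> half_tets_tm = int (half_tets (bits_colour w))"
    unfolding half_tets_tm_def half_tets_def val_Count[of _ _ 0] b of_nat_sum
    using 2 by (auto intro!: sum.cong)
  show "val s \<rho> full_tets_tm = int (full_tets (bits_colour w))"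
    unfolding full_tets_tm_def full_tets_def val_Count[of _ _ 0] b of_nat_sum
    using 3 by (auto intro!: sum.cong)
qed

lemma verifier_input_init:
  assumes "w \<in> bit_strings l" "32 * n \<le> l"
  shows "verifier_input m w (run \<O> verifier_init \<rho> (load [encode_with T m, w]))"
    and "run \<O> verifier_init \<rho> (load [encode_with T m, w]) 6 0 = 0"
proof -
  let ?x = "encode_with T m"
  have len: "length ?x = 2 + 20 * n" by (simp add: encode_with_def length_encode)
  have x: "load [?x, w] 0 (int k + 1) = ?x ! k" if "k < 2 + 20 * n" for k
    using that len by (simp add: load_def)
  have enc: "?x ! Suc k = encode T ! k" for k by (simp add: encode_with_def)
  have wl: "length w = l" "set w \<subseteq> {0, 1}" using assms by (auto simp: bit_strings_def)
  have r: "run \<O> verifier_init \<rho> (load [?x, w]) = (load [?x, w])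
      (2 := (load [?x, w] 2)(0 := int n), 3 := (load [?x, w] 3)(0 := int l))"
    using len wl by (simp add: verifier_init_def store_def load_def)
  have adj: "load [?x, w] 0 (3 + (20 * int t + 5 * int f)) = int (adj T t f)" if "t < n" "f < 4" for t f
  proof -
    have "load [?x, w] 0 (int (Suc (1 + 20 * t + 5 * f)) + 1) = int (adj T t f)"
      using that x[of "Suc (1 + 20 * t + 5 * f)"] unfolding enc encode_adj[OF that] by linarith
    then show ?thesis by (simp add: algebra_simps)
  qed
  have perm: "load [?x, w] 0 (4 + (20 * int t + (5 * int f + int v))) = int (perm T t f v)"
    if "t < n" "f < 4" "v < 4" for t f v
  proof -
    have "load [?x, w] 0 (int (Suc (2 + 20 * t + 5 * f + v)) + 1) = int (perm T t f v)"
      using that x[of "Suc (2 + 20 * t + 5 * f + v)"] unfolding enc encode_perm[OF that] by linarith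
    then show ?thesis by (simp add: algebra_simps)
  qed
  have "load [?x, w] 0 1 = m" using x[of 0] by (simp add: encode_with_def)
  moreover have "load [?x, w] 1 (int i + 1) = w ! i" if "i < length w" for i
    using that by (simp add: load_def)
  ultimately show "verifier_input m w (run \<O> verifier_init \<rho> (load [?x, w]))"
    unfolding verifier_input_def r using adj perm wl assms(2) by simp
  show "run \<O> verifier_init \<rho> (load [?x, w]) 6 0 = 0" unfolding r by (simp add: load_def)
qed

lemma verifier_accepts_iff:
  assumes "w \<in> bit_strings l" "32 * n \<le> l"
  shows "0 < run \<O> (verifier_main parity) \<rho> (run \<O> verifier_init \<rho> (load [encode_with T m, w])) 0 0 \<longleftrightarrow>
    valid_bits w \<and> 2 * int (half_edges (bits_colour w)) - int (half_faces (bits_colour w)) +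
      2 * int (half_tets (bits_colour w)) = 2 * m \<and> (even (full_tets (bits_colour w)) \<longleftrightarrow> parity)"
proof -
  define s where "s = run \<O> count_edges \<rho> (run \<O> verifier_init \<rho> (load [encode_with T m, w]))"
  have s: "verifier_input m w s" "s 6 0 = int (half_edges (bits_colour w))"
    using run_count_edges[OF verifier_input_init[OF assms]] by (simp_all add: s_def)
  have m: "s 0 1 = m" using s(1) by (simp add: verifier_input_def)
  have e: "holds s \<rho> (if parity then Even full_tets_tm else Neg (Even full_tets_tm)) \<longleftrightarrow>
      (even (full_tets (bits_colour w)) \<longleftrightarrow> parity)"
    using even_quotient_iff[of "full_tets (bits_colour w)"] by (simp add: Even_def val_counts[OF s(1)])
  have "0 < run \<O> (verifier_main parity) \<rho> (run \<O> verifier_init \<rho> (load [encode_with T m, w])) 0 0 \<longleftrightarrow>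
    holds s \<rho> (Conj valid_tm
     (Conj (Eq (Plus (Minus (Scale 2 (Arr 6 (Num 0))) half_faces_tm) (Scale 2 half_tets_tm)) (Scale 2 (Arr 0 (Num 1))))
       (if parity then Even full_tets_tm else Neg (Even full_tets_tm))))"
    by (simp add: verifier_main_def s_def[symmetric] store_def holds_def)
  then show ?thesis
    unfolding holds_simps(2) holds_Eq holds_valid_tm[OF s(1)] e val.simps(1-5) op_val.simps val_counts[OF s(1)] s(2) m .
qed

text \<open>The numerical tests depend only on slots below \<open>16 * n\<close>, where the bits of
  a colouring agree with its slot colours. Hence the accepted witnesses are the injective image of
  the colourings to be counted.\<close>

lemma card_accepted:
  assumes "32 * n \<le> l"
  shows "card {w \<in> bit_strings l. 0 < run \<O> (verifier_main parity) \<rho> (run \<O> verifier_init \<rho> (load [encode_with T m, w])) 0 0} =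
    (if parity then b_even T m else b_odd T m)"
proof -
  let ?P = "\<lambda>c. 2 * int (half_edges c) - int (half_faces c) + 2 * int (half_tets c) = 2 * m \<and> (even (full_tets c) \<longleftrightarrow> parity)"
  have cong: "?P c = ?P c'" if "\<And>z. z < 16 * n \<Longrightarrow> c z = c' z" for c c'
  proof -
    have "c (slot t a b) = c' (slot t a b)" if "t < n" "a < 4" "b < 4" for t a b
      using \<open>\<And>z. z < 16 * n \<Longrightarrow> c z = c' z\<close> slot_less that by blast
    then have "half_faces c = half_faces c'" "half_tets c = half_tets c'" "full_tets c = full_tets c'"
      unfolding half_faces_def half_tets_def full_tets_def
      by (intro sum.cong refl if_cong ex_cong1 conj_cong all_cong1 imp_cong disj_cong; simp)+
    moreover have "half_edges c = half_edges c'"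
      unfolding half_edges_def using that by (metis (lifting))
    ultimately show ?thesis by simp
  qed
  have P: "?P (bits_colour (colouring_bits l \<theta>)) \<longleftrightarrow> euler_char_surface T (reduction T \<theta>) = m \<and>
      (even (card (octagons T \<theta>)) \<longleftrightarrow> parity)" if \<theta>: "\<theta> \<in> Adm T 4" for \<theta>
  proof -
    have "?P (bits_colour (colouring_bits l \<theta>)) = ?P (slot_colour \<theta>)"
      by (rule cong) (rule bits_colour_colouring_bits[OF \<theta> assms])
    then show ?thesis
      unfolding euler_char_surface_eq[OF \<theta>, symmetric] card_octagons_eq[OF \<theta>, symmetric] by simp
  qed
  have "{w \<in> bit_strings l. 0 < run \<O> (verifier_main parity) \<rho> (run \<O> verifier_init \<rho> (load [encode_with T m, w])) 0 0} =
      {w \<in> {w \<in> bit_strings l. valid_bits w}. ?P (bits_colour w)}"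
    using verifier_accepts_iff[OF _ assms] by blast
  also have "\<dots> = {w \<in> colouring_bits l ` Adm T 4. ?P (bits_colour w)}"
    using bij_betw_colouring_bits[OF assms] by (simp add: bij_betw_def)
  also have "\<dots> = colouring_bits l ` {\<theta> \<in> Adm T 4. euler_char_surface T (reduction T \<theta>) = m \<and>
      (even (card (octagons T \<theta>)) \<longleftrightarrow> parity)}"
    using P by blast
  also have "card \<dots> = card {\<theta> \<in> Adm T 4. euler_char_surface T (reduction T \<theta>) = m \<and>
      (even (card (octagons T \<theta>)) \<longleftrightarrow> parity)}"
    using bij_betw_colouring_bits[OF assms] by (intro card_image) (auto simp: bij_betw_def inj_on_def)
  finally show ?thesis unfolding b_even_def b_odd_def by (simp add: conj_commute)
qed

end

section \<open>Running time of the verifier and membership in #P\<close>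

lemma int_size_int_le: "int_size (int k) \<le> Suc k"
  by (simp add: int_size_le_iff flip: of_nat_power)

lemma int_size_load:
  assumes "1 \<le> B" "\<And>xs x. xs \<in> set xss \<Longrightarrow> x \<in> set xs \<Longrightarrow> int_size x \<le> B"
    and "\<And>xs. xs \<in> set xss \<Longrightarrow> length xs < B"
  shows "int_size (load xss a i) \<le> B"
proof -
  have "int_size (int (length (xss ! a))) \<le> B" if "a < length xss"
    using int_size_int_le[of "length (xss ! a)"] assms(3)[OF nth_mem[OF that]] by simp
  moreover have "int_size (xss ! a ! nat (i - 1)) \<le> B"
    if "a < length xss" "1 \<le> i" "i \<le> int (length (xss ! a))"
    using that by (intro assms(2)[OF nth_mem[OF that(1)]] nth_mem) linarith
  moreover have "int_size 0 \<le> B" using assms(1) by (simp add: int_size_def floorlog_def)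
  ultimately show ?thesis by (auto simp: load_def)
qed

lemma length_le_list_size: "length xs \<le> list_size xs"
proof -
  have "(\<Sum>x\<leftarrow>xs. 1) \<le> (\<Sum>x\<leftarrow>xs. int_size x)" by (rule sum_list_mono) (rule int_size_pos)
  then show ?thesis by (simp add: list_size_def sum_list_triv)
qed

lemma int_size_le_list_size: "x \<in> set xs \<Longrightarrow> int_size x \<le> list_size xs"
  unfolding list_size_def by (rule member_le_sum_list) auto

abbreviation verifier :: "bool \<Rightarrow> prog" where
  "verifier parity \<equiv> two_phase verifier_init (verifier_main parity)"

lemma wf_verifier:
  "wf_stm {} verifier_init" "wf_stm {2, 3} (verifier_main parity)"
  "\<not> asks verifier_init" "\<not> asks (verifier_main parity)"
  by (simp_all add: verifier_init_def verifier_main_def count_edges_def reach_round_def reach_tm_def start_tm_def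
      first_half_slot_tm_def valid_tm_def trailing_zero_tm_def bits_sorted_tm_def slot_consistent_tm_def
      glue_consistent_tm_def triangle_admissible_tm_def half_slot_tm_def half_face_tm_def full_slot_tm_def
      half_faces_tm_def half_tets_tm_def full_tets_tm_def Even_def Forall_def Count_def Eq_def Less_def
      Conj_def Disj_def Neg_def Slot_def Colour_def Adj_def Perm_def Glue_def Tet_Of_def Fst_Of_def
      Snd_Of_def Let_def)

text \<open>Here \<open>x\<close> is an arbitrary list, as \<open>sharpP\<close> requires halting in
  polynomial time on every input. Since nothing is asked of an oracle, the bounds on answers and
  query lengths are 0.\<close>

lemma exec_verifier:
  fixes x :: "int list"
  defines "X \<equiv> list_size x"
  assumes w: "w \<in> bit_strings (2 * X)"
  shows "\<exists>m k s. exec \<O> (verifier parity) (load [x, w]) m k s \<and>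
    m \<le> two_phase_time verifier_init (verifier_main parity) (2 * X) 0 (2 * X + 3) \<and>
    s 0 0 = run \<O> (verifier_main parity) (\<lambda>_. 0) (run \<O> verifier_init (\<lambda>_. 0) (load [x, w])) 0 0"
proof -
  let ?s = "load [x, w]"
  let ?s1 = "run \<O> verifier_init (\<lambda>_. 0) ?s"
  have wl: "length w = 2 * X" "set w \<subseteq> {0, 1}" using w by (auto simp: bit_strings_def)
  have "?s1 2 0 = (int (length x) - 2) div 20" "?s1 3 0 = int (length w)"
    by (simp_all add: verifier_init_def store_def load_def)
  moreover have "(int (length x) - 2) div 20 \<le> int (2 * X)"
    using length_le_list_size[of x] by (simp add: X_def)
  ultimately have le: "\<forall>v\<in>{2, 3}. ?s1 v 0 \<le> int (2 * X)" using wl by simp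
  have bits: "int_size (?s a i) \<le> 2 * X + 3" for a i
  proof (rule int_size_load)
    show "int_size y \<le> 2 * X + 3" if "ys \<in> set [x, w]" "y \<in> set ys" for ys y
    proof (cases "ys = x")
      case True
      then show ?thesis using int_size_le_list_size[of y x] that by (simp add: X_def)
    next
      case False
      then have "y = 0 \<or> y = 1" using that wl by auto
      then show ?thesis by (auto simp: int_size_def floorlog_def)
    qed
    show "length ys < 2 * X + 3" if "ys \<in> set [x, w]" for ys
      using that wl length_le_list_size[of x] by (auto simp: X_def)
  qed simp
  have "?s 10 0 = 0" by (simp add: load_def)
  obtain m k s where "exec \<O> (verifier parity) ?s m k s"
    "m \<le> two_phase_time verifier_init (verifier_main parity) (2 * X) 0 (2 * X + 3)"
    "\<forall>a<10. s a = run \<O> (verifier_main parity) (\<lambda>_. 0) ?s1 a"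
    by (rule exec_two_phase[where W = 0, OF wf_verifier(1,3,2) _ \<open>?s 10 0 = 0\<close> bits _ refl le
        safe_of_no_asks[OF wf_verifier(4)]]) simp_all
  then show ?thesis by (metis zero_less_numeral)
qed

lemma verifier_count_sharpP:
  "(\<lambda>x. card {w \<in> bit_strings (2 * list_size x). 0 < run (\<lambda>_ _. 0) (verifier_main parity) (\<lambda>_. 0)
      (run (\<lambda>_ _. 0) verifier_init (\<lambda>_. 0) (load [x, w])) 0 0}) \<in> sharpP"
proof -
  obtain p where p: "\<And>X. poly p X =
      two_phase_time verifier_init (verifier_main parity) (poly [:0, 2:] X) (poly 0 X) (poly [:3, 2:] X)"
    using two_phase_time_poly[of verifier_init "verifier_main parity" "[:0, 2:]" 0 "[:3, 2:]"] by blast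
  have args: "poly [:0, 2:] X = 2 * X" "poly 0 X = 0" "poly [:3, 2:] X = 2 * X + 3" for X :: nat
    by simp_all
  have acc: "(\<exists>n k s. exec (\<lambda>_ _. 0) (verifier parity) (load [x, w]) n k s \<and> s 0 0 > 0) \<longleftrightarrow>
      0 < run (\<lambda>_ _. 0) (verifier_main parity) (\<lambda>_. 0) (run (\<lambda>_ _. 0) verifier_init (\<lambda>_. 0) (load [x, w])) 0 0"
    if "w \<in> bit_strings (2 * list_size x)" for x w
    using exec_verifier[OF that, of "\<lambda>_ _. 0" parity] exec_deterministic by metis
  show ?thesis
    unfolding sharpP_def mem_Collect_eq
  proof (rule exI[of _ "verifier parity"], rule exI[of _ "[:0, 2:]"], rule exI[of _ p],
      intro allI conjI ballI)
    fix x w assume w: "w \<in> bit_strings (poly [:0, 2:] (list_size x))"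
    then show "\<exists>n k s. exec (\<lambda>_ _. 0) (verifier parity) (load [x, w]) n k s \<and> n \<le> poly p (list_size x)"
      using exec_verifier[of w x "\<lambda>_ _. 0" parity] unfolding p args by blast
  next
    fix x
    show "card {w \<in> bit_strings (2 * list_size x). 0 < run (\<lambda>_ _. 0) (verifier_main parity) (\<lambda>_. 0)
        (run (\<lambda>_ _. 0) verifier_init (\<lambda>_. 0) (load [x, w])) 0 0} =
      card {w \<in> bit_strings (poly [:0, 2:] (list_size x)).
        \<exists>n k s. exec (\<lambda>_ _. 0) (verifier parity) (load [x, w]) n k s \<and> s 0 0 > 0}"
      unfolding args using acc[of _ x] by (metis (mono_tags, lifting))
  qed
qed

lemma in_sharpP_counting_octagons:
  "in_sharpP {(encode_with T m, if parity then b_even T m else b_odd T m) | T m.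
     closed_3_manifold_triangulation T}"
proof -
  have "card {w \<in> bit_strings (2 * list_size (encode_with T m)). 0 < run (\<lambda>_ _. 0) (verifier_main parity) (\<lambda>_. 0)
      (run (\<lambda>_ _. 0) verifier_init (\<lambda>_. 0) (load [encode_with T m, w])) 0 0} =
    (if parity then b_even T m else b_odd T m)" if T: "closed_3_manifold_triangulation T" for T m
  proof -
    interpret gluing T by unfold_locales (use T in \<open>simp add: closed_3_manifold_triangulation_def\<close>)
    \<comment> \<open>The encoding has \<open>2 + 20 * n\<close> entries of size at least 1, so
      witnesses of twice the input size have room for the \<open>32 * n\<close> colour bits.\<close>
    have "32 * n \<le> 2 * list_size (encode_with T m)"
      using length_le_list_size[of "encode_with T m"] by (simp add: encode_with_def length_encode)
    from card_accepted[OF this] show ?thesis .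
  qed
  then show ?thesis
    unfolding in_sharpP_def by (intro bexI[OF _ verifier_count_sharpP[of parity]]) auto
qed

section \<open>The reduction\<close>

lemma poly_nat_mono: "x \<le> y \<Longrightarrow> poly p x \<le> poly p y" for p :: "nat poly"
  by (induction p) (auto intro: add_mono mult_mono)

lemma two_phase_time_mono:
  assumes "N \<le> N'" "L \<le> L'" "B \<le> B'"
  shows "two_phase_time c1 c2 N L B \<le> two_phase_time c1 c2 N' L' B'"
  unfolding two_phase_time_def step_cost_def Let_def
  by (intro mult_le_mono add_mono order_refl poly_nat_mono assms)

definition root_sign :: "nat \<Rightarrow> int" where
  "root_sign q = (if q = 1 then - 1 else 1)"

lemma minus_root2: "- complex_of_real (root2 q) = of_int (root_sign q) * of_real (sqrt 2)"
  by (simp add: root2_def root_sign_def)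

lemma minus_root2_square: "(- complex_of_real (root2 q)) * (- complex_of_real (root2 q)) = 2"
  by (metis minus_mult_minus of_real_mult of_real_numeral root2_square)

section \<open>The invariant as a sum over Euler characteristics\<close>

context gluing begin

lemma card_edges_le: "card (edges T) \<le> 16 * n"
proof -
  have "edges T \<subseteq> (\<lambda>(t, a, b). face_class T t {a, b}) ` ({..<n} \<times> {..<4} \<times> {..<4})"
    unfolding edges_alt by force
  then have "card (edges T) \<le> card ({..<n} \<times> {..<4::nat} \<times> {..<4::nat})"
    by (rule surj_card_le[rotated]) simp
  then show ?thesis by simp
qed

lemma card_triangles_le: "card (triangles T) \<le> 4 * n"
proof -
  have "card (triangles T) \<le> card ({..<n} \<times> {..<4::nat})" unfolding triangles_alt by (rule card_image_le) simp
  then show ?thesis by simp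
qed

text \<open>At most \<open>16 * n\<close> points and \<open>n\<close> discs count positively, and at
  most \<open>4 * n\<close> segments count negatively.\<close>

lemma abs_euler_char_surface_le: "\<bar>euler_char_surface T \<theta>\<bar> \<le> 17 * int n"
proof -
  have "card (surface_points T \<theta>) \<le> card (edges T)"
    by (rule card_mono[OF finite_edges]) (auto simp: surface_points_def)
  moreover have "card (surface_segments T \<theta>) \<le> card (triangles T)"
    by (rule card_mono[OF finite_triangles]) (auto simp: surface_segments_def)
  moreover have "card (triangular_discs T \<theta> \<union> quadrilateral_discs T \<theta>) \<le> card {..<n}"
    by (rule card_mono) (auto simp: triangular_discs_def quadrilateral_discs_def)
  ultimately show ?thesis
    unfolding euler_char_surface_def using card_edges_le card_triangles_le by simp
qed

text \<open>Serves to bound the lengths of the oracle answers. The three colours are rounded up to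
  four to obtain a power of 2.\<close>

lemma card_Adm_le: "card (Adm T 4) \<le> 2 ^ (32 * n)"
proof -
  have f: "{real c / 2 | c. c \<le> 4 - 2} = (\<lambda>c. real c / 2) ` {..2}" by auto
  have "card (Adm T 4) \<le> card (edges T \<rightarrow>\<^sub>E {real c / 2 | c. c \<le> 4 - 2})"
  proof (rule card_mono)
    show "finite (edges T \<rightarrow>\<^sub>E {real c / 2 | c. c \<le> 4 - 2})"
      unfolding f by (intro finite_PiE finite_edges) simp
  qed (auto simp: Adm_def)
  also have "\<dots> = card {real c / 2 | c. c \<le> 4 - 2} ^ card (edges T)"
    by (simp add: card_PiE finite_edges)
  also have "\<dots> \<le> 4 ^ card (edges T)"
  proof (rule power_mono)
    have "card ((\<lambda>c. real c / 2) ` {..2}) \<le> card {..2::nat}" by (rule card_image_le) simp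
    then show "card {real c / 2 | c. c \<le> 4 - 2} \<le> 4" unfolding f by simp
  qed simp
  also have "\<dots> \<le> 4 ^ (16 * n)" by (rule power_increasing[OF card_edges_le]) simp
  also have "\<dots> = 2 ^ (32 * n)" using power_mult[of "2::nat" 2 "16 * n"] by simp
  finally show ?thesis .
qed

lemma int_size_counts: "int_size (int (b_even T m)) \<le> 32 * n + 2" "int_size (int (b_odd T m)) \<le> 32 * n + 2"
proof -
  have size: "int_size (int (card A)) \<le> 32 * n + 2" if "A \<subseteq> Adm T 4" for A
  proof -
    have "card A \<le> 2 ^ (32 * n)" using card_mono[OF finite_Adm that] card_Adm_le by simp
    also have "\<dots> < 2 ^ (32 * n + 1)" by simp
    finally have "int (card A) < 2 ^ (32 * n + 1)"
      by (metis of_nat_less_iff of_nat_numeral of_nat_power)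
    then have "int_size (int (card A)) \<le> Suc (32 * n + 1)" unfolding int_size_le_iff by simp
    then show ?thesis by simp
  qed
  show "int_size (int (b_even T m)) \<le> 32 * n + 2" "int_size (int (b_odd T m)) \<le> 32 * n + 2"
    unfolding b_even_def b_odd_def by (rule size; blast)+
qed

definition count_diff :: "int \<Rightarrow> int" where
  "count_diff m = int (b_even T m) - int (b_odd T m)"

text \<open>Shifting all exponents by \<open>32 * M\<close> makes them nonnegative, and as
  \<open>y * y = 2\<close> the shift amounts to the denominator \<open>2 ^ (16 * M)\<close>. The
  window from \<open>- 32 * M\<close> to \<open>32 * M - 1\<close> contains every Euler
  characteristic by \<open>abs_euler_char_surface_le\<close>; taking \<open>M = n + 1\<close> keeps
  it nonempty for \<open>n = 0\<close>.\<close>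

lemma TV4_eq:
  assumes q: "q \<in> {1, 3}"
  defines "y \<equiv> - complex_of_real (root2 q)" and "M \<equiv> n + 1"
  shows "TV4 q T = (\<Sum>j<64 * M. y ^ j * of_int (count_diff (int j - 32 * int M))) / 2 ^ (16 * M)"
proof -
  define ec where "ec \<theta> = euler_char_surface T (reduction T \<theta>)" for \<theta>
  define g where "g \<theta> = nat (ec \<theta> + 32 * int M)" for \<theta>
  have g: "g \<theta> < 64 * M" "int (g \<theta>) = ec \<theta> + 32 * int M" for \<theta>
  proof -
    have "\<bar>ec \<theta>\<bar> \<le> 17 * int n" unfolding ec_def by (rule abs_euler_char_surface_le)
    then show "g \<theta> < 64 * M" "int (g \<theta>) = ec \<theta> + 32 * int M" by (simp_all add: g_def M_def)
  qed
  have y: "y \<noteq> 0" "y * y = 2" using minus_root2_square by (auto simp: y_def root2_def)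
  have y32: "y ^ (32 * M) = 2 ^ (16 * M)"
    using power_mult[of y 2 "16 * M"] y(2) by (simp add: power2_eq_square)
  have powi: "y powi (int j - 32 * int M) = y ^ j / 2 ^ (16 * M)" for j
    using y(1) power_int_diff[of y "int j" "int (32 * M)"] by (simp flip: y32 add: power_int_of_nat del: of_nat_mult)
       (simp add: of_nat_mult flip: power_int_of_nat)
  have signs: "(\<Sum>\<theta>\<in>{\<theta> \<in> Adm T 4. ec \<theta> = m}. (-1) ^ card (octagons T \<theta>)) = (of_int (count_diff m) :: complex)" for m
  proof -
    have "(\<Sum>\<theta>\<in>{\<theta> \<in> Adm T 4. ec \<theta> = m}. (-1) ^ card (octagons T \<theta>)) =
        (\<Sum>\<theta>\<in>{\<theta> \<in> Adm T 4. ec \<theta> = m}. if even (card (octagons T \<theta>)) then 1 else - 1 :: complex)"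
      by (intro sum.cong) (auto simp: neg_one_even_power neg_one_odd_power)
    also have "\<dots> = of_nat (card {\<theta> \<in> {\<theta> \<in> Adm T 4. ec \<theta> = m}. even (card (octagons T \<theta>))}) -
        of_nat (card {\<theta> \<in> {\<theta> \<in> Adm T 4. ec \<theta> = m}. odd (card (octagons T \<theta>))})"
      using finite_Adm[of 4] by (subst sum.If_cases) (auto simp: Int_def Collect_neg_eq[symmetric])
    also have "\<dots> = of_int (count_diff m)"
      unfolding count_diff_def b_even_def b_odd_def ec_def by (simp add: conj_ac)
    finally show ?thesis .
  qed
  have "TV4 q T = (\<Sum>\<theta>\<in>Adm T 4. y powi ec \<theta> * (-1) ^ card (octagons T \<theta>))"
    unfolding TV4_def by (intro sum.cong refl) (simp add: weight_eq[OF _ q] y_def ec_def)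
  also have "\<dots> = (\<Sum>j<64 * M. \<Sum>\<theta>\<in>{\<theta> \<in> Adm T 4. g \<theta> = j}. y powi ec \<theta> * (-1) ^ card (octagons T \<theta>))"
    by (rule sum.group[symmetric]) (use g finite_Adm in auto)
  also have "\<dots> = (\<Sum>j<64 * M. y powi (int j - 32 * int M) * of_int (count_diff (int j - 32 * int M)))"
  proof (rule sum.cong, rule refl)
    fix j
    have "g \<theta> = j \<longleftrightarrow> ec \<theta> = int j - 32 * int M" for \<theta> using g(2)[of \<theta>] by linarith
    then have "(\<Sum>\<theta>\<in>{\<theta> \<in> Adm T 4. g \<theta> = j}. y powi ec \<theta> * (-1) ^ card (octagons T \<theta>)) =
        (\<Sum>\<theta>\<in>{\<theta> \<in> Adm T 4. ec \<theta> = int j - 32 * int M}. y powi (int j - 32 * int M) * (-1) ^ card (octagons T \<theta>))"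
      by (intro sum.cong) auto
    then show "(\<Sum>\<theta>\<in>{\<theta> \<in> Adm T 4. g \<theta> = j}. y powi ec \<theta> * (-1) ^ card (octagons T \<theta>)) =
        y powi (int j - 32 * int M) * of_int (count_diff (int j - 32 * int M))"
      by (simp only: sum_distrib_left[symmetric] signs)
  qed
  finally show ?thesis unfolding powi by (simp add: sum_divide_distrib)
qed

end

text \<open>Arrays: 1 query, 2 the number \<open>N\<close> of tetrahedra plus 1, 3 and 4 answers, 5 and 6 the coefficients
  of 1 and \<open>\<surd>2\<close> of the Horner scheme at \<open>\<plusminus>\<surd>2\<close>, 7 denominator. The queries run through
  \<open>m = 32 N - 1, \<dots>, -32 N\<close>, which covers all Euler characteristics also when \<open>N = 1\<close>.\<close>

definition horner_step :: "int \<Rightarrow> stm" where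
  "horner_step \<delta> = Then (Ask 0 1 3) (Then (Ask 1 1 4)
    (Then (Assign 8 (Num 0) (Plus (Scale (2 * \<delta>) (Arr 6 (Num 0))) (Minus (Arr 3 (Num 0)) (Arr 4 (Num 0)))))
    (Then (Assign 6 (Num 0) (Scale \<delta> (Arr 5 (Num 0))))
    (Then (Assign 5 (Num 0) (Arr 8 (Num 0)))
      (Assign 1 (Num 1) (Minus (Arr 1 (Num 1)) (Num 1)))))))"

text \<open>The encoding moves up by one place to make room for \<open>m\<close> in front. With
  \<open>N = n + 1\<close> the loop covers \<open>20 * n + 20\<close> cells, enough for the
  \<open>2 + 20 * n\<close> entries and their length; what it puts at indices 0 and 1 is replaced by
  the length and the first \<open>m\<close>.\<close>

definition copy_query :: stm where
  "copy_query = Then (For 0 (Times 20 2) (Assign 1 (Var 0) (Arr 0 (Minus (Var 0) (Num 1)))))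
    (Then (Assign 1 (Num 0) (Plus (Arr 0 (Num 0)) (Num 1)))
      (Assign 1 (Num 1) (Minus (Scale 32 (Arr 2 (Num 0))) (Num 1))))"

text \<open>The denominator is produced by repeated doubling, since the language has neither powers
  nor products of variables. The result then replaces the instance in array 0, in list
  format.\<close>

definition write_result :: stm where
  "write_result = Then (Assign 7 (Num 0) (Num 1))
    (Then (For 0 (Times 16 2) (Assign 7 (Num 0) (Plus (Arr 7 (Num 0)) (Arr 7 (Num 0)))))
    (Then (Assign 0 (Num 1) (Arr 5 (Num 0)))
    (Then (Assign 0 (Num 2) (Arr 6 (Num 0)))
    (Then (Assign 0 (Num 3) (Arr 7 (Num 0)))
      (Assign 0 (Num 0) (Num 3))))))"

text \<open>An encoding has \<open>1 + 20 * n\<close> entries; adding 19 before the division yields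
  exactly \<open>n + 1\<close>.\<close>

definition reduction_init :: stm where
  "reduction_init = Assign 2 (Num 0) (Quot (Plus (Arr 0 (Num 0)) (Num 19)) (Num 20))"

definition reduction_main :: "int \<Rightarrow> stm" where
  "reduction_main \<delta> = Then copy_query (Then (For 0 (Times 64 2) (horner_step \<delta>)) write_result)"

section \<open>Correctness of the Horner scheme\<close>

lemma safe_For_invariant:
  assumes "P 0 s" and "\<And>i s'. i < bound_val s b \<Longrightarrow> P i s' \<Longrightarrow>
      safe \<O> W L c (\<rho>(x := int i)) s' \<and> P (Suc i) (run \<O> c (\<rho>(x := int i)) s')"
  shows "safe \<O> W L (For x b c) \<rho> s \<and> P (bound_val s b) (run \<O> (For x b c) \<rho> s)"
proof -
  have P: "k \<le> bound_val s b \<Longrightarrow> P k (fold (\<lambda>i. run \<O> c (\<rho>(x := int i))) [0..<k] s)" for k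
    by (induction k) (use assms in auto)
  then show ?thesis using assms(2) by simp
qed

context gluing begin

definition query_array :: "int \<Rightarrow> (int \<Rightarrow> int) \<Rightarrow> bool" where
  "query_array m v \<longleftrightarrow> v 0 = 2 + 20 * int n \<and> v 1 = m \<and> (\<forall>k<1 + 20 * n. v (int k + 2) = encode T ! k)"

lemma read_query: "query_array m (s a) \<Longrightarrow> read_list s a = encode_with T m"
proof (rule nth_equalityI)
  assume q: "query_array m (s a)"
  then have l: "length (read_list s a) = 2 + 20 * n" by (simp add: read_list_def query_array_def)
  then show "length (read_list s a) = length (encode_with T m)" by (simp add: encode_with_def length_encode)
  fix i assume "i < length (read_list s a)"
  with l have i: "i < 2 + 20 * n" by simp
  have "nat (s a 0) = 2 + 20 * n" using q by (simp add: query_array_def)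
  then have "read_list s a ! i = s a (int i + 1)" unfolding read_list_def using i by (simp del: upt_Suc)
  also have "\<dots> = encode_with T m ! i"
  proof (cases i)
    case 0
    then show ?thesis using q by (simp add: query_array_def encode_with_def)
  next
    case (Suc k)
    then have "s a (int k + 2) = encode T ! k" using q i by (simp add: query_array_def)
    then show ?thesis using Suc by (simp add: encode_with_def add.commute)
  qed
  finally show "read_list s a ! i = encode_with T m ! i" .
qed

lemma run_copy_query:
  assumes "\<And>k. k < 1 + 20 * n \<Longrightarrow> s 0 (int k + 1) = encode T ! k" "s 0 0 = 1 + 20 * int n" "s 2 0 = int (n + 1)"
  shows "\<exists>v. run \<O> copy_query \<rho> s = s(1 := v) \<and> query_array (32 * int (n + 1) - 1) v"
proof -
  define v where "v = (\<lambda>i. if 0 \<le> i \<and> i < int (20 * (n + 1)) then s 0 (i - 1) else s 1 i)"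
  have b: "bound_val s (Times 20 2) = 20 * (n + 1)" using assms(3) by (simp add: nat_mult_distrib)
  have "run \<O> (For 0 (Times 20 2) (Assign 1 (Var 0) (Arr 0 (Minus (Var 0) (Num 1))))) \<rho> s = s(1 := v)"
    unfolding v_def b[symmetric] by (subst run_For_Assign) (simp_all cong: if_cong)
  then have "run \<O> copy_query \<rho> s = s(1 := v(0 := 2 + 20 * int n, 1 := 32 * int (n + 1) - 1))"
    unfolding copy_query_def run.simps(2) using assms by (simp add: store_def)
  moreover have "query_array (32 * int (n + 1) - 1) (v(0 := 2 + 20 * int n, 1 := 32 * int (n + 1) - 1))"
    unfolding query_array_def
  proof (intro conjI allI impI)
    fix k assume k: "k < 1 + 20 * n"
    have "int k + 2 - 1 = int k + 1" by simp
    then have "v (int k + 2) = s 0 (int k + 1)" using k by (simp add: v_def add.commute)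
    then show "(v(0 := 2 + 20 * int n, 1 := 32 * int (n + 1) - 1)) (int k + 2) = encode T ! k"
      using assms(1)[OF k] by simp
  qed simp_all
  ultimately show ?thesis by blast
qed

text \<open>Horner's scheme consumes coefficients from the top: after \<open>i\<close> rounds it has
  absorbed the \<open>i\<close> largest values of \<open>m\<close>, and the query array already
  holds the next smaller one.\<close>

definition horner_invariant :: "nat \<Rightarrow> nat \<Rightarrow> memory \<Rightarrow> bool" where
  "horner_invariant q i s \<longleftrightarrow> query_array (32 * int (n + 1) - 1 - int i) (s 1) \<and>
    of_int (s 5 0) + of_int (s 6 0) * complex_of_real (sqrt 2) =
      (\<Sum>k<i. (- of_real (root2 q)) ^ (i - 1 - k) * of_int (count_diff (32 * int (n + 1) - 1 - int k))) \<and>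
    s 2 0 = int (n + 1)"

text \<open>The base -x is \<delta> sqrt 2 with \<delta> = \<open>root_sign q\<close>, so
  multiplication by it sends a + b sqrt 2 to 2 \<delta> b + \<delta> a sqrt 2 and stays in integers.
  Array 8 buffers the new first coefficient while the old one is still needed. Safety of the two
  queries uses \<open>int_size_counts\<close> for the answers and the length
  \<open>2 + 20 * n\<close> of the query.\<close>

lemma horner_step_invariant:
  assumes O: "\<And>m. \<O> 0 (encode_with T m) = int (b_even T m)" "\<And>m. \<O> 1 (encode_with T m) = int (b_odd T m)"
    and inv: "horner_invariant q i s"
  shows "safe \<O> (32 * n + 2) (20 * n + 2) (horner_step (root_sign q)) \<rho> s \<and>
    horner_invariant q (Suc i) (run \<O> (horner_step (root_sign q)) \<rho> s)"
proof -
  define m where "m = 32 * int (n + 1) - 1 - int i"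
  define y where "y = - complex_of_real (root2 q)"
  have q: "query_array m (s 1)" using inv by (simp add: horner_invariant_def m_def)
  then have q0: "s 1 0 = 2 + 20 * int n" "s 1 1 = m" by (simp_all add: query_array_def)
  define s1 where "s1 = store s 3 0 (int (b_even T m))"
  define s2 where "s2 = store s1 4 0 (int (b_odd T m))"
  have r: "read_list s 1 = encode_with T m" "read_list s1 1 = encode_with T m"
    by (rule read_query; use q in \<open>simp add: s1_def store_def\<close>)+
  have run12: "run \<O> (Ask 0 1 3) \<rho> s = s1" "run \<O> (Ask 1 1 4) \<rho> s1 = s2"
    using r O by (simp_all add: s1_def s2_def)
  have "safe \<O> (32 * n + 2) (20 * n + 2) (Ask 0 1 3) \<rho> s" "safe \<O> (32 * n + 2) (20 * n + 2) (Ask 1 1 4) \<rho> s1"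
    using r O int_size_counts q0 by (simp_all add: s1_def store_def)
  then have safe: "safe \<O> (32 * n + 2) (20 * n + 2) (horner_step (root_sign q)) \<rho> s"
    unfolding horner_step_def safe.simps(2) run12 by simp
  define s3 where "s3 = run \<O> (horner_step (root_sign q)) \<rho> s"
  have s3: "s3 5 0 = 2 * root_sign q * s 6 0 + count_diff m" "s3 6 0 = root_sign q * s 5 0"
     "s3 2 0 = s 2 0" "s3 1 = (s 1)(1 := m - 1)"
    unfolding s3_def horner_step_def run.simps(2) run12
    using q0 by (simp_all add: s1_def s2_def store_def count_diff_def)
  have "query_array (m - 1) (s3 1)" using q unfolding s3 query_array_def by auto
  moreover have "of_int (s3 5 0) + of_int (s3 6 0) * complex_of_real (sqrt 2) =
      (\<Sum>k<Suc i. y ^ (Suc i - 1 - k) * of_int (count_diff (32 * int (n + 1) - 1 - int k)))"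
  proof -
    have y: "y = of_int (root_sign q) * of_real (sqrt 2)" unfolding y_def by (rule minus_root2)
    have sq: "complex_of_real (sqrt 2) * complex_of_real (sqrt 2) = 2"
      by (metis of_real_mult of_real_numeral real_sqrt_mult_self abs_numeral)
    have "of_int (s3 5 0) + of_int (s3 6 0) * complex_of_real (sqrt 2) =
        y * (of_int (s 5 0) + of_int (s 6 0) * complex_of_real (sqrt 2)) + of_int (count_diff m)"
      unfolding s3 y of_int_add of_int_mult distrib_left by (simp add: sq[symmetric] algebra_simps)
    also have "of_int (s 5 0) + of_int (s 6 0) * complex_of_real (sqrt 2) =
        (\<Sum>k<i. y ^ (i - 1 - k) * of_int (count_diff (32 * int (n + 1) - 1 - int k)))"
      using inv by (simp add: horner_invariant_def y_def)
    also have "y * \<dots> = (\<Sum>k<i. y ^ (i - k) * of_int (count_diff (32 * int (n + 1) - 1 - int k)))"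
      unfolding sum_distrib_left
    proof (rule sum.cong, rule refl)
      fix k assume "k \<in> {..<i}"
      then have "i - k = Suc (i - 1 - k)" by simp
      then show "y * (y ^ (i - 1 - k) * of_int (count_diff (32 * int (n + 1) - 1 - int k))) =
          y ^ (i - k) * of_int (count_diff (32 * int (n + 1) - 1 - int k))"
        by (simp only: power_Suc mult.assoc)
    qed
    finally show ?thesis by (simp add: m_def)
  qed
  moreover have "s3 2 0 = int (n + 1)" using inv s3(3) by (simp add: horner_invariant_def)
  ultimately have "horner_invariant q (Suc i) s3"
    unfolding horner_invariant_def y_def[symmetric] by (simp add: m_def algebra_simps)
  then show ?thesis using safe by (simp add: s3_def)
qed

lemma run_write_result:
  assumes "s 2 0 = int (n + 1)"
  shows "read_list (run \<O> write_result \<rho> s) 0 = [s 5 0, s 6 0, 2 ^ (16 * (n + 1))]"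
proof -
  define s1 where "s1 = store s 7 0 1"
  define s2 where "s2 = run \<O> (For 0 (Times 16 2) (Assign 7 (Num 0) (Plus (Arr 7 (Num 0)) (Arr 7 (Num 0))))) \<rho> s1"
  define P where "P i s' \<longleftrightarrow> s' 7 0 = 2 ^ i \<and> s' 5 = s 5 \<and> s' 6 = s 6" for i and s' :: memory
  have b: "bound_val s1 (Times 16 2) = 16 * (n + 1)" using assms by (simp add: s1_def store_def nat_mult_distrib)
  have "P (bound_val s1 (Times 16 2)) s2"
    unfolding s2_def by (rule run_For_invariant) (auto simp: P_def s1_def store_def)
  then have s2: "s2 7 0 = 2 ^ (16 * (n + 1))" "s2 5 = s 5" "s2 6 = s 6" unfolding b by (simp_all add: P_def)
  define s3 where "s3 = run \<O> write_result \<rho> s"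
  have "s3 0 0 = 3" "s3 0 1 = s 5 0" "s3 0 2 = s 6 0" "s3 0 3 = 2 ^ (16 * (n + 1))"
    unfolding s3_def write_result_def run.simps(2) 
    unfolding run.simps(1)[of _ 7] val.simps(1) s1_def[symmetric] s2_def[symmetric]
    using s2 by (simp_all add: store_def)
  then have "read_list s3 0 = [s 5 0, s 6 0, 2 ^ (16 * (n + 1))]"
    by (simp add: read_list_def upt_rec numeral_eq_Suc)
  then show ?thesis by (simp add: s3_def)
qed

lemma run_reduction:
  assumes q: "q \<in> {1, 3}"
    and O: "\<And>m. \<O> 0 (encode_with T m) = int (b_even T m)" "\<And>m. \<O> 1 (encode_with T m) = int (b_odd T m)"
  defines "s \<equiv> run \<O> reduction_init (\<lambda>_. 0) (load [encode T])"
  shows "s 2 0 = int (n + 1)"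
    and "safe \<O> (32 * n + 2) (20 * n + 2) (reduction_main (root_sign q)) (\<lambda>_. 0) s"
    and "represents (read_list (run \<O> (reduction_main (root_sign q)) (\<lambda>_. 0) s) 0) (TV4 q T)"
proof -
  let ?\<rho> = "\<lambda>_. 0 :: int"
  have s: "s = (load [encode T])(2 := (load [encode T] 2)(0 := int (n + 1)))"
    unfolding s_def reduction_init_def by (simp add: store_def load_def length_encode) 
  then show s20: "s 2 0 = int (n + 1)" by simp
  have "s 0 (int k + 1) = encode T ! k" if "k < 1 + 20 * n" for k
    using that by (simp add: s load_def length_encode)
  moreover have "s 0 0 = 1 + 20 * int n" by (simp add: s load_def length_encode)
  ultimately obtain v where v: "run \<O> copy_query ?\<rho> s = s(1 := v)" "query_array (32 * int (n + 1) - 1) v"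
    using run_copy_query[of s \<O> ?\<rho>] s20 by blast
  define s1 where "s1 = run \<O> copy_query ?\<rho> s"
  define c where "c = For 0 (Times 64 2) (horner_step (root_sign q))"
  define s2 where "s2 = run \<O> c ?\<rho> s1"
  have h0: "horner_invariant q 0 s1"
    using v by (simp add: horner_invariant_def s1_def s load_def)
  have b: "bound_val s1 (Times 64 2) = 64 * (n + 1)"
    using v s20 by (simp add: s1_def nat_mult_distrib)
  have loop: "safe \<O> (32 * n + 2) (20 * n + 2) c ?\<rho> s1 \<and> horner_invariant q (bound_val s1 (Times 64 2)) s2"
    unfolding s2_def c_def by (rule safe_For_invariant[of "horner_invariant q"]) (use h0 horner_step_invariant[OF O] in auto)
  have na: "\<not> asks copy_query" "\<not> asks write_result" by (simp_all add: copy_query_def write_result_def)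
  show "safe \<O> (32 * n + 2) (20 * n + 2) (reduction_main (root_sign q)) ?\<rho> s"
    unfolding reduction_main_def safe.simps(2) c_def[symmetric] s1_def[symmetric] s2_def[symmetric]
    using loop safe_of_no_asks na by blast
  define y where "y = - complex_of_real (root2 q)"
  define M where "M = n + 1"
  have h: "horner_invariant q (64 * M) s2" using loop b by (simp add: M_def)
  have "of_int (s2 5 0) + of_int (s2 6 0) * complex_of_real (sqrt 2) =
      (\<Sum>k<64 * M. y ^ (64 * M - 1 - k) * of_int (count_diff (32 * int M - 1 - int k)))"
    using h by (simp add: horner_invariant_def y_def M_def)
  \<comment> \<open>The scheme ran downwards in \<open>m\<close>; in this form the summation order
    can be reversed to match \<open>TV4_eq\<close>.\<close>
  also have "\<dots> = (\<Sum>k<64 * M. y ^ (64 * M - Suc k) * of_int (count_diff (int (64 * M - Suc k) - 32 * int M)))"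
  proof (rule sum.cong, rule refl)
    fix k assume "k \<in> {..<64 * M}"
    then have "int (64 * M - Suc k) - 32 * int M = 32 * int M - 1 - int k" "64 * M - 1 - k = 64 * M - Suc k"
      by (simp_all add: of_nat_diff)
    then show "y ^ (64 * M - 1 - k) * of_int (count_diff (32 * int M - 1 - int k)) =
        y ^ (64 * M - Suc k) * of_int (count_diff (int (64 * M - Suc k) - 32 * int M))" by (simp only:)
  qed
  also have "\<dots> = (\<Sum>j<64 * M. y ^ j * of_int (count_diff (int j - 32 * int M)))"
    by (rule sum.nat_diff_reindex)
  finally have "TV4 q T = (of_int (s2 5 0) + of_int (s2 6 0) * complex_of_real (sqrt 2)) / 2 ^ (16 * M)"
    using TV4_eq[OF q] by (simp add: y_def M_def)
  moreover have "run \<O> (reduction_main (root_sign q)) ?\<rho> s = run \<O> write_result ?\<rho> s2"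
    unfolding reduction_main_def run.simps(2) c_def[symmetric] s1_def[symmetric] s2_def[symmetric] ..
  moreover have "read_list (run \<O> write_result ?\<rho> s2) 0 = [s2 5 0, s2 6 0, 2 ^ (16 * M)]"
    using run_write_result[of s2] h by (simp add: horner_invariant_def M_def)
  ultimately show "represents (read_list (run \<O> (reduction_main (root_sign q)) ?\<rho> s) 0) (TV4 q T)"
    unfolding represents_def by auto
qed

end

abbreviation reduction_prog :: "nat \<Rightarrow> prog" where
  "reduction_prog q \<equiv> two_phase reduction_init (reduction_main (root_sign q))"

lemma wf_reduction:
  "wf_stm {} reduction_init" "wf_stm {2} (reduction_main \<delta>)" "\<not> asks reduction_init"
  by (simp_all add: reduction_init_def reduction_main_def copy_query_def horner_step_def write_result_def)

lemma TV4_reduces: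
  assumes q: "q \<in> {1, 3}"
  shows "reduces_by_poly_calls (TV4 q) counting_even_octagons counting_odd_octagons"
proof -
  let ?steps = "two_phase_steps reduction_init (reduction_main (root_sign q))"
  \<comment> \<open>Since \<open>X\<close> is at least \<open>1 + 20 * n\<close>, the polynomial
    \<open>X + 1\<close> dominates both the loop bound \<open>n + 1\<close> and the query length
    \<open>20 * n + 2\<close>.\<close>
  obtain p where p: "\<And>X. poly p X = two_phase_time reduction_init (reduction_main (root_sign q))
      (poly [:1, 1:] X) (poly [:1, 1:] X) (poly [:3, 2:] X)"
    using two_phase_time_poly[of reduction_init "reduction_main (root_sign q)" "[:1, 1:]" "[:1, 1:]" "[:3, 2:]"]
    by blast
  show ?thesis
    unfolding reduces_by_poly_calls_def
  \<comment> \<open>Each oracle call is one step, so the step polynomial at \<open>n + 1\<close>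
    bounds the calls by a function of \<open>n\<close> alone, whereas the time polynomial is taken
    in the size of the encoding.\<close>
  proof (rule exI[of _ "reduction_prog q"], rule exI[of _ p], rule exI[of _ "pcompose ?steps [:1, 1:]"],
      intro allI impI)
    fix T and \<O> :: "nat \<Rightarrow> int list \<Rightarrow> int"
    assume T: "closed_3_manifold_triangulation T"
      and "solves (\<O> 0) counting_even_octagons \<and> solves (\<O> 1) counting_odd_octagons"
    then have O: "\<And>m. \<O> 0 (encode_with T m) = int (b_even T m)" "\<And>m. \<O> 1 (encode_with T m) = int (b_odd T m)"
      unfolding solves_def counting_even_octagons_def counting_odd_octagons_def by blast+
    interpret gluing T by unfold_locales (use T in \<open>simp add: closed_3_manifold_triangulation_def\<close>)
    define X where "X = list_size (encode T)"
    have X: "1 + 20 * n \<le> X" using length_le_list_size[of "encode T"] by (simp add: X_def length_encode)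
    let ?s = "load [encode T]"
    note red = run_reduction[where \<O> = \<O>, OF q O]
    have bits: "int_size (?s a i) \<le> 2 * X + 3" for a i
    proof (rule int_size_load)
      show "int_size y \<le> 2 * X + 3" if "ys \<in> set [encode T]" "y \<in> set ys" for ys y
        using int_size_le_list_size[of y "encode T"] that by (simp add: X_def)
      show "length ys < 2 * X + 3" if "ys \<in> set [encode T]" for ys
        using that length_le_list_size[of "encode T"] by (simp add: X_def)
    qed simp
    have "?s 10 0 = 0" by (simp add: load_def)
    obtain m k s where 1: "exec \<O> (reduction_prog q) ?s m k s" "k \<le> poly ?steps (n + 1)"
      "m \<le> two_phase_time reduction_init (reduction_main (root_sign q)) (n + 1) (20 * n + 2) (2 * X + 3)"
      "\<forall>a<10. s a = run \<O> (reduction_main (root_sign q)) (\<lambda>_. 0) (run \<O> reduction_init (\<lambda>_. 0) ?s) a"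
      by (rule exec_two_phase[OF wf_reduction(1,3,2) _ \<open>?s 10 0 = 0\<close> bits _ refl _ red(2), of "n + 1"])
        (use red(1) X in simp_all)
    have "m \<le> poly p X"
      unfolding p by (rule order_trans[OF 1(3) two_phase_time_mono]) (use X in auto)
    moreover have "read_list s 0 =
        read_list (run \<O> (reduction_main (root_sign q)) (\<lambda>_. 0) (run \<O> reduction_init (\<lambda>_. 0) ?s)) 0"
      using 1(4) by (simp add: read_list_def)
    moreover have "k \<le> poly (pcompose ?steps [:1, 1:]) n" using 1(2) by (simp add: poly_pcompose)
    ultimately show "\<exists>m k s. exec \<O> (reduction_prog q) ?s m k s \<and> m \<le> poly p (list_size (encode T)) \<and>
        k \<le> poly (pcompose ?steps [:1, 1:]) n \<and> represents (read_list s 0) (TV4 q T)"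
      using 1(1) red(3) unfolding X_def by metis
  qed
qed

theorem mainTheorem2:
  shows "(\<forall>q \<in> {1, 3}.
            reduces_by_poly_calls (TV4 q) counting_even_octagons counting_odd_octagons) \<and>
         in_sharpP counting_even_octagons \<and>
         in_sharpP counting_odd_octagons"
  using TV4_reduces in_sharpP_counting_octagons[of True] in_sharpP_counting_octagons[of False]
  unfolding counting_even_octagons_def counting_odd_octagons_def by auto

end
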